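(* Let $\mathfrak g=\mathfrak{osp}(1,2)$, let $n\in\mathbb Z_+$ and $N\in\mathbb N$, and write $n=kN+j$ with $k\in\mathbb Z_+$ and $0\le j<N$. Then there are isomorphisms of $\mathbf U(\mathfrak g[t])$-modules: (1) $W(n,N)\cong V(k)^{*(N-j)}*V(k+1)^{*j}$; (2) $W(n)\cong D(1,n)$; (3) $D(N,n)\cong V(N)^{*k}*V(j)$.
   Context: All spaces are over $\mathbb C$; $\mathbb Z_+$ = non-negative integers, $\mathbb N$ = positive integers. $\mathfrak g=\mathfrak{osp}(1,2)=\mathfrak g_0\oplus\mathfrak g_1$ has positive even root $\alpha=2\delta_1$ and positive odd root $\delta_1$; $x_{\beta}^{\pm}$ ($\beta\in\{\delta_1,2\delta_1\}$) are Chevalley generators of the root spaces $\mathfrak g_{\pm\beta}$, $h_\alpha=[x_\alpha^+,x_\alpha^-]$ spans the Cartan subalgebra $\mathfrak h_0$, and $\delta_1(h_\alpha)=1$. $\mathfrak g_0=\mathrm{span}\{x_\alpha^+,x_\alpha^-,h_\alpha\}\cong\mathfrak{sl}_2$, and $\mathfrak n^+=\mathrm{span}\{x_{\delta_1}^+,x_{2\delta_1}^+\}$. $\mathfrak g[t]=\mathfrak g\otimes\mathbb C[t]$ is the current superalgebra, and $\mathbf U(\mathfrak g[t])$ its universal enveloping algebra, graded by powers of $t$. For $m\in\mathbb Z_+$, $V(m)$ is the irreducible $\mathfrak g$-module of highest weight $m\delta_1$ (of dimension $2m+1$). Fusion product. Let $V_1,\dots,V_r$ be finite-dimensional cyclic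 $\mathfrak g$-modules with homogeneous cyclic vectors $v_1,\dots,v_r$ (for $V(m)$, the highest weight vector), and $z_1,\dots,z_r\in\mathbb C$ pairwise distinct. Let $V_i^{z_i}$ be the $\mathfrak g[t]$-module $V_i$ with $(x\otimes f).w=f(z_i)x.w$. The tensor product $V_1^{z_1}\otimes\cdots\otimes V_r^{z_r}$ (with the usual super sign rule) is a cyclic $\mathbf U(\mathfrak g[t])$-module generated by $v_1\otimes\cdots\otimes v_r$. With $\mathbf U(\mathfrak g[t])[m]$ the degree $m$ component, filter it by $\mathbf V^j=\sum_{m=0}^j\mathbf U(\mathfrak g[t])[m](v_1\otimes\cdots\otimes v_r)$; the associated graded $\mathbf U(\mathfrak g[t])$-module is the fusion product $V_1*\cdots*V_r$ (the parameters are omitted from the notation; the statement is for any choice of pairwise distinct parameters). $V^{*a}$ means that $V$ appears $a$ times in the fusion product. Local Weyl module $W(n)$: the $\mathfrak g[t]$-module generated by a non-zero $w_n$ with defining relations $\mathfrak n^+[t]w_n=0$, $(h_\alpha\otimes t^r)w_n=n\delta_{r,0}w_n$ for all $r\in\mathbb Z_+$, $(x_\alpha^-\otimes1)^{n+1}w_n=0$. Truncated Weyl module $W(n,N)$: the $\mathfrak g[t]$-module generated by a non-zero $w_{n,N}$ with defining relations $\mathfrak n^+[t]w_{n,N}=0$, $(h_\alpha\otimes t^r)w_{n,N}=n\delta_{r,0}w_{n,N}$ for all $r\in\mathbb Z_+$, $(x_\alpha^-\otimes1)^{n+1}w_{n,N}=0$, $(\mathfrak g\otimes t^N\mathbb C[t])w_{n,N}=0$.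 Demazure type module $D(\ell,n)$ ($\ell\in\mathbb N$): the $\mathfrak g[t]$-module generated by a non-zero $v_{\ell,n}$ with defining relations $\mathfrak n^+[t]v_{\ell,n}=0$, $(h_\alpha\otimes t^r)v_{\ell,n}=n\delta_{r,0}v_{\ell,n}$, $(x_\alpha^-\otimes t^r)^{\max\{0,\,n-\ell r\}+1}v_{\ell,n}=0$ for all $r\in\mathbb Z_+$. *)

theory Defs
  imports
    "HOL-Analysis.Determinants"
    "HOL-Algebra.Module"
    "HOL-Algebra.AbelCoset"
    "HOL-Library.Poly_Mapping"
begin

section \<open>The Lie superalgebra osp(1,2) and its current superalgebra\<close>

text \<open>Basis of root vectors: \<open>Xap\<close>, \<open>Xam\<close> span the root spaces of the even roots
  \<open>\<plusminus>\<alpha> = \<plusminus>2\<delta>\<^sub>1\<close>, \<open>Xdp\<close>, \<open>Xdm\<close> those of the odd roots \<open>\<plusminus>\<delta>\<^sub>1\<close>, and \<open>Hal = [Xap, Xam]\<close>.\<close>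

datatype osp = Xap | Xam | Hal | Xdp | Xdm

instance osp :: finite
proof
  have "(UNIV :: osp set) \<subseteq> {Xap, Xam, Hal, Xdp, Xdm}"
    using osp.exhaust by blast
  thus "finite (UNIV :: osp set)"
    by (rule finite_subset) simp
qed

fun osp_odd :: "osp \<Rightarrow> bool" where
  "osp_odd Xdp = True"
| "osp_odd Xdm = True"
| "osp_odd _ = False"

text \<open>Superbracket of two basis elements, as a formal linear combination of the basis.
  It is checked against a matrix realisation in \<open>osp_bracket_matrix\<close> below.\<close>

fun osp_bracket :: "osp \<Rightarrow> osp \<Rightarrow> (osp \<Rightarrow>\<^sub>0 complex)" where
  "osp_bracket Xap Xap = 0"
| "osp_bracket Xap Xam = Poly_Mapping.single Hal 1"
| "osp_bracket Xap Hal = Poly_Mapping.single Xap (-2)"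
| "osp_bracket Xap Xdp = 0"
| "osp_bracket Xap Xdm = Poly_Mapping.single Xdp (-1)"
| "osp_bracket Xam Xap = Poly_Mapping.single Hal (-1)"
| "osp_bracket Xam Xam = 0"
| "osp_bracket Xam Hal = Poly_Mapping.single Xam 2"
| "osp_bracket Xam Xdp = Poly_Mapping.single Xdm (-1)"
| "osp_bracket Xam Xdm = 0"
| "osp_bracket Hal Xap = Poly_Mapping.single Xap 2"
| "osp_bracket Hal Xam = Poly_Mapping.single Xam (-2)"
| "osp_bracket Hal Hal = 0"
| "osp_bracket Hal Xdp = Poly_Mapping.single Xdp 1"
| "osp_bracket Hal Xdm = Poly_Mapping.single Xdm (-1)"
| "osp_bracket Xdp Xap = 0"
| "osp_bracket Xdp Xam = Poly_Mapping.single Xdm 1"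
| "osp_bracket Xdp Hal = Poly_Mapping.single Xdp (-1)"
| "osp_bracket Xdp Xdp = Poly_Mapping.single Xap 2"
| "osp_bracket Xdp Xdm = Poly_Mapping.single Hal 1"
| "osp_bracket Xdm Xap = Poly_Mapping.single Xdp 1"
| "osp_bracket Xdm Xam = 0"
| "osp_bracket Xdm Hal = Poly_Mapping.single Xdm 1"
| "osp_bracket Xdm Xdp = Poly_Mapping.single Hal 1"
| "osp_bracket Xdm Xdm = Poly_Mapping.single Xam (-2)"

text \<open>Koszul sign \<open>(-1)\<^bsup>|x||y|\<^esup>\<close>.\<close>

definition ksign :: "bool \<Rightarrow> bool \<Rightarrow> complex" where
  "ksign p q = (if p \<and> q then -1 else 1)"

text \<open>\<open>osp(1,2)\<close> inside \<open>gl(1|2)\<close>: coordinate 1 is even, coordinates 2 and 3 are odd, and the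
  homogeneous elements \<open>X\<close> of parity \<open>p\<close> are those of that parity which satisfy
  \<open>B(Xv,w) + (-1)\<^bsup>p|v|\<^esup> B(v,Xw) = 0\<close> for the even supersymmetric form \<open>B\<close> with
  Gram matrix \<open>osp_form\<close>.\<close>

definition coord_odd :: "3 \<Rightarrow> bool" where
  "coord_odd i \<longleftrightarrow> i \<noteq> 1"

definition osp_form :: "complex ^ 3 ^ 3" where
  "osp_form = vector [vector [1, 0, 0], vector [0, 0, -1], vector [0, 1, 0]]"

definition osp_homogeneous :: "bool \<Rightarrow> (complex ^ 3 ^ 3) set" where
  "osp_homogeneous p = {X.
     (\<forall>i j. X $ i $ j \<noteq> 0 \<longrightarrow> (coord_odd i \<noteq> coord_odd j) = p) \<and>
     (\<forall>v w. (\<Sum>i\<in>UNIV. X $ i $ v * osp_form $ i $ w)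
           + ksign p (coord_odd v) * (\<Sum>i\<in>UNIV. osp_form $ v $ i * X $ i $ w) = 0)}"

fun osp_matrix :: "osp \<Rightarrow> complex ^ 3 ^ 3" where
  "osp_matrix Xap = vector [vector [0, 0, 0], vector [0, 0, 1], vector [0, 0, 0]]"
| "osp_matrix Xam = vector [vector [0, 0, 0], vector [0, 0, 0], vector [0, 1, 0]]"
| "osp_matrix Hal = vector [vector [0, 0, 0], vector [0, 1, 0], vector [0, 0, -1]]"
| "osp_matrix Xdp = vector [vector [0, 0, 1], vector [1, 0, 0], vector [0, 0, 0]]"
| "osp_matrix Xdm = vector [vector [0, 1, 0], vector [0, 0, 0], vector [-1, 0, 0]]"


definition matrix_scale :: "complex \<Rightarrow> complex ^ 3 ^ 3 \<Rightarrow> complex ^ 3 ^ 3" where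
  "matrix_scale c X = (\<chi> i j. c * X $ i $ j)"

lemma UNIV_osp: "(UNIV :: osp set) = {Xap, Xam, Hal, Xdp, Xdm}"
  using osp.exhaust by blast


lemma osp_bracket_matrix:
  "osp_matrix x ** osp_matrix y
     - matrix_scale (ksign (osp_odd x) (osp_odd y)) (osp_matrix y ** osp_matrix x)
     = (\<Sum>z\<in>UNIV. matrix_scale (Poly_Mapping.lookup (osp_bracket x y) z) (osp_matrix z))"
  by (cases x; cases y; simp only: vec_eq_iff forall_3 UNIV_osp;
     simp add: matrix_matrix_mult_def sum_3 matrix_scale_def ksign_def lookup_single)

lemma osp_matrix_homogeneous: "osp_matrix x \<in> osp_homogeneous (osp_odd x)"
  by (cases x; simp only: osp_homogeneous_def mem_Collect_eq forall_3 sum_3;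
     simp add: osp_form_def coord_odd_def ksign_def)

lemma all_osp: "(\<forall>z. P z) \<longleftrightarrow> P Xap \<and> P Xam \<and> P Hal \<and> P Xdp \<and> P Xdm"
  by (metis osp.exhaust)

lemma osp_matrix_basis:
  assumes "X \<in> osp_homogeneous p"
  shows "\<exists>!c. (\<forall>z. osp_odd z \<noteq> p \<longrightarrow> c z = 0) \<and> X = (\<Sum>z\<in>UNIV. matrix_scale (c z) (osp_matrix z))"
proof -
  have expand: "X = (\<Sum>z\<in>UNIV. matrix_scale (d z) (osp_matrix z)) \<longleftrightarrow>
      X $ 1 $ 1 = 0 \<and> X $ 1 $ 2 = d Xdm \<and> X $ 1 $ 3 = d Xdp \<and>
      X $ 2 $ 1 = d Xdp \<and> X $ 2 $ 2 = d Hal \<and> X $ 2 $ 3 = d Xap \<and>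
      X $ 3 $ 1 = - d Xdm \<and> X $ 3 $ 2 = d Xam \<and> X $ 3 $ 3 = - d Hal" for d
    by (simp only: vec_eq_iff forall_3 UNIV_osp) (simp add: matrix_scale_def)
  define c where "c = (\<lambda>z. case z of Xap \<Rightarrow> X $ 2 $ 3 | Xam \<Rightarrow> X $ 3 $ 2 | Hal \<Rightarrow> X $ 2 $ 2
                         | Xdp \<Rightarrow> X $ 1 $ 3 | Xdm \<Rightarrow> X $ 1 $ 2)"
  have zero: "X $ i $ j = 0" if "(coord_odd i \<noteq> coord_odd j) \<noteq> p" for i j
    using assms that by (auto simp: osp_homogeneous_def)
  have inv: "(\<Sum>i\<in>UNIV. X $ i $ v * osp_form $ i $ w)
           + ksign p (coord_odd v) * (\<Sum>i\<in>UNIV. osp_form $ v $ i * X $ i $ w) = 0" for v w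
    using assms by (auto simp: osp_homogeneous_def)
  have entries: "X $ 1 $ 1 = 0" "X $ 2 $ 1 = X $ 1 $ 3"
    "X $ 3 $ 1 = - X $ 1 $ 2" "X $ 3 $ 3 = - X $ 2 $ 2"
    using inv[of 1 1] inv[of 1 2] inv[of 1 3] inv[of 2 3] zero[of 1 1] zero[of 2 1]
      zero[of 1 2] zero[of 1 3] zero[of 3 1] zero[of 2 2] zero[of 3 3]
    by (cases p; simp add: sum_3 osp_form_def coord_odd_def ksign_def add_eq_0_iff; fail)+
  show ?thesis
  proof (rule ex1I[of _ c])
    show "(\<forall>z. osp_odd z \<noteq> p \<longrightarrow> c z = 0) \<and> X = (\<Sum>z\<in>UNIV. matrix_scale (c z) (osp_matrix z))"
      using zero entries by (cases p) (simp_all add: expand all_osp c_def coord_odd_def)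
  next
    fix d assume "(\<forall>z. osp_odd z \<noteq> p \<longrightarrow> d z = 0) \<and> X = (\<Sum>z\<in>UNIV. matrix_scale (d z) (osp_matrix z))"
    thus "d = c"
      by (simp add: expand fun_eq_iff all_osp c_def)
  qed
qed


section \<open>Supermodules\<close>

text \<open>Complex super vector spaces with operators indexed by a basis \<open>'x\<close> of a Lie
  superalgebra. The fields \<open>mult\<close> and \<open>one\<close> inherited from the ring record play no role.\<close>

abbreviation complex_field :: "complex ring" where
  "complex_field \<equiv> \<lparr>carrier = UNIV, monoid.mult = (*), one = 1, ring.zero = 0, add = (+)\<rparr>"

record ('x, 'm) supermodule = "(complex, 'm) module" +
  act :: "'x \<Rightarrow> 'm \<Rightarrow> 'm"
  even_part :: "'m set"
  odd_part :: "'m set"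

definition part :: "('x, 'm) supermodule \<Rightarrow> bool \<Rightarrow> 'm set" where
  "part M p = (if p then odd_part M else even_part M)"

locale super_vector_space = Module.module complex_field M
  for M :: "('x, 'm) supermodule" (structure) +
  assumes part_submodule: "submodule (part M p) complex_field M"
    and parts_disjoint: "part M False \<inter> part M True = {\<zero>}"
    and parts_sum: "m \<in> carrier M \<Longrightarrow> \<exists>a\<in>part M False. \<exists>b\<in>part M True. m = a \<oplus> b"

text \<open>Representations of the Lie superalgebra with basis \<open>'x\<close>, parity \<open>par\<close> and bracket \<open>br\<close>.\<close>

locale lie_supermodule = super_vector_space M
  for par :: "'x \<Rightarrow> bool" and br :: "'x \<Rightarrow> 'x \<Rightarrow> ('x \<Rightarrow>\<^sub>0 complex)"
    and M :: "('x, 'm) supermodule" (structure) +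
  assumes act_add: "a \<in> carrier M \<Longrightarrow> b \<in> carrier M \<Longrightarrow> act M x (a \<oplus> b) = act M x a \<oplus> act M x b"
    and act_smult: "a \<in> carrier M \<Longrightarrow> act M x (c \<odot> a) = c \<odot> act M x a"
    and act_part: "a \<in> part M p \<Longrightarrow> act M x a \<in> part M (p \<noteq> par x)"
    and act_bracket: "a \<in> carrier M \<Longrightarrow>
      act M x (act M y a) \<ominus> ksign (par x) (par y) \<odot> act M y (act M x a)
        = (\<Oplus>z\<in>Poly_Mapping.keys (br x y). Poly_Mapping.lookup (br x y) z \<odot> act M z a)"

definition graded_invariant :: "('x, 'm) supermodule \<Rightarrow> 'm set \<Rightarrow> bool" where
  "graded_invariant M S \<longleftrightarrow> submodule S complex_field M \<and> (\<forall>x. \<forall>m\<in>S. act M x m \<in> S) \<and>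
     (\<forall>m\<in>S. \<exists>a\<in>S \<inter> part M False. \<exists>b\<in>S \<inter> part M True. m = a \<oplus>\<^bsub>M\<^esub> b)"

definition irreducible_supermodule :: "('x, 'm) supermodule \<Rightarrow> bool" where
  "irreducible_supermodule M \<longleftrightarrow> carrier M \<noteq> {\<zero>\<^bsub>M\<^esub>} \<and>
     (\<forall>S. graded_invariant M S \<longrightarrow> S = {\<zero>\<^bsub>M\<^esub>} \<or> S = carrier M)"

text \<open>\<open>M\<close> is an irreducible \<open>osp(1,2)\<close>-module of highest weight \<open>m\<delta>\<^sub>1\<close>, with highest weight
  vector \<open>v\<close>, where \<open>\<delta>\<^sub>1(Hal) = 1\<close>. Highest weight vectors are taken to be even.\<close>

definition irreducible_highest_weight :: "(osp, 'm) supermodule \<Rightarrow> nat \<Rightarrow> 'm \<Rightarrow> bool" where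
  "irreducible_highest_weight M m v \<longleftrightarrow>
     lie_supermodule osp_odd osp_bracket M \<and> irreducible_supermodule M \<and>
     v \<in> even_part M \<and> v \<noteq> \<zero>\<^bsub>M\<^esub> \<and>
     act M Xap v = \<zero>\<^bsub>M\<^esub> \<and> act M Xdp v = \<zero>\<^bsub>M\<^esub> \<and> act M Hal v = of_nat m \<odot>\<^bsub>M\<^esub> v"

definition quotient_supermodule :: "('x, 'm) supermodule \<Rightarrow> 'm set \<Rightarrow> ('x, 'm set) supermodule" where
  "quotient_supermodule M K = \<lparr>
     carrier = (\<lambda>m. K +>\<^bsub>M\<^esub> m) ` carrier M,
     monoid.mult = undefined, one = undefined,
     ring.zero = K,
     add = set_add M,
     smult = (\<lambda>c X. \<Union>m\<in>X. K +>\<^bsub>M\<^esub> (c \<odot>\<^bsub>M\<^esub> m)),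
     act = (\<lambda>x X. \<Union>m\<in>X. K +>\<^bsub>M\<^esub> act M x m),
     even_part = (\<lambda>m. K +>\<^bsub>M\<^esub> m) ` even_part M,
     odd_part = (\<lambda>m. K +>\<^bsub>M\<^esub> m) ` odd_part M\<rparr>"


section \<open>The universal enveloping algebra of the current superalgebra\<close>

text \<open>The pair \<open>(x, s)\<close> stands for \<open>x \<otimes> t\<^sup>s\<close>.\<close>

type_synonym gen = "osp \<times> nat"

definition gen_odd :: "gen \<Rightarrow> bool" where
  "gen_odd g = osp_odd (fst g)"

definition gen_bracket :: "gen \<Rightarrow> gen \<Rightarrow> (gen \<Rightarrow>\<^sub>0 complex)" where
  "gen_bracket g h = (\<Sum>z\<in>UNIV. Poly_Mapping.single (z, snd g + snd h)
      (Poly_Mapping.lookup (osp_bracket (fst g) (fst h)) z))"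

datatype uword = UWord (letters: "gen list")

instantiation uword :: monoid_add
begin
definition "0 = UWord []"
definition "v + w = UWord (letters v @ letters w)"
instance
  by standard (simp_all add: zero_uword_def plus_uword_def)
end

text \<open>With this monoid structure \<open>uword \<Rightarrow>\<^sub>0 complex\<close> is the free associative algebra on
  \<open>gen\<close>, that is, the tensor algebra of \<open>\<gg>[t]\<close>.\<close>

type_synonym free_alg = "uword \<Rightarrow>\<^sub>0 complex"

definition free_scalar :: "complex \<Rightarrow> free_alg" where
  "free_scalar c = Poly_Mapping.single 0 c"

definition free_gen :: "gen \<Rightarrow> free_alg" where
  "free_gen g = Poly_Mapping.single (UWord [g]) 1"

definition bracket_relator :: "gen \<Rightarrow> gen \<Rightarrow> free_alg" where
  "bracket_relator g h = free_gen g * free_gen h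
     - free_scalar (ksign (gen_odd g) (gen_odd h)) * free_gen h * free_gen g
     - (\<Sum>z\<in>Poly_Mapping.keys (gen_bracket g h).
          free_scalar (Poly_Mapping.lookup (gen_bracket g h) z) * free_gen z)"

inductive_set uea_ideal :: "free_alg set" where
  zero: "0 \<in> uea_ideal"
| relator: "a * bracket_relator g h * b \<in> uea_ideal"
| add: "p \<in> uea_ideal \<Longrightarrow> q \<in> uea_ideal \<Longrightarrow> p + q \<in> uea_ideal"

definition uea_rel :: "free_alg \<Rightarrow> free_alg \<Rightarrow> bool" where
  "uea_rel p q \<longleftrightarrow> p - q \<in> uea_ideal"

lemma uea_ideal_mult:
  assumes "p \<in> uea_ideal"
  shows "a * p \<in> uea_ideal" "p * a \<in> uea_ideal"
  using assms
proof (induction p)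
  case zero
  { case 1 show ?case by (simp add: uea_ideal.zero) }
  { case 2 show ?case by (simp add: uea_ideal.zero) }
next
  case (relator b g h c)
  { case 1 show ?case using uea_ideal.relator[of "a * b" g h c] by (simp add: mult.assoc) }
  { case 2 show ?case using uea_ideal.relator[of b g h "c * a"] by (simp add: mult.assoc) }
next
  case (add p q)
  { case 1 show ?case using add by (simp add: distrib_left uea_ideal.add) }
  { case 2 show ?case using add by (simp add: distrib_right uea_ideal.add) }
qed

lemma uea_ideal_uminus: "p \<in> uea_ideal \<Longrightarrow> - p \<in> uea_ideal"
  using uea_ideal_mult(1)[of p "-1"] by simp

lemma uea_ideal_diff: "p \<in> uea_ideal \<Longrightarrow> q \<in> uea_ideal \<Longrightarrow> p - q \<in> uea_ideal"
  using uea_ideal.add[of p "- q"] uea_ideal_uminus by simp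

lemma bracket_relator_zero: "Poly_Mapping.lookup (bracket_relator g h) 0 = 0"
  by (simp add: bracket_relator_def free_gen_def free_scalar_def mult_single lookup_minus
      lookup_single lookup_sum plus_uword_def zero_uword_def)

lemma uea_ideal_zero_coeff: "p \<in> uea_ideal \<Longrightarrow> Poly_Mapping.lookup p 0 = 0"
proof (induction rule: uea_ideal.induct)
  case (relator a g h b)
  have split: "v + w = 0 \<longleftrightarrow> v = 0 \<and> w = 0" for v w :: uword
    by (cases v; cases w) (auto simp: plus_uword_def zero_uword_def)
  have "0 \<notin> Poly_Mapping.keys (bracket_relator g h)"
    by (simp add: bracket_relator_zero in_keys_iff)
  hence "0 \<notin> Poly_Mapping.keys (a * bracket_relator g h)"
    using keys_mult[of a "bracket_relator g h"] by (force simp: split)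
  hence "0 \<notin> Poly_Mapping.keys (a * bracket_relator g h * b)"
    using keys_mult[of "a * bracket_relator g h" b] by (force simp: split)
  thus ?case by (simp add: in_keys_iff)
qed (simp_all add: lookup_add)

quotient_type uea = free_alg / uea_rel
proof (rule equivpI)
  show "reflp uea_rel"
    by (simp add: reflp_def uea_rel_def uea_ideal.zero)
  show "symp uea_rel"
  proof (rule sympI)
    fix p q assume "uea_rel p q"
    thus "uea_rel q p" using uea_ideal_uminus[of "p - q"] by (simp add: uea_rel_def)
  qed
  show "transp uea_rel"
  proof (rule transpI)
    fix p q r assume "uea_rel p q" "uea_rel q r"
    thus "uea_rel p r" using uea_ideal.add[of "p - q" "q - r"] by (simp add: uea_rel_def)
  qed
qed

instantiation uea :: ring_1
begin

lift_definition zero_uea :: uea is 0 .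

lift_definition one_uea :: uea is 1 .

lift_definition plus_uea :: "uea \<Rightarrow> uea \<Rightarrow> uea" is "(+)"
proof -
  fix p p' q q' assume "uea_rel p p'" "uea_rel q q'"
  thus "uea_rel (p + q) (p' + q')"
    using uea_ideal.add[of "p - p'" "q - q'"] by (simp add: uea_rel_def algebra_simps)
qed

lift_definition uminus_uea :: "uea \<Rightarrow> uea" is uminus
proof -
  fix p p' assume "uea_rel p p'"
  thus "uea_rel (- p) (- p')"
    using uea_ideal_uminus[of "p - p'"] by (simp add: uea_rel_def)
qed

lift_definition minus_uea :: "uea \<Rightarrow> uea \<Rightarrow> uea" is "(-)"
proof -
  fix p p' q q' assume "uea_rel p p'" "uea_rel q q'"
  thus "uea_rel (p - q) (p' - q')"
    using uea_ideal_diff[of "p - p'" "q - q'"] by (simp add: uea_rel_def algebra_simps)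
qed

lift_definition times_uea :: "uea \<Rightarrow> uea \<Rightarrow> uea" is "(*)"
proof -
  fix p p' q q' assume *: "uea_rel p p'" "uea_rel q q'"
  have "(p - p') * q + p' * (q - q') \<in> uea_ideal"
    using * by (intro uea_ideal.add uea_ideal_mult) (simp_all add: uea_rel_def)
  thus "uea_rel (p * q) (p' * q')"
    by (simp add: uea_rel_def algebra_simps)
qed

instance
proof
  show "(0 :: uea) \<noteq> 1"
  proof (transfer, rule notI)
    assume "uea_rel 0 1"
    hence "Poly_Mapping.lookup (0 - 1 :: free_alg) 0 = 0"
      unfolding uea_rel_def by (rule uea_ideal_zero_coeff)
    thus False by (simp add: lookup_minus lookup_one)
  qed
qed (transfer; simp add: uea_rel_def uea_ideal.zero algebra_simps)+

end

lift_definition uscalar :: "complex \<Rightarrow> uea" is free_scalar .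

lift_definition ugen :: "gen \<Rightarrow> uea" is free_gen .

definition word_degree :: "uword \<Rightarrow> nat" where
  "word_degree w = sum_list (map snd (letters w))"

definition word_odd :: "uword \<Rightarrow> bool" where
  "word_odd w = odd (length (filter gen_odd (letters w)))"

definition uea_degree :: "nat \<Rightarrow> uea set" where
  "uea_degree m = abs_uea ` {p. \<forall>w\<in>Poly_Mapping.keys p. word_degree w = m}"

definition uea_parity :: "bool \<Rightarrow> uea set" where
  "uea_parity p = abs_uea ` {q. \<forall>w\<in>Poly_Mapping.keys q. word_odd w = p}"

text \<open>The action of the enveloping algebra on a \<open>\<gg>[t]\<close>-module; if \<open>M\<close> satisfies the bracket
  relations then the result does not depend on the representative \<open>rep_uea u\<close>.\<close>

definition free_act :: "(gen, 'm) supermodule \<Rightarrow> free_alg \<Rightarrow> 'm \<Rightarrow> 'm" where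
  "free_act M p m = (\<Oplus>\<^bsub>M\<^esub>w\<in>Poly_Mapping.keys p.
     Poly_Mapping.lookup p w \<odot>\<^bsub>M\<^esub> foldr (act M) (letters w) m)"

definition uea_act :: "(gen, 'm) supermodule \<Rightarrow> uea \<Rightarrow> 'm \<Rightarrow> 'm" where
  "uea_act M u m = free_act M (rep_uea u) m"

definition uea_iso :: "(gen, 'm) supermodule \<Rightarrow> (gen, 'n) supermodule \<Rightarrow> bool"  (infix \<open>\<cong>\<^sub>U\<close> 50) where
  "M \<cong>\<^sub>U N \<longleftrightarrow> (\<exists>f. bij_betw f (carrier M) (carrier N) \<and>
     (\<forall>a\<in>carrier M. \<forall>b\<in>carrier M. f (a \<oplus>\<^bsub>M\<^esub> b) = f a \<oplus>\<^bsub>N\<^esub> f b) \<and>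
     (\<forall>c. \<forall>a\<in>carrier M. f (c \<odot>\<^bsub>M\<^esub> a) = c \<odot>\<^bsub>N\<^esub> f a) \<and>
     (\<forall>u. \<forall>a\<in>carrier M. f (uea_act M u a) = uea_act N u (f a)) \<and>
     (\<forall>p. \<forall>a\<in>part M p. f a \<in> part N p))"


section \<open>Modules given by a generator and relations\<close>

definition regular_module :: "(gen, uea) supermodule" where
  "regular_module = \<lparr>
     carrier = UNIV, monoid.mult = undefined, one = undefined, ring.zero = 0, add = (+),
     smult = (\<lambda>c u. uscalar c * u),
     act = (\<lambda>g u. ugen g * u),
     even_part = uea_parity False,
     odd_part = uea_parity True\<rparr>"

inductive_set left_ideal :: "uea set \<Rightarrow> uea set" for R where
  zero: "0 \<in> left_ideal R"
| relation: "r \<in> R \<Longrightarrow> u * r \<in> left_ideal R"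
| add: "a \<in> left_ideal R \<Longrightarrow> b \<in> left_ideal R \<Longrightarrow> a + b \<in> left_ideal R"

text \<open>The module with an (even) generator \<open>w\<close>, the class of \<open>1\<close>, and defining relations
  \<open>r w = 0\<close> for \<open>r \<in> R\<close>.\<close>

definition presented_module :: "uea set \<Rightarrow> (gen, uea set) supermodule" where
  "presented_module R = quotient_supermodule regular_module (left_ideal R)"

definition highest_weight_relations :: "nat \<Rightarrow> uea set" where
  "highest_weight_relations n =
     {ugen (x, r) | x r. x \<in> {Xap, Xdp}} \<union>
     {ugen (Hal, r) - uscalar (if r = 0 then of_nat n else 0) | r. True}"

definition weyl_module :: "nat \<Rightarrow> (gen, uea set) supermodule" where
  "weyl_module n = presented_module (highest_weight_relations n \<union> {ugen (Xam, 0) ^ (n + 1)})"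

definition truncated_weyl_module :: "nat \<Rightarrow> nat \<Rightarrow> (gen, uea set) supermodule" where
  "truncated_weyl_module n N = presented_module
     (highest_weight_relations n \<union> {ugen (Xam, 0) ^ (n + 1)} \<union> {ugen (x, s) | x s. N \<le> s})"

text \<open>The truncated subtraction of natural numbers is \<open>max {0, n - lr}\<close>.\<close>

definition demazure_module :: "nat \<Rightarrow> nat \<Rightarrow> (gen, uea set) supermodule" where
  "demazure_module l n = presented_module
     (highest_weight_relations n \<union> {ugen (Xam, r) ^ ((n - l * r) + 1) | r. True})"


section \<open>Tensor products of evaluation modules\<close>

text \<open>The sign \<open>(-1)\<^bsup>|m|\<^esup> m\<close>, extended linearly.\<close>

definition parity_involution :: "('x, 'm) supermodule \<Rightarrow> 'm \<Rightarrow> 'm" where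
  "parity_involution M m =
     (THE m'. \<exists>a\<in>part M False. \<exists>b\<in>part M True. m = a \<oplus>\<^bsub>M\<^esub> b \<and> m' = a \<ominus>\<^bsub>M\<^esub> b)"

definition tensor_tuples :: "(osp, 'm) supermodule list \<Rightarrow> 'm list set" where
  "tensor_tuples Ms = listset (map carrier Ms)"

definition parity_tuples :: "(osp, 'm) supermodule list \<Rightarrow> bool \<Rightarrow> 'm list set" where
  "parity_tuples Ms p = \<Union> {listset (map2 part Ms ps) | ps.
     length ps = length Ms \<and> odd (length (filter id ps)) = p}"

text \<open>\<open>apply_factor Ms x i\<close> takes \<open>v\<^sub>1 \<otimes> \<dots> \<otimes> v\<^sub>r\<close> to
  \<open>(-1)\<^bsup>|x|(|v\<^sub>1| + \<dots> + |v\<^bsub>i-1\<^esub>|)\<^esup> v\<^sub>1 \<otimes> \<dots> \<otimes> x v\<^sub>i \<otimes> \<dots> \<otimes> v\<^sub>r\<close> (with \<open>i\<close> counted from 0).\<close>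

definition apply_factor :: "(osp, 'm) supermodule list \<Rightarrow> osp \<Rightarrow> nat \<Rightarrow> 'm list \<Rightarrow> 'm list" where
  "apply_factor Ms x i vs =
     map2 (\<lambda>M v. if osp_odd x then parity_involution M v else v) (take i Ms) (take i vs)
     @ act (Ms ! i) x (vs ! i) # drop (Suc i) vs"

text \<open>The free vector space on the tuples, on which \<open>x \<otimes> t\<^sup>s\<close> acts on the \<open>i\<close>-th entry
  through \<open>zs ! i ^ s\<close> times \<open>x\<close>.\<close>

definition free_tensor :: "(osp, 'm) supermodule list \<Rightarrow> complex list \<Rightarrow>
    (gen, 'm list \<Rightarrow>\<^sub>0 complex) supermodule" where
  "free_tensor Ms zs = \<lparr>
     carrier = {p. Poly_Mapping.keys p \<subseteq> tensor_tuples Ms},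
     monoid.mult = undefined, one = undefined, ring.zero = 0, add = (+),
     smult = (\<lambda>c. Poly_Mapping.map ((*) c)),
     act = (\<lambda>(x, s) p. \<Sum>vs\<in>Poly_Mapping.keys p. \<Sum>i<length Ms.
        Poly_Mapping.single (apply_factor Ms x i vs) (Poly_Mapping.lookup p vs * (zs ! i) ^ s)),
     even_part = {p. Poly_Mapping.keys p \<subseteq> parity_tuples Ms False},
     odd_part = {p. Poly_Mapping.keys p \<subseteq> parity_tuples Ms True}\<rparr>"

inductive_set multilinear_relations :: "(osp, 'm) supermodule list \<Rightarrow> ('m list \<Rightarrow>\<^sub>0 complex) set"
  for Ms where
  zero: "0 \<in> multilinear_relations Ms"
| additive: "vs \<in> tensor_tuples Ms \<Longrightarrow> i < length Ms \<Longrightarrow>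
    a \<in> carrier (Ms ! i) \<Longrightarrow> b \<in> carrier (Ms ! i) \<Longrightarrow>
    Poly_Mapping.single (vs[i := a \<oplus>\<^bsub>Ms ! i\<^esub> b]) c
      - Poly_Mapping.single (vs[i := a]) c - Poly_Mapping.single (vs[i := b]) c
      \<in> multilinear_relations Ms"
| homogeneous: "vs \<in> tensor_tuples Ms \<Longrightarrow> i < length Ms \<Longrightarrow> a \<in> carrier (Ms ! i) \<Longrightarrow>
    Poly_Mapping.single (vs[i := d \<odot>\<^bsub>Ms ! i\<^esub> a]) c - Poly_Mapping.single (vs[i := a]) (c * d)
      \<in> multilinear_relations Ms"
| add: "p \<in> multilinear_relations Ms \<Longrightarrow> q \<in> multilinear_relations Ms \<Longrightarrow>
    p + q \<in> multilinear_relations Ms"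

definition evaluation_tensor :: "(osp, 'm) supermodule list \<Rightarrow> complex list \<Rightarrow>
    (gen, ('m list \<Rightarrow>\<^sub>0 complex) set) supermodule" where
  "evaluation_tensor Ms zs = quotient_supermodule (free_tensor Ms zs) (multilinear_relations Ms)"

definition pure_tensor :: "(osp, 'm) supermodule list \<Rightarrow> complex list \<Rightarrow> 'm list \<Rightarrow>
    ('m list \<Rightarrow>\<^sub>0 complex) set" where
  "pure_tensor Ms zs vs = multilinear_relations Ms +>\<^bsub>free_tensor Ms zs\<^esub> Poly_Mapping.single vs 1"


section \<open>Fusion products\<close>

definition degree_filtration :: "(gen, 'm) supermodule \<Rightarrow> 'm \<Rightarrow> nat \<Rightarrow> 'm set" where
  "degree_filtration M v j =
     {(\<Oplus>\<^bsub>M\<^esub>m\<in>{..j}. uea_act M (u m) v) | u. \<forall>m\<le>j. u m \<in> uea_degree m}"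

definition previous_filtration :: "(gen, 'm) supermodule \<Rightarrow> 'm \<Rightarrow> nat \<Rightarrow> 'm set" where
  "previous_filtration M v j = (if j = 0 then {\<zero>\<^bsub>M\<^esub>} else degree_filtration M v (j - 1))"

text \<open>The direct sum of the quotients \<open>V\<^sup>j / V\<^bsup>j-1\<^esup>\<close>; its elements are families of cosets,
  almost all of which are zero, and \<open>x \<otimes> t\<^sup>s\<close> raises the degree by \<open>s\<close>.\<close>

definition graded_part :: "(gen, 'm) supermodule \<Rightarrow> 'm \<Rightarrow> 'm set \<Rightarrow> (nat \<Rightarrow> 'm set) set" where
  "graded_part M v S = {F.
     (\<forall>j. F j \<in> (\<lambda>m. previous_filtration M v j +>\<^bsub>M\<^esub> m) ` (degree_filtration M v j \<inter> S)) \<and>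
     finite {j. F j \<noteq> previous_filtration M v j}}"

definition associated_graded :: "(gen, 'm) supermodule \<Rightarrow> 'm \<Rightarrow> (gen, nat \<Rightarrow> 'm set) supermodule" where
  "associated_graded M v = \<lparr>
     carrier = graded_part M v (carrier M),
     monoid.mult = undefined, one = undefined,
     ring.zero = previous_filtration M v,
     add = (\<lambda>F G j. F j <+>\<^bsub>M\<^esub> G j),
     smult = (\<lambda>c F j. \<Union>m\<in>F j. previous_filtration M v j +>\<^bsub>M\<^esub> (c \<odot>\<^bsub>M\<^esub> m)),
     act = (\<lambda>(x, s) F j. if s \<le> j
              then \<Union>m\<in>F (j - s). previous_filtration M v j +>\<^bsub>M\<^esub> act M (x, s) m
              else previous_filtration M v j),
     even_part = graded_part M v (even_part M),
     odd_part = graded_part M v (odd_part M)\<rparr>"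

definition fusion_product :: "((osp, 'm) supermodule \<times> 'm) list \<Rightarrow> complex list \<Rightarrow>
    (gen, nat \<Rightarrow> ('m list \<Rightarrow>\<^sub>0 complex) set set) supermodule" where
  "fusion_product Vs zs = associated_graded (evaluation_tensor (map fst Vs) zs)
     (pure_tensor (map fst Vs) zs (map snd Vs))"

end

theory Submission
  imports Defs "HOL-Library.Function_Algebras" "HOL-Computational_Algebra.Polynomial"
begin

text \<open>Upper bound: let \<open>v\<close> be a highest weight vector that is killed by the coefficient of \<open>z\<^sup>s\<close> in
  \<open>(\<Sum>p. (x\<^sub>\<alpha>\<^sup>- \<otimes> t\<^sup>p) z\<^sup>p)\<^sup>r\<close> whenever \<open>r + s > \<Sum>i. min r m\<^sub>i\<close>. Then \<open>v\<close> generates a module of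
  dimension at most \<open>\<Prod>i. 2 m\<^sub>i + 1\<close>, by induction on the partition \<open>(m\<^sub>i)\<close>: a suitable submodule
  chain has cyclic subquotients for smaller partitions, whose bounds add up. By identities of
  Garland type the defining relations of each of the three modules imply such a family.

  Lower bound: evaluating at \<open>\<Prod>i. (t - z\<^sub>i)\<close> and its factors shows that the same defining relations
  hold in the associated graded module of the tensor product \<open>V(m\<^sub>1) \<otimes> \<dots> \<otimes> V(m\<^sub>r)\<close>, which is
  cyclic by Lagrange interpolation and has dimension \<open>\<Prod>i. 2 m\<^sub>i + 1\<close>. Hence the annihilator of its
  generator is the left ideal spanned by the relations. In particular \<open>W(n)\<close> and \<open>D(1,n)\<close> are both
  equal to \<open>V(1)\<^bsup>*n\<^esup> * V(0)\<close>.\<close>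

section \<open>Computing in the enveloping algebra\<close>

text \<open>The family of relations in the upper bound is read off from the tensor product. There
  the series with coefficients x_\<alpha>^- \<otimes> t^p acts as the sum of the x_i / (1 - z_i z),
  where x_i is x_\<alpha>^- in factor i, and x_i^(m_i + 1) kills v_i. In the r-th power, applied to
  the generator, x_i thus occurs at most min r m_i times, and multiplying by all (1 - z_i z)^(min r
  m_i) leaves a polynomial in z whose degree is at most the sum of the min r m_i, minus r. A later
  coefficient is a combination of earlier ones, so it has lower degree in t and vanishes in the
  associated graded module. The presentations themselves are not inherited by the submodules of the
  chain; this family is, with another partition, which is why the induction runs over it. The bounds
  must add up without loss, since they have to meet the dimension of the tensor product. Conversely
  no basis of the associated graded module is at hand: a homogeneous spanning set of it is carried
  to the tensor product, where coordinates are explicit.\<close>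

lemma poly_mapping_eq_sum: "(\<Sum>k\<in>Poly_Mapping.keys p. Poly_Mapping.single k (Poly_Mapping.lookup p k)) = p"
  by (rule poly_mapping_eqI)
    (auto simp: lookup_sum lookup_single when_def sum.delta in_keys_iff)

lemma poly_mapping_additive_induct [case_names single add]:
  fixes p :: "'k \<Rightarrow>\<^sub>0 'c :: comm_monoid_add"
  assumes single: "\<And>k c. P (Poly_Mapping.single k c)"
    and add: "\<And>p q. P p \<Longrightarrow> P q \<Longrightarrow> P (p + q)"
  shows "P p"
proof -
  have "P (\<Sum>k\<in>A. Poly_Mapping.single k (Poly_Mapping.lookup p k))" if "finite A" for A
    using that
  proof (induction A)
    case empty
    show ?case using single[of undefined 0] by simp
  next
    case (insert k A)
    thus ?case by (simp add: single add)
  qed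
  from this[OF finite_keys[of p]] show ?thesis by (simp add: poly_mapping_eq_sum)
qed

lemma abs_uea_add: "abs_uea (p + q) = abs_uea p + abs_uea q"
  by (simp add: plus_uea.abs_eq)

lemma abs_uea_mult: "abs_uea (p * q) = abs_uea p * abs_uea q"
  by (simp add: times_uea.abs_eq)

lemma abs_uea_diff: "abs_uea (p - q) = abs_uea p - abs_uea q"
  by (simp add: minus_uea.abs_eq)

lemma abs_uea_0: "abs_uea 0 = 0"
  by (simp add: zero_uea.abs_eq)

lemma abs_uea_1: "abs_uea 1 = 1"
  by (simp add: one_uea.abs_eq)

lemma abs_uea_scalar: "abs_uea (free_scalar c) = uscalar c"
  by (simp add: uscalar.abs_eq)

lemma abs_uea_gen: "abs_uea (free_gen g) = ugen g"
  by (simp add: ugen.abs_eq)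

lemma abs_uea_sum: "abs_uea (sum f A) = (\<Sum>a\<in>A. abs_uea (f a))"
  by (induction A rule: infinite_finite_induct) (simp_all add: abs_uea_0 abs_uea_add)

lemma abs_uea_power: "abs_uea (p ^ n) = abs_uea p ^ n"
  by (induction n) (simp_all add: abs_uea_1 abs_uea_mult)

lemma abs_uea_eq_iff: "abs_uea p = abs_uea q \<longleftrightarrow> p - q \<in> uea_ideal"
  by (simp add: uea.abs_eq_iff uea_rel_def)

lemma abs_rep_uea: "abs_uea (rep_uea u) = u"
  by (meson Quotient3_abs_rep Quotient3_uea)

lemma rep_abs_uea: "rep_uea (abs_uea p) - p \<in> uea_ideal"
  by (metis abs_rep_uea abs_uea_eq_iff)

lemma free_scalar_mult: "free_scalar (a * b) = free_scalar a * free_scalar b"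
  by (simp add: free_scalar_def mult_single)

lemma free_scalar_add: "free_scalar (a + b) = free_scalar a + free_scalar b"
  by (simp add: free_scalar_def single_add)

lemma free_scalar_0: "free_scalar 0 = 0"
  by (simp add: free_scalar_def)

lemma free_scalar_1: "free_scalar 1 = 1"
  by (simp add: free_scalar_def)

lemma free_scalar_commute: "free_scalar c * p = p * free_scalar c"
proof (induction p rule: poly_mapping_additive_induct)
  case (single k v)
  show ?case by (simp add: free_scalar_def mult_single mult.commute)
next
  case (add p q)
  thus ?case by (simp add: distrib_left distrib_right)
qed

lemma uscalar_mult: "uscalar (a * b) = uscalar a * uscalar b"
  by (simp flip: abs_uea_scalar abs_uea_mult add: free_scalar_mult)

lemma uscalar_add: "uscalar (a + b) = uscalar a + uscalar b"
  by (simp flip: abs_uea_scalar abs_uea_add add: free_scalar_add)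

lemma uscalar_0 [simp]: "uscalar 0 = 0"
  by (simp flip: abs_uea_scalar abs_uea_0 add: free_scalar_0)

lemma uscalar_1 [simp]: "uscalar 1 = 1"
  by (simp flip: abs_uea_scalar abs_uea_1 add: free_scalar_1)

lemma uscalar_uminus: "uscalar (- a) = - uscalar a"
  by (metis add.right_inverse add_eq_0_iff uscalar_0 uscalar_add)

lemma uscalar_commute: "uscalar c * u = u * uscalar c"
  by (metis abs_rep_uea abs_uea_mult abs_uea_scalar free_scalar_commute)

lemma uscalar_left_commute: "u * (uscalar c * w) = uscalar c * (u * w)"
  by (metis mult.assoc uscalar_commute)

lemma uscalar_of_nat: "uscalar (of_nat n) = of_nat n"
  by (induction n) (simp_all add: uscalar_add)

lemma uscalar_numeral: "uscalar (numeral n) = numeral n"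
  by (metis of_nat_numeral uscalar_of_nat)

text \<open>The set of keys depends on which structure constants are non-zero. A sum over all five
  basis elements can be unfolded uniformly.\<close>

lemma gen_bracket_keys_sum:
  "(\<Sum>z\<in>Poly_Mapping.keys (gen_bracket g h). uscalar (Poly_Mapping.lookup (gen_bracket g h) z) * F z)
     = (\<Sum>z\<in>UNIV. uscalar (Poly_Mapping.lookup (osp_bracket (fst g) (fst h)) z) * F (z, snd g + snd h))"
proof -
  let ?b = "gen_bracket g h" and ?s = "snd g + snd h"
  have lookup: "Poly_Mapping.lookup ?b (z, s) =
      (if s = ?s then Poly_Mapping.lookup (osp_bracket (fst g) (fst h)) z else 0)" for z s
  proof -
    have "Poly_Mapping.lookup ?b (z, s) =
        (\<Sum>z'\<in>UNIV. if z' = z \<and> s = ?s then Poly_Mapping.lookup (osp_bracket (fst g) (fst h)) z else 0)"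
      unfolding gen_bracket_def lookup_sum
      by (intro sum.cong) (auto simp: lookup_single when_def)
    also have "\<dots> = (if s = ?s then Poly_Mapping.lookup (osp_bracket (fst g) (fst h)) z else 0)"
      by (cases "s = ?s") simp_all
    finally show ?thesis .
  qed
  have sub: "Poly_Mapping.keys ?b \<subseteq> (\<lambda>z. (z, ?s)) ` UNIV"
    by (auto simp: in_keys_iff lookup split: if_splits)
  have "(\<Sum>z\<in>Poly_Mapping.keys ?b. uscalar (Poly_Mapping.lookup ?b z) * F z)
      = (\<Sum>z\<in>(\<lambda>z. (z, ?s)) ` UNIV. uscalar (Poly_Mapping.lookup ?b z) * F z)"
    using sub by (intro sum.mono_neutral_left) (auto simp: in_keys_iff)
  also have "\<dots> = (\<Sum>z\<in>UNIV. uscalar (Poly_Mapping.lookup (osp_bracket (fst g) (fst h)) z) * F (z, ?s))"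
    by (subst sum.reindex) (auto simp: inj_on_def lookup)
  finally show ?thesis .
qed

lemma ugen_bracket:
  "ugen (a, r) * ugen (b, s) - uscalar (ksign (osp_odd a) (osp_odd b)) * ugen (b, s) * ugen (a, r)
     = (\<Sum>z\<in>UNIV. uscalar (Poly_Mapping.lookup (osp_bracket a b) z) * ugen (z, r + s))"
proof -
  have "bracket_relator (a, r) (b, s) \<in> uea_ideal"
    using uea_ideal.relator[of 1 "(a, r)" "(b, s)" 1] by simp
  hence "abs_uea (bracket_relator (a, r) (b, s)) = 0"
    by (metis abs_uea_0 abs_uea_eq_iff diff_zero)
  thus ?thesis
    unfolding bracket_relator_def
    by (simp add: abs_uea_diff abs_uea_mult abs_uea_sum abs_uea_scalar abs_uea_gen
        gen_bracket_keys_sum gen_odd_def mult.assoc)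
qed

abbreviation "yg r \<equiv> ugen (Xdm, r)"
abbreviation "fg r \<equiv> ugen (Xam, r)"
abbreviation "hg r \<equiv> ugen (Hal, r)"
abbreviation "xg r \<equiv> ugen (Xdp, r)"
abbreviation "eg r \<equiv> ugen (Xap, r)"

text \<open>Oriented so that raising operators and \<open>hg\<close> move to the right, towards a
  highest weight vector. The first and the last identity keep their factor 2, which later proofs
  cancel through \<open>uscalar\<close>.\<close>

lemma uea_commutation:
  "yg r * yg s + yg s * yg r = - (2 * fg (r + s))"
  "fg r * fg s = fg s * fg r"
  "fg r * yg s = yg s * fg r"
  "hg r * fg s = fg s * hg r - 2 * fg (r + s)"
  "hg r * yg s = yg s * hg r - yg (r + s)"
  "xg r * yg s = hg (r + s) - yg s * xg r"
  "xg r * fg s = fg s * xg r + yg (r + s)"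
  "eg r * fg s = fg s * eg r + hg (r + s)"
  "2 * eg (r + s) = xg r * xg s + xg s * xg r"
  using ugen_bracket[of Xdm r Xdm s] ugen_bracket[of Xam r Xam s] ugen_bracket[of Xam r Xdm s]
    ugen_bracket[of Hal r Xam s] ugen_bracket[of Hal r Xdm s] ugen_bracket[of Xdp r Xdm s]
    ugen_bracket[of Xdp r Xam s] ugen_bracket[of Xap r Xam s] ugen_bracket[of Xdp r Xdp s]
  by (simp_all add: ksign_def UNIV_osp lookup_single uscalar_uminus uscalar_numeral algebra_simps
      eq_neg_iff_add_eq_0)

subsection \<open>Coefficients of powers of the lowering current\<close>

text \<open>\<open>fpow r s\<close> is the coefficient of \<open>z\<^sup>s\<close> in \<open>(\<Sum>p. (x\<^sub>\<alpha>\<^sup>- \<otimes> t\<^sup>p) z\<^sup>p)\<^sup>r\<close>, and \<open>ypow r s\<close> that of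
  \<open>z\<^sup>s\<close> in \<open>(\<Sum>p. (x\<^sub>\<delta>\<^sup>- \<otimes> t\<^sup>p) z\<^sup>p)\<close> times this power.\<close>

primrec fpow :: "nat \<Rightarrow> nat \<Rightarrow> uea" where
  "fpow 0 s = (if s = 0 then 1 else 0)"
| "fpow (Suc r) s = (\<Sum>p\<le>s. fg p * fpow r (s - p))"

definition ypow :: "nat \<Rightarrow> nat \<Rightarrow> uea" where
  "ypow r s = (\<Sum>p\<le>s. yg p * fpow r (s - p))"

lemma sum_triangle_swap:
  fixes G :: "nat \<Rightarrow> nat \<Rightarrow> 'a :: comm_monoid_add"
  shows "(\<Sum>p\<le>s. \<Sum>q\<le>s - p. G p q) = (\<Sum>q\<le>s. \<Sum>p\<le>s - q. G p q)"
  unfolding sum.Sigma[OF finite_atMost ballI[OF finite_atMost]]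
  by (rule sum.reindex_bij_witness[of _ prod.swap prod.swap]) auto

lemma mult_of_nat_swap: "u * (of_nat k * w) = of_nat k * (u * w)" for u w :: uea
  by (metis mult.assoc mult_of_nat_commute)

lemma fg_fpow_commute: "fg q * fpow r s = fpow r s * fg q"
proof (induction r arbitrary: s)
  case (Suc r)
  have "fg q * (fg p * w) = fg p * (fg q * w)" for p w
    by (metis mult.assoc uea_commutation(2))
  thus ?case by (simp add: sum_distrib_left sum_distrib_right Suc mult.assoc)
qed auto

lemma yg_fpow_commute: "yg q * fpow r s = fpow r s * yg q"
proof (induction r arbitrary: s)
  case (Suc r)
  have "yg q * (fg p * w) = fg p * (yg q * w)" for p w
    by (metis mult.assoc uea_commutation(3))
  thus ?case by (simp add: sum_distrib_left sum_distrib_right Suc mult.assoc)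
qed auto

lemma fg_ypow_commute: "fg q * ypow r s = ypow r s * fg q"
proof -
  have "fg q * (yg p * w) = yg p * (fg q * w)" for p w
    by (metis mult.assoc uea_commutation(3))
  thus ?thesis
    by (simp add: ypow_def sum_distrib_left sum_distrib_right fg_fpow_commute mult.assoc)
qed

lemma fpow_Suc_right: "fpow (Suc r) s = (\<Sum>p\<le>s. fpow r (s - p) * fg p)"
  by (simp add: fg_fpow_commute)

lemma fpow_one: "fpow 1 s = fg s"
proof -
  have "fpow 1 s = (\<Sum>p\<le>s. if p = s then fg p else 0)"
    unfolding One_nat_def fpow.simps by (intro sum.cong) auto
  thus ?thesis by simp
qed

lemma fpow_zero_right: "fpow r 0 = fg 0 ^ r"
  by (induction r) auto

lemma ypow_zero: "ypow 0 s = yg s"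
proof -
  have "ypow 0 s = (\<Sum>p\<le>s. if p = s then yg p else 0)"
    unfolding ypow_def by (intro sum.cong) auto
  thus ?thesis by simp
qed

lemma ypow_Suc: "ypow (Suc r) s = (\<Sum>p\<le>s. fg p * ypow r (s - p))"
proof -
  have "ypow (Suc r) s = (\<Sum>q\<le>s. \<Sum>p\<le>s - q. fg p * (yg q * fpow r (s - q - p)))"
    unfolding ypow_def fpow.simps(2) sum_distrib_left mult.assoc[symmetric]
    by (simp only: uea_commutation(3))
  also have "\<dots> = (\<Sum>p\<le>s. \<Sum>q\<le>s - p. fg p * (yg q * fpow r (s - q - p)))"
    by (rule sum_triangle_swap[symmetric])
  finally show ?thesis
    by (simp only: ypow_def sum_distrib_left mult.assoc diff_commute[of s])
qed

text \<open>The derivative of the generating series of \<open>fpow\<close> and \<open>ypow\<close>.\<close>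

lemma fpow_derivative:
  "of_nat (Suc r) * (\<Sum>p\<le>s. of_nat p * (fg p * fpow r (s - p))) = of_nat s * fpow (Suc r) s"
proof (induction r arbitrary: s)
  case 0
  have "(\<Sum>p\<le>s. of_nat p * (fg p * fpow 0 (s - p))) = (\<Sum>p\<le>s. if p = s then of_nat p * fg p else 0)"
    by (intro sum.cong) auto
  thus ?case using fpow_one[of s] by simp
next
  case (Suc r)
  define d where "d = (\<lambda>s. \<Sum>p\<le>s. of_nat p * (fg p * fpow r (s - p)))"
  define D where "D = (\<Sum>p\<le>s. of_nat p * (fg p * fpow (Suc r) (s - p)))"
  have "D = (\<Sum>p\<le>s. \<Sum>q\<le>s - p. fg q * (of_nat p * (fg p * fpow r (s - p - q))))"
    unfolding D_def
  proof (intro sum.cong refl)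
    fix p
    have "fg p * (fg q * w) = fg q * (fg p * w)" for q w
      by (metis mult.assoc uea_commutation(2))
    thus "of_nat p * (fg p * fpow (Suc r) (s - p))
        = (\<Sum>q\<le>s - p. fg q * (of_nat p * (fg p * fpow r (s - p - q))))"
      by (simp only: fpow.simps sum_distrib_left mult_of_nat_swap)
  qed
  also have "\<dots> = (\<Sum>q\<le>s. \<Sum>p\<le>s - q. fg q * (of_nat p * (fg p * fpow r (s - p - q))))"
    by (rule sum_triangle_swap)
  also have "\<dots> = (\<Sum>q\<le>s. fg q * d (s - q))"
    by (simp only: d_def sum_distrib_left diff_commute[of s])
  finally have "of_nat (Suc r) * D = (\<Sum>q\<le>s. fg q * (of_nat (Suc r) * d (s - q)))"
    by (simp only: sum_distrib_left mult_of_nat_swap)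
  also have "\<dots> = (\<Sum>q\<le>s. fg q * (of_nat (s - q) * fpow (Suc r) (s - q)))"
    by (simp only: d_def Suc)
  also have "\<dots> = (\<Sum>q\<le>s. of_nat s * (fg q * fpow (Suc r) (s - q)) - of_nat q * (fg q * fpow (Suc r) (s - q)))"
    by (intro sum.cong) (simp_all add: of_nat_diff left_diff_distrib right_diff_distrib mult_of_nat_swap)
  also have "\<dots> = of_nat s * fpow (Suc (Suc r)) s - D"
    by (simp only: D_def sum_subtractf sum_distrib_left fpow.simps(2))
  finally show ?case
    by (simp add: D_def distrib_right)
qed

lemma ypow_derivative:
  "of_nat (Suc r) * (\<Sum>p\<le>s. of_nat p * (fg p * ypow r (s - p)))
     + (\<Sum>p\<le>s. of_nat p * (yg p * fpow (Suc r) (s - p))) = of_nat s * ypow (Suc r) s"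
proof -
  have "of_nat (Suc r) * (\<Sum>p\<le>s. of_nat p * (fg p * ypow r (s - p)))
      = of_nat (Suc r) * (\<Sum>p\<le>s. \<Sum>q\<le>s - p. yg q * (of_nat p * (fg p * fpow r (s - p - q))))"
    unfolding ypow_def
  proof (intro arg_cong[of _ _ "\<lambda>u. of_nat (Suc r) * u"] sum.cong refl)
    fix p
    have "fg p * (yg q * w) = yg q * (fg p * w)" for q w
      by (metis mult.assoc uea_commutation(3))
    thus "of_nat p * (fg p * (\<Sum>q\<le>s - p. yg q * fpow r (s - p - q)))
        = (\<Sum>q\<le>s - p. yg q * (of_nat p * (fg p * fpow r (s - p - q))))"
      by (simp only: sum_distrib_left mult_of_nat_swap)
  qed
  also have "\<dots> = of_nat (Suc r) * (\<Sum>q\<le>s. \<Sum>p\<le>s - q. yg q * (of_nat p * (fg p * fpow r (s - p - q))))"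
    by (rule arg_cong[of _ _ "\<lambda>u. of_nat (Suc r) * u"], rule sum_triangle_swap)
  also have "\<dots> = (\<Sum>q\<le>s. yg q * (of_nat (Suc r) * (\<Sum>p\<le>s - q. of_nat p * (fg p * fpow r (s - q - p)))))"
    by (simp only: sum_distrib_left mult_of_nat_swap[of "yg q" for q] diff_commute[of s])
  also have "\<dots> = (\<Sum>q\<le>s. yg q * (of_nat (s - q) * fpow (Suc r) (s - q)))"
    by (simp only: fpow_derivative)
  also have "\<dots> = (\<Sum>q\<le>s. of_nat s * (yg q * fpow (Suc r) (s - q)) - of_nat q * (yg q * fpow (Suc r) (s - q)))"
    by (intro sum.cong) (simp_all add: of_nat_diff left_diff_distrib right_diff_distrib mult_of_nat_swap)
  also have "\<dots> = of_nat s * ypow (Suc r) s - (\<Sum>p\<le>s. of_nat p * (yg p * fpow (Suc r) (s - p)))"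
    by (simp only: sum_subtractf sum_distrib_left ypow_def)
  finally show ?thesis by simp
qed

text \<open>Commutation with \<open>xg 0\<close> is a derivation that takes the series of the
  \<open>fg\<close> to that of the \<open>yg\<close>. As all of these commute with the
  \<open>fg\<close>, a power contributes the factor \<open>Suc r\<close>.\<close>

lemma xg_fpow: "xg 0 * fpow (Suc r) s = fpow (Suc r) s * xg 0 + of_nat (Suc r) * ypow r s"
proof (induction r arbitrary: s)
  case 0
  show ?case using fpow_one[of s] uea_commutation(7)[of 0 s] by (simp add: ypow_zero)
next
  case (Suc r)
  have "xg 0 * fpow (Suc (Suc r)) s = (\<Sum>p\<le>s. (fg p * xg 0 + yg p) * fpow (Suc r) (s - p))"
    unfolding fpow.simps(2)[of "Suc r"] sum_distrib_left mult.assoc[symmetric]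
    by (simp add: uea_commutation(7))
  also have "\<dots> = (\<Sum>p\<le>s. fg p * (xg 0 * fpow (Suc r) (s - p))) + ypow (Suc r) s"
    by (simp only: distrib_right sum.distrib mult.assoc ypow_def)
  also have "(\<Sum>p\<le>s. fg p * (xg 0 * fpow (Suc r) (s - p)))
      = (\<Sum>p\<le>s. fg p * fpow (Suc r) (s - p)) * xg 0 + of_nat (Suc r) * (\<Sum>p\<le>s. fg p * ypow r (s - p))"
    unfolding Suc distrib_left sum.distrib sum_distrib_left sum_distrib_right
    by (intro arg_cong2[of _ _ _ _ "(+)"] sum.cong refl) (metis mult.assoc mult_of_nat_commute)+
  finally show ?case by (simp add: ypow_Suc distrib_right add.assoc)
qed

subsection \<open>Left ideals\<close>

global_interpretation uvs: vector_space "\<lambda>c u. uscalar c * u"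
  by unfold_locales (simp_all add: distrib_left distrib_right uscalar_add uscalar_mult mult.assoc)

locale uea_left_ideal =
  fixes K :: "uea set"
  assumes zero: "0 \<in> K"
    and add: "a \<in> K \<Longrightarrow> b \<in> K \<Longrightarrow> a + b \<in> K"
    and mult: "a \<in> K \<Longrightarrow> u * a \<in> K"
begin

lemma uminus: "a \<in> K \<Longrightarrow> - a \<in> K"
  using mult[of a "-1"] by simp

lemma diff: "a \<in> K \<Longrightarrow> b \<in> K \<Longrightarrow> a - b \<in> K"
  using add[of a "- b"] uminus[of b] by simp

lemma sum: "(\<And>i. i \<in> A \<Longrightarrow> g i \<in> K) \<Longrightarrow> sum g A \<in> K"
  by (induction A rule: infinite_finite_induct) (auto intro: zero add)

lemma of_nat_cancel: "of_nat n * a \<in> K \<Longrightarrow> 0 < n \<Longrightarrow> a \<in> K"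
  using mult[of "of_nat n * a" "uscalar (1 / of_nat n)"]
  by (simp add: mult.assoc[symmetric] uscalar_of_nat[symmetric] uscalar_mult[symmetric])

lemma subspace: "uvs.subspace K"
  by (simp add: uvs.subspace_def zero add mult)

text \<open>Two unknown terms, \<open>L - 1\<close> and \<open>L\<close>, and two linear equations.
  The weighted sum minus \<open>L - 1\<close> times the plain sum has weight 0 on the first and
  weight 1 on the second.\<close>

lemma last_term:
  assumes "\<And>p. p \<le> n \<Longrightarrow> p \<noteq> L \<Longrightarrow> p \<noteq> L - 1 \<Longrightarrow> g p \<in> K"
    and "(\<Sum>p\<le>n. g p) \<in> K" "(\<Sum>p\<le>n. of_nat p * g p) \<in> K" and "0 < L" "L \<le> n"
  shows "g L \<in> K"
proof -
  let ?h = "\<lambda>p. of_nat p * g p - of_nat (L - 1) * g p"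
  have "(\<Sum>p\<le>n. ?h p) \<in> K"
    using assms(2,3) by (simp add: sum_subtractf flip: sum_distrib_left) (intro diff mult)
  moreover have "(\<Sum>p\<le>n. ?h p) = ?h L + (\<Sum>p\<in>{..n} - {L}. ?h p)"
    using assms by (intro sum.remove) auto
  moreover have "(\<Sum>p\<in>{..n} - {L}. ?h p) \<in> K"
  proof (rule sum)
    fix p assume "p \<in> {..n} - {L}"
    thus "?h p \<in> K"
      using assms(1)[of p] zero by (cases "p = L - 1") (auto intro: diff mult)
  qed
  moreover have "?h L = g L"
    using assms(4) by (cases L) (simp_all add: distrib_right)
  ultimately show ?thesis
    using diff by fastforce
qed

end

definition ideal_plus :: "uea set \<Rightarrow> uea \<Rightarrow> uea set" where
  "ideal_plus K w = {k + u * w | k u. k \<in> K}"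

lemma ideal_plusI: "k \<in> K \<Longrightarrow> k + u * w \<in> ideal_plus K w"
  by (auto simp: ideal_plus_def)

context uea_left_ideal
begin

lemma ideal_plus: "uea_left_ideal (ideal_plus K w)"
proof
  show "0 \<in> ideal_plus K w"
    using ideal_plusI[OF zero, of 0] by simp
  fix a b assume a: "a \<in> ideal_plus K w"
  then obtain k u where k: "k \<in> K" "a = k + u * w" by (auto simp: ideal_plus_def)
  show "c * a \<in> ideal_plus K w" for c
    using ideal_plusI[OF mult[OF k(1)], of c "c * u" w] k by (simp add: distrib_left mult.assoc)
  assume "b \<in> ideal_plus K w"
  then obtain k' u' where "k' \<in> K" "b = k' + u' * w" by (auto simp: ideal_plus_def)
  thus "a + b \<in> ideal_plus K w"
    using ideal_plusI[OF add[OF k(1), of k'], of "u + u'" w] k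
    by (simp add: distrib_right add_ac)
qed

lemma ideal_plus_superset: "K \<subseteq> ideal_plus K w"
  using ideal_plusI[of _ K 0 w] by auto

lemma ideal_plus_generator: "u * w \<in> ideal_plus K w"
  using ideal_plusI[OF zero, of u w] by simp

end

text \<open>Bounds the dimension of the submodule generated by \<open>v\<close> in the quotient of
  the algebra by \<open>K\<close>. A spanning set makes sense of this without forming the
  quotient.\<close>

definition orbit_dim_le :: "uea set \<Rightarrow> uea \<Rightarrow> nat \<Rightarrow> bool" where
  "orbit_dim_le K v d \<longleftrightarrow> (\<exists>B. finite B \<and> card B \<le> d \<and> (\<forall>u. u * v \<in> uvs.span (B \<union> K)))"

text \<open>Subadditivity along \<open>K \<subseteq> ideal_plus K w\<close>: a spanning set for the
  orbit of \<open>w\<close> modulo \<open>K\<close> supplies what has been divided out in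
  addition.\<close>

lemma orbit_dim_le_extend:
  assumes "orbit_dim_le (ideal_plus K w) v d" "orbit_dim_le K w d'"
  shows "orbit_dim_le K v (d + d')"
proof -
  obtain B where B: "finite B" "card B \<le> d" "\<And>u. u * v \<in> uvs.span (B \<union> ideal_plus K w)"
    using assms(1) by (auto simp: orbit_dim_le_def)
  obtain C where C: "finite C" "card C \<le> d'" "\<And>u. u * w \<in> uvs.span (C \<union> K)"
    using assms(2) by (auto simp: orbit_dim_le_def)
  have "ideal_plus K w \<subseteq> uvs.span (C \<union> K)"
    using C(3) by (auto simp: ideal_plus_def intro!: uvs.span_add intro: uvs.span_base)
  also have "\<dots> \<subseteq> uvs.span (B \<union> C \<union> K)"
    by (rule uvs.span_mono) auto
  finally have "B \<union> ideal_plus K w \<subseteq> uvs.span (B \<union> C \<union> K)"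
    by (auto intro: uvs.span_base)
  hence "uvs.span (B \<union> ideal_plus K w) \<subseteq> uvs.span (B \<union> C \<union> K)"
    by (rule uvs.span_minimal) simp
  moreover have "card (B \<union> C) \<le> d + d'"
    using card_Un_le[of B C] B C by linarith
  ultimately show ?thesis
    using B C unfolding orbit_dim_le_def by (intro exI[of _ "B \<union> C"]) auto
qed

lemma abs_uea_single: "abs_uea (Poly_Mapping.single (UWord gs) c) = uscalar c * prod_list (map ugen gs)"
proof -
  have "Poly_Mapping.single (UWord gs) c = free_scalar c * prod_list (map free_gen gs)"
  proof (induction gs)
    case Nil
    show ?case by (simp add: free_scalar_def zero_uword_def)
  next
    case (Cons g gs)
    have "free_scalar c * (free_gen g * prod_list (map free_gen gs)) =
        free_gen g * Poly_Mapping.single (UWord gs) c"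
      by (simp add: Cons flip: mult.assoc free_scalar_commute)
    also have "\<dots> = Poly_Mapping.single (UWord (g # gs)) c"
      by (simp add: free_gen_def mult_single plus_uword_def)
    finally show ?case by simp
  qed
  moreover have "abs_uea (prod_list (map free_gen gs)) = prod_list (map ugen gs)"
    by (induction gs) (simp_all add: abs_uea_1 abs_uea_mult abs_uea_gen)
  ultimately show ?thesis by (simp add: abs_uea_mult abs_uea_scalar)
qed

text \<open>The odd generators suffice to generate the algebra.\<close>

lemma orbit_in_subspace:
  assumes S: "uvs.subspace S" and v: "v \<in> S"
    and x: "\<And>r a. a \<in> S \<Longrightarrow> xg r * a \<in> S" and y: "\<And>r a. a \<in> S \<Longrightarrow> yg r * a \<in> S"
  shows "u * v \<in> S"
proof -
  have half: "a \<in> S" if "2 * a \<in> S" for a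
    using uvs.subspace_scale[OF S that, of "1 / 2"]
    by (simp add: uscalar_mult[symmetric] flip: mult.assoc uscalar_numeral)
  have e: "eg r * a \<in> S" if "a \<in> S" for r a
    using half[of "eg r * a"] uvs.subspace_add[OF S x[OF x[OF that]] x[OF x[OF that]], of 0 r r 0]
      uea_commutation(9)[of 0 r] by (simp flip: mult.assoc distrib_right)
  have f: "fg r * a \<in> S" if "a \<in> S" for r a
  proof (rule half)
    have "- (2 * (fg r * a)) \<in> S"
      using uvs.subspace_add[OF S y[OF y[OF that]] y[OF y[OF that]], of 0 r r 0]
        uea_commutation(1)[of 0 r] by (simp flip: mult.assoc distrib_right)
    thus "2 * (fg r * a) \<in> S"
      using uvs.subspace_neg[OF S] by force
  qed
  have h: "hg r * a \<in> S" if "a \<in> S" for r a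
  proof -
    have "hg r = xg 0 * yg r + yg r * xg 0"
      using uea_commutation(6)[of 0 r] by simp
    thus ?thesis
      using uvs.subspace_add[OF S x[OF y[OF that]] y[OF x[OF that]]]
      by (simp add: distrib_right mult.assoc)
  qed
  have g: "ugen g * a \<in> S" if "a \<in> S" for g a
    using e f h x y that by (cases g; cases "fst g") auto
  have "abs_uea p * v \<in> S" for p
  proof (induction p rule: poly_mapping_additive_induct)
    case (single k c)
    have "prod_list (map ugen gs) * v \<in> S" for gs
      by (induction gs) (simp_all add: v g mult.assoc)
    thus ?case
      using uvs.subspace_scale[OF S] by (cases k) (simp add: abs_uea_single mult.assoc)
  next
    case (add p q)
    thus ?case using uvs.subspace_add[OF S] by (simp add: abs_uea_add distrib_right)
  qed
  from this[of "rep_uea u"] show ?thesis by (simp add: abs_rep_uea)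
qed

subsection \<open>Highest weight vectors modulo a left ideal\<close>

text \<open>Vanishing under the \<open>xg\<close> covers the \<open>eg\<close> as well, which are
  halves of anticommutators of the \<open>xg\<close>.\<close>

definition hw_mod :: "uea set \<Rightarrow> nat \<Rightarrow> uea \<Rightarrow> bool" where
  "hw_mod K n v \<longleftrightarrow> (\<forall>r. xg r * v \<in> K) \<and> hg 0 * v - of_nat n * v \<in> K \<and> (\<forall>r>0. hg r * v \<in> K)"

definition frels :: "uea set \<Rightarrow> (nat \<Rightarrow> nat) \<Rightarrow> uea \<Rightarrow> bool" where
  "frels K D v \<longleftrightarrow> (\<forall>r s. D r < r + s \<longrightarrow> fpow r s * v \<in> K)"

text \<open>The indices are shifted because \<open>ypow r s\<close> arises from
  \<open>fpow (Suc r) s\<close> by commutation with \<open>xg 0\<close>, as in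
  \<open>yrels_of_frels\<close>.\<close>

definition yrels :: "uea set \<Rightarrow> (nat \<Rightarrow> nat) \<Rightarrow> uea \<Rightarrow> bool" where
  "yrels K D v \<longleftrightarrow> (\<forall>r s. D (Suc r) < Suc r + s \<longrightarrow> ypow r s * v \<in> K)"

lemma hw_modD:
  assumes "hw_mod K n v"
  shows "xg r * v \<in> K" "hg 0 * v - of_nat n * v \<in> K" "0 < r \<Longrightarrow> hg r * v \<in> K"
  using assms by (auto simp: hw_mod_def)

section \<open>Commutation with powers of lowering operators; identities of Garland type\<close>

lemma hg_fpow:
  "hg q * fpow (Suc r) s = fpow (Suc r) s * hg q
     - of_nat (2 * Suc r) * (\<Sum>m\<le>s. fg (q + m) * fpow r (s - m))"
proof (induction r arbitrary: s)
  case 0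
  have "(\<Sum>m\<le>s. fg (q + m) * fpow 0 (s - m)) = (\<Sum>m\<le>s. if m = s then fg (q + m) else 0)"
    by (intro sum.cong) auto
  thus ?case using fpow_one[of s] uea_commutation(4)[of q s] by simp
next
  case (Suc r)
  have swap: "fg p * (fg t * w) = fg t * (fg p * w)" for p t w
    by (metis mult.assoc uea_commutation(2))
  have "hg q * fpow (Suc (Suc r)) s = (\<Sum>p\<le>s. (fg p * hg q - 2 * fg (q + p)) * fpow (Suc r) (s - p))"
    unfolding fpow.simps(2)[of "Suc r"] sum_distrib_left mult.assoc[symmetric]
    by (simp only: uea_commutation(4))
  also have "\<dots> = (\<Sum>p\<le>s. fg p * (hg q * fpow (Suc r) (s - p))) - 2 * (\<Sum>p\<le>s. fg (q + p) * fpow (Suc r) (s - p))"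
    by (simp only: left_diff_distrib sum_subtractf mult.assoc sum_distrib_left)
  also have "(\<Sum>p\<le>s. fg p * (hg q * fpow (Suc r) (s - p)))
      = fpow (Suc (Suc r)) s * hg q
        - of_nat (2 * Suc r) * (\<Sum>p\<le>s. \<Sum>m\<le>s - p. fg p * (fg (q + m) * fpow r (s - p - m)))"
    unfolding Suc fpow.simps(2)[of "Suc r"]
    by (simp only: right_diff_distrib sum_subtractf sum_distrib_right sum_distrib_left mult_of_nat_swap mult.assoc)
  also have "(\<Sum>p\<le>s. \<Sum>m\<le>s - p. fg p * (fg (q + m) * fpow r (s - p - m)))
      = (\<Sum>m\<le>s. \<Sum>p\<le>s - m. fg p * (fg (q + m) * fpow r (s - p - m)))"
    by (rule sum_triangle_swap)
  also have "\<dots> = (\<Sum>m\<le>s. fg (q + m) * fpow (Suc r) (s - m))"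
    unfolding fpow.simps(2) sum_distrib_left
    by (intro sum.cong refl) (simp only: swap diff_commute[of s])
  finally show ?case
    by (simp add: algebra_simps mult_2 del: fpow.simps)
qed

lemma fg_power_commute: "fg q * fg L ^ i = fg L ^ i * fg q"
  by (rule power_commuting_commutes[symmetric]) (rule uea_commutation(2))

lemma yg_power_commute: "yg q * fg L ^ i = fg L ^ i * yg q"
  by (rule power_commuting_commutes[symmetric]) (rule uea_commutation(3))

lemma hg_power: "hg q * fg L ^ Suc i = fg L ^ Suc i * hg q - of_nat (2 * Suc i) * (fg (q + L) * fg L ^ i)"
proof (induction i)
  case 0
  show ?case using uea_commutation(4)[of q L] by simp
next
  case (Suc i)
  have "hg q * fg L ^ Suc (Suc i) = fg L * (hg q * fg L ^ Suc i) - 2 * fg (q + L) * fg L ^ Suc i"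
    by (metis uea_commutation(4) left_diff_distrib mult.assoc power_Suc)
  also have "fg L * (hg q * fg L ^ Suc i) = fg L ^ Suc (Suc i) * hg q
      - of_nat (2 * Suc i) * (fg (q + L) * fg L ^ Suc i)"
    unfolding Suc right_diff_distrib mult_of_nat_swap
    by (simp add: uea_commutation(2)[of L "q + L"] flip: mult.assoc)
  finally show ?case by (simp add: algebra_simps mult_2)
qed

lemma xg_power: "xg q * fg L ^ Suc i = fg L ^ Suc i * xg q + of_nat (Suc i) * (yg (q + L) * fg L ^ i)"
proof (induction i)
  case 0
  show ?case using uea_commutation(7)[of q L] by simp
next
  case (Suc i)
  have "xg q * fg L ^ Suc (Suc i) = fg L * (xg q * fg L ^ Suc i) + yg (q + L) * fg L ^ Suc i"
    by (metis uea_commutation(7) distrib_right mult.assoc power_Suc)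
  also have "fg L * (xg q * fg L ^ Suc i) = fg L ^ Suc (Suc i) * xg q
      + of_nat (Suc i) * (yg (q + L) * fg L ^ Suc i)"
    unfolding Suc distrib_left mult_of_nat_swap
    by (simp add: uea_commutation(3)[of L "q + L"] flip: mult.assoc)
  finally show ?case by (simp add: algebra_simps)
qed

text \<open>Acting with \<open>eg 1\<close> trades one lowering factor for one unit of degree:
  \<open>eg 1\<close> turns a factor \<open>fg p\<close> into \<open>hg (Suc p)\<close>, which then
  moves right until it kills \<open>v\<close>.\<close>

lemma (in uea_left_ideal) garland_step:
  assumes hw: "hw_mod K n v"
  shows "eg 1 * (fpow (Suc r) s * v) + of_nat (Suc r * Suc s) * (fpow r (Suc s) * v) \<in> K"
proof -
  have e: "eg q * v \<in> K" for q
  proof (rule of_nat_cancel[of 2])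
    have "2 * (eg q * v) = xg 0 * (xg q * v) + xg q * (xg 0 * v)"
      using uea_commutation(9)[of 0 q] by (metis add_0 distrib_right mult.assoc)
    thus "of_nat 2 * (eg q * v) \<in> K"
      using hw_modD(1)[OF hw] by (simp add: add mult)
  qed simp
  have h: "hg (Suc q) * v \<in> K" for q
    using hw_modD(3)[OF hw] by simp
  show ?thesis
  proof (induction r arbitrary: s)
    case 0
    have "eg 1 * (fpow (Suc 0) s * v) = fg s * (eg 1 * v) + hg (Suc s) * v"
      using fpow_one[of s] uea_commutation(8)[of 1 s]
      by (simp add: distrib_right flip: mult.assoc)
    thus ?case using e h by (simp add: add mult zero)
  next
    case (Suc r)
    define F where "F = (\<lambda>p. fpow (Suc r) p * v)"
    define c :: uea where "c = of_nat (Suc r)"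
    \<comment> \<open>\<open>T\<close> is the weighted sum of \<open>fpow_derivative\<close>. Modulo
      \<open>K\<close> the commutators \<open>hg (Suc p)\<close> contribute
      \<open>- 2 * c * T\<close> and the induction hypothesis
      \<open>c * (T - of_nat (Suc s) * F (Suc s))\<close>. Replacing \<open>c * T\<close> by
      \<open>of_nat (Suc s) * F (Suc s)\<close> gives the factor \<open>c + 1\<close>, that is
      \<open>r + 2\<close>.\<close>
    define T where "T = (\<Sum>p\<le>Suc s. of_nat p * (fg p * fpow r (Suc s - p))) * v"
    have cT: "c * T = of_nat (Suc s) * F (Suc s)"
      using arg_cong[OF fpow_derivative[of r "Suc s"], of "\<lambda>u. u * v"]
      by (simp only: mult.assoc c_def T_def F_def)
    have "eg 1 * (fpow (Suc (Suc r)) s * v) = (\<Sum>p\<le>s. (eg 1 * fg p) * (fpow (Suc r) (s - p) * v))"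
      unfolding fpow.simps(2)[of "Suc r"] sum_distrib_left sum_distrib_right mult.assoc ..
    also have "\<dots> = (\<Sum>p\<le>s. fg p * (eg 1 * F (s - p))) + (\<Sum>p\<le>s. hg (Suc p) * F (s - p))"
      by (simp only: uea_commutation(8) distrib_right sum.distrib mult.assoc F_def plus_1_eq_Suc)
    finally have split: "eg 1 * (fpow (Suc (Suc r)) s * v)
        = (\<Sum>p\<le>s. fg p * (eg 1 * F (s - p))) + (\<Sum>p\<le>s. hg (Suc p) * F (s - p))" .
    have hF: "hg (Suc p) * F t = fpow (Suc r) t * (hg (Suc p) * v)
        - 2 * c * ((\<Sum>m\<le>t. fg (Suc p + m) * fpow r (t - m)) * v)" for p t
    proof -
      have "hg (Suc p) * F t = (hg (Suc p) * fpow (Suc r) t) * v"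
        by (simp only: F_def mult.assoc)
      thus ?thesis
        by (simp only: hg_fpow left_diff_distrib mult.assoc c_def of_nat_mult of_nat_numeral)
    qed
    have "(\<Sum>p\<le>s. hg (Suc p) * F (s - p)) + 2 * c * T \<in> K"
    proof -
      have "(\<Sum>p\<le>s. hg (Suc p) * F (s - p)) = (\<Sum>p\<le>s. fpow (Suc r) (s - p) * (hg (Suc p) * v))
          - 2 * c * ((\<Sum>p\<le>s. \<Sum>m\<le>s - p. fg (Suc p + m) * fpow r (s - p - m)) * v)"
        by (simp only: hF sum_subtractf sum_distrib_left sum_distrib_right)
      \<comment> \<open>Only \<open>k = p + m\<close> matters, and it arises from
        \<open>k + 1\<close> values of \<open>p\<close>. This multiplicity is the weight of the term
        of index \<open>Suc k\<close> in \<open>T\<close>.\<close>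
      also have "(\<Sum>p\<le>s. \<Sum>m\<le>s - p. fg (Suc p + m) * fpow r (s - p - m))
          = (\<Sum>k\<le>s. \<Sum>p\<le>k. fg (Suc k) * fpow r (s - k))"
        unfolding sum.Sigma[OF finite_atMost ballI[OF finite_atMost]]
        by (rule sum.reindex_bij_witness[of _ "\<lambda>(k, p). (p, k - p)" "\<lambda>(p, m). (p + m, p)"]) auto
      also have "\<dots> = (\<Sum>k\<le>Suc s. of_nat k * (fg k * fpow r (Suc s - k)))"
        by (simp add: sum.atMost_Suc_shift del: sum.atMost_Suc fpow.simps)
      finally have "(\<Sum>p\<le>s. hg (Suc p) * F (s - p)) + 2 * c * T
          = (\<Sum>p\<le>s. fpow (Suc r) (s - p) * (hg (Suc p) * v))"
        by (simp add: T_def)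
      thus ?thesis by (simp add: sum mult h del: fpow.simps)
    qed
    moreover have "(\<Sum>p\<le>s. fg p * (eg 1 * F (s - p))) + c * (of_nat (Suc s) * F (Suc s) - T) \<in> K"
    proof -
      have "of_nat (Suc s) * F (Suc s) - T
          = (\<Sum>p\<le>Suc s. of_nat (Suc s - p) * (fg p * (fpow r (Suc s - p) * v)))"
        unfolding F_def T_def fpow.simps(2) sum_distrib_left sum_distrib_right sum_subtractf[symmetric]
        by (intro sum.cong refl) (simp add: of_nat_diff left_diff_distrib mult.assoc)
      also have "\<dots> = (\<Sum>p\<le>s. fg p * (of_nat (Suc (s - p)) * (fpow r (Suc (s - p)) * v)))"
        by (simp add: Suc_diff_le mult_of_nat_swap del: fpow.simps of_nat_Suc of_nat_diff)
      finally have "c * (of_nat (Suc s) * F (Suc s) - T)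
          = (\<Sum>p\<le>s. fg p * (of_nat (Suc r * Suc (s - p)) * (fpow r (Suc (s - p)) * v)))"
        by (simp only: c_def sum_distrib_left mult_of_nat_swap[of "fg p" for p] of_nat_mult mult.assoc)
      thus ?thesis
        using Suc[of "s - p" for p] unfolding F_def
        by (simp only: sum.distrib[symmetric] distrib_left[symmetric] sum mult)
    qed
    ultimately have "(\<Sum>p\<le>s. hg (Suc p) * F (s - p)) + 2 * c * T
        + ((\<Sum>p\<le>s. fg p * (eg 1 * F (s - p))) + c * (of_nat (Suc s) * F (Suc s) - T)) \<in> K"
      by (rule add)
    moreover have "2 * c * T + c * (of_nat (Suc s) * F (Suc s) - T)
        = of_nat (Suc (Suc r) * Suc s) * F (Suc s)"
    proof -
      have "2 * c * T + c * (of_nat (Suc s) * F (Suc s) - T) = c * T + c * (of_nat (Suc s) * F (Suc s))"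
        by (simp add: mult_2 right_diff_distrib distrib_right)
      also have "\<dots> = of_nat (Suc (Suc r) * Suc s) * F (Suc s)"
        unfolding cT unfolding c_def by (simp add: algebra_simps)
      finally show ?thesis .
    qed
    ultimately have "(\<Sum>p\<le>s. fg p * (eg 1 * F (s - p))) + (\<Sum>p\<le>s. hg (Suc p) * F (s - p))
        + of_nat (Suc (Suc r) * Suc s) * F (Suc s) \<in> K"
      by (metis (no_types, lifting) add.assoc add.commute)
    thus ?case
      unfolding split by (simp only: F_def)
  qed
qed

text \<open>Since \<open>garland_step\<close> preserves \<open>r + s\<close>, all these relations
  follow from those with \<open>s = 0\<close>, which are multiples of the given power.\<close>

lemma (in uea_left_ideal) garland:
  assumes hw: "hw_mod K n v" and f: "fg 0 ^ (m + 1) * v \<in> K" and rs: "m < r + s"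
  shows "fpow r s * v \<in> K"
  using rs
proof (induction s arbitrary: r)
  case 0
  have "fg 0 ^ r * v = fg 0 ^ (r - (m + 1)) * (fg 0 ^ (m + 1) * v)"
    using 0 by (simp add: mult.assoc[symmetric] del: power_Suc flip: power_add)
  thus ?case using mult[OF f] by (simp add: fpow_zero_right)
next
  case (Suc s)
  have "eg 1 * (fpow (Suc r) s * v) \<in> K"
    by (rule mult, rule Suc.IH) (use Suc.prems in simp)
  from diff[OF garland_step[OF hw, of r s] this]
  have "of_nat (Suc r * Suc s) * (fpow r (Suc s) * v) \<in> K"
    by simp
  thus ?case by (rule of_nat_cancel) simp
qed

subsection \<open>An upper bound for cyclic modules with given truncations\<close>

text \<open>The number of boxes in the first \<open>r\<close> columns of the diagram with rows
  \<open>xs\<close>.\<close>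

definition min_sum :: "nat list \<Rightarrow> nat \<Rightarrow> nat" where
  "min_sum xs r = (\<Sum>x\<leftarrow>xs. min r x)"

lemma min_sum_simps [simp]: "min_sum [] r = 0" "min_sum (x # xs) r = min r x + min_sum xs r"
  by (simp_all add: min_sum_def)

lemma min_sum_Suc: "min_sum xs (Suc r) \<le> min_sum xs r + length xs"
  by (induction xs) auto

lemma min_sum_all_ge: "(\<And>x. x \<in> set xs \<Longrightarrow> r \<le> x) \<Longrightarrow> min_sum xs r = r * length xs"
  by (induction xs) auto

lemma min_sum_mset: "mset xs = mset ys \<Longrightarrow> min_sum xs r = min_sum ys r"
  unfolding min_sum_def by (metis mset_map sum_mset_sum_list)

lemma min_diff_le: "min r (x - i) \<le> min r (x - Suc i) + 1" for r x i :: nat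
  by (cases "x \<le> i") auto

lemma min_Suc_diff: "i < x \<Longrightarrow> min (Suc r) (x - i) = min r (x - Suc i) + 1" for r x i :: nat
  by (cases x) (auto simp: Suc_diff_le)

section \<open>Relations inherited by \<open>fg L * v\<close> and \<open>yg L * v\<close>\<close>

context uea_left_ideal
begin

lemma last_summand:
  fixes n L :: nat
  assumes "\<And>p. p \<le> n \<Longrightarrow> p \<noteq> L \<Longrightarrow> g p \<in> K" "(\<Sum>p\<le>n. g p) \<in> K" "L \<le> n"
  shows "g L \<in> K"
proof -
  have "(\<Sum>p\<le>n. g p) = g L + (\<Sum>p\<in>{..n} - {L}. g p)"
    using assms by (intro sum.remove) auto
  moreover have "(\<Sum>p\<in>{..n} - {L}. g p) \<in> K"
    using assms(1) by (intro sum) auto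
  ultimately show ?thesis
    using diff[OF assms(2)] by fastforce
qed

text \<open>The target is the term \<open>p = L\<close> in coefficient \<open>s + L\<close> of the
  power \<open>Suc r\<close>. Terms with \<open>p > L\<close> lie in \<open>K\<close> because
  \<open>fg p\<close> kills \<open>v\<close>, those with \<open>p < L - 1\<close> by the first bound
  on \<open>D\<close>. The derivative identity separates the terms \<open>L - 1\<close> and
  \<open>L\<close>, as in \<open>last_term\<close>.\<close>

lemma frels_fg:
  assumes L: "0 < L" "\<And>p. L < p \<Longrightarrow> fg p * v \<in> K" and f: "frels K D v"
    and D: "\<And>r. D r \<le> D' r + 2" "\<And>r. D (Suc r) \<le> D' r + L + 1"
  shows "frels K D' (fg L * v)"
  unfolding frels_def
proof (intro allI impI)
  fix r s assume rs: "D' r < r + s"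
  let ?n = "s + L"
  let ?g = "\<lambda>p. fg p * (fpow r (?n - p) * v)"
  have all: "fpow (Suc r) ?n * v \<in> K"
    using f rs D(2)[of r] by (auto simp: frels_def simp del: fpow.simps)
  have g: "?g p \<in> K" if "p \<le> ?n" "p \<noteq> L" "p \<noteq> L - 1" for p
  proof (cases "p < L")
    case True
    have "fpow r (?n - p) * v \<in> K"
      using f rs D(1)[of r] that True by (auto simp: frels_def)
    thus ?thesis by (rule mult)
  next
    case False
    have "?g p = fpow r (?n - p) * (fg p * v)"
      by (metis fg_fpow_commute mult.assoc)
    thus ?thesis using L that False by (simp add: mult)
  qed
  have "?g L \<in> K"
  proof (rule last_term[where n = ?n and g = ?g])
    show "(\<Sum>p\<le>?n. ?g p) \<in> K"
      using all by (simp add: sum_distrib_right mult.assoc)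
    have "of_nat (Suc r) * (\<Sum>p\<le>?n. of_nat p * ?g p) = of_nat ?n * (fpow (Suc r) ?n * v)"
      using arg_cong[OF fpow_derivative[of r ?n], of "\<lambda>u. u * v"]
      by (simp only: mult.assoc sum_distrib_right)
    thus "(\<Sum>p\<le>?n. of_nat p * ?g p) \<in> K"
      using mult[OF all] of_nat_cancel by (metis zero_less_Suc)
  qed (use g L in auto)
  moreover have "?g L = fpow r s * (fg L * v)"
    by (simp add: fg_fpow_commute flip: mult.assoc)
  ultimately show "fpow r s * (fg L * v) \<in> K" by simp
qed

text \<open>As for \<open>frels_fg\<close>, but the derivative of \<open>ypow\<close> has a second
  sum, where the weight sits on the odd factor. Its terms lie in \<open>K\<close> one by one:
  \<open>E\<close> and \<open>D\<close> leave only \<open>p = L\<close>, which the plain sum then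
  settles.\<close>

lemma yrels_fg:
  assumes L: "0 < L" "\<And>p. L < p \<Longrightarrow> fg p * v \<in> K" "\<And>p. L < p \<Longrightarrow> yg p * v \<in> K"
    and f: "frels K D v" and y: "yrels K E v"
    and E: "\<And>r. E r \<le> E' r + 2" "\<And>r. E (Suc r) \<le> E' r + L + 1" "\<And>r. D r \<le> E' r + 1"
  shows "yrels K E' (fg L * v)"
  unfolding yrels_def
proof (intro allI impI)
  fix r s assume rs: "E' (Suc r) < Suc r + s"
  let ?n = "s + L"
  let ?g = "\<lambda>p. fg p * (ypow r (?n - p) * v)" and ?k = "\<lambda>p. yg p * (fpow (Suc r) (?n - p) * v)"
  have all: "ypow (Suc r) ?n * v \<in> K"
    using y rs E(2)[of "Suc r"] by (auto simp: yrels_def)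
  have g: "?g p \<in> K" if "p \<le> ?n" "p \<noteq> L" "p \<noteq> L - 1" for p
  proof (cases "p < L")
    case True
    have "ypow r (?n - p) * v \<in> K"
      using y rs E(1)[of "Suc r"] that True by (auto simp: yrels_def)
    thus ?thesis by (rule mult)
  next
    case False
    have "?g p = ypow r (?n - p) * (fg p * v)"
      by (metis fg_ypow_commute mult.assoc)
    thus ?thesis using L that False by (simp add: mult)
  qed
  have k: "?k p \<in> K" if "p \<noteq> L" for p
  proof (cases "p < L")
    case True
    have "fpow (Suc r) (?n - p) * v \<in> K"
      using f rs E(3)[of "Suc r"] that True by (auto simp: frels_def simp del: fpow.simps)
    thus ?thesis by (rule mult)
  next
    case False
    have "?k p = fpow (Suc r) (?n - p) * (yg p * v)"
      by (metis yg_fpow_commute mult.assoc)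
    thus ?thesis using L that False by (simp add: mult del: fpow.simps)
  qed
  have kL: "?k L \<in> K"
    by (rule last_summand[where n = ?n and g = ?k]) (use k all in \<open>simp_all add: ypow_def sum_distrib_right mult.assoc del: fpow.simps\<close>)
  have "?g L \<in> K"
  proof (rule last_term[where n = ?n and g = ?g])
    show "(\<Sum>p\<le>?n. ?g p) \<in> K"
      using all by (simp add: ypow_Suc sum_distrib_right mult.assoc)
    have "of_nat (Suc r) * (\<Sum>p\<le>?n. of_nat p * ?g p) + (\<Sum>p\<le>?n. of_nat p * ?k p)
        = of_nat ?n * (ypow (Suc r) ?n * v)"
      using arg_cong[OF ypow_derivative[of r ?n], of "\<lambda>u. u * v"]
      by (simp only: mult.assoc sum_distrib_right distrib_right)
    hence "of_nat (Suc r) * (\<Sum>p\<le>?n. of_nat p * ?g p)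
        = of_nat ?n * (ypow (Suc r) ?n * v) - (\<Sum>p\<le>?n. of_nat p * ?k p)"
      by (simp only: eq_diff_eq)
    moreover have "(\<Sum>p\<le>?n. of_nat p * ?k p) \<in> K"
    proof (rule sum)
      fix p
      show "of_nat p * ?k p \<in> K"
        using k[of p] kL by (intro mult[of "?k p"]) metis
    qed
    ultimately have "of_nat (Suc r) * (\<Sum>p\<le>?n. of_nat p * ?g p) \<in> K"
      using diff[OF mult[OF all]] by (simp only:)
    thus "(\<Sum>p\<le>?n. of_nat p * ?g p) \<in> K"
      using of_nat_cancel by (metis zero_less_Suc)
  qed (use g L in auto)
  moreover have "?g L = ypow r s * (fg L * v)"
    by (simp add: fg_ypow_commute flip: mult.assoc)
  ultimately show "ypow r s * (fg L * v) \<in> K" by simp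
qed

text \<open>The first bound has 1 where \<open>frels_fg\<close> has 2, so it also disposes of
  \<open>p = L - 1\<close>; the plain sum isolates \<open>p = L\<close> and no derivative
  enters.\<close>

lemma frels_yg:
  assumes L: "\<And>p. L < p \<Longrightarrow> yg p * v \<in> K" and f: "frels K D v" and y: "yrels K E v"
    and D: "\<And>r. D r \<le> D' r + 1" "\<And>r. E (Suc r) \<le> D' r + L + 1"
  shows "frels K D' (yg L * v)"
  unfolding frels_def
proof (intro allI impI)
  fix r s assume rs: "D' r < r + s"
  let ?n = "s + L"
  let ?k = "\<lambda>p. yg p * (fpow r (?n - p) * v)"
  have k: "?k p \<in> K" if "p \<noteq> L" for p
  proof (cases "p < L")
    case True
    have "fpow r (?n - p) * v \<in> K"
      using f rs D(1)[of r] that True by (auto simp: frels_def)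
    thus ?thesis by (rule mult)
  next
    case False
    have "?k p = fpow r (?n - p) * (yg p * v)"
      by (metis yg_fpow_commute mult.assoc)
    thus ?thesis using L that False by (simp add: mult)
  qed
  have all: "ypow r ?n * v \<in> K"
    using y rs D(2)[of r] by (auto simp: yrels_def)
  have "?k L \<in> K"
    by (rule last_summand[where n = ?n and g = ?k])
      (use k all in \<open>simp_all add: ypow_def sum_distrib_right mult.assoc\<close>)
  moreover have "?k L = fpow r s * (yg L * v)"
    by (simp add: yg_fpow_commute flip: mult.assoc)
  ultimately show "fpow r s * (yg L * v) \<in> K" by simp
qed

text \<open>If all \<open>x\<^sub>\<alpha>\<^sup>- \<otimes> t\<^sup>p\<close> with \<open>p > L\<close> kill \<open>v\<close> then, by its degree, every monomial of
  \<open>fpow r s\<close> that does not contain the \<open>b\<close>-th power of \<open>x\<^sub>\<alpha>\<^sup>- \<otimes> t\<^sup>L\<close> kills \<open>v\<close>.\<close>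

lemma fpow_concentrated:
  assumes "0 < L" "\<And>p. L < p \<Longrightarrow> fg p * v \<in> K" "L * r + b \<le> r + s"
  shows "fpow r s * v \<in> ideal_plus K (fg L ^ b * v)"
  using assms(2,3)
proof (induction r arbitrary: s b v)
  case 0
  thus ?case
    using ideal_plusI[OF zero, of 1 v] ideal_plusI[OF zero, of 0] by (cases "b = 0") auto
next
  case (Suc r)
  interpret I: uea_left_ideal "ideal_plus K (fg L ^ b * v)" by (rule ideal_plus)
  have comm: "fg p * (u * v) \<in> K" if "L < p" "u * fg p = fg p * u" for p u
    using Suc.prems(1)[OF that(1)] mult[of "fg p * v" u] that(2) by (metis mult.assoc)
  have "fpow r (s - p) * (fg p * v) \<in> ideal_plus K (fg L ^ b * v)" if "p \<le> s" for p
  proof (cases p L rule: linorder_cases)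
    \<comment> \<open>For \<open>p < L\<close> the inequality survives with the same
      \<open>b\<close>, because \<open>p + 1 \<le> L\<close>. For \<open>p = L\<close> one unit is
      lost, which \<open>b - 1\<close> makes up.\<close>
    case less
    have "fpow r (s - p) * v \<in> ideal_plus K (fg L ^ b * v)"
      using Suc.prems less that by (intro Suc.IH) auto
    from I.mult[OF this, of "fg p"] show ?thesis
      by (metis fg_fpow_commute mult.assoc)
  next
    case equal
    show ?thesis
    proof (cases b)
      case 0
      thus ?thesis
        using ideal_plusI[OF zero, of "fpow r (s - p) * fg p" v] by (simp add: mult.assoc)
    next
      case b: (Suc c)
      have "fpow r (s - p) * (fg L * v) \<in> ideal_plus K (fg L ^ c * (fg L * v))"
        using Suc.prems equal that b
        by (intro Suc.IH) (auto intro!: comm simp: uea_commutation(2))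
      thus ?thesis using equal b by (simp add: power_Suc2 mult.assoc del: power_Suc)
    qed
  next
    case greater
    thus ?thesis
      using Suc.prems(1) ideal_plus_superset by (auto intro: I.mult)
  qed
  thus ?case
    by (simp only: fpow_Suc_right sum_distrib_right mult.assoc) (intro I.sum, simp)
qed

lemma fg_kills:
  assumes "frels K D v" "D 1 \<le> Suc L" "L < p"
  shows "fg p * v \<in> K"
  using assms(1)[unfolded frels_def, rule_format, of 1 p] assms(2,3) fpow_one[of p] by simp

text \<open>Apply \<open>xg 0\<close>, which kills \<open>v\<close> modulo \<open>K\<close>, to the
  even relation and cancel \<open>Suc r\<close>.\<close>

lemma yrels_of_frels:
  assumes hw: "hw_mod K n v" and f: "frels K D v"
  shows "yrels K D v"
  unfolding yrels_def
proof (intro allI impI)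
  fix r s assume "D (Suc r) < Suc r + s"
  hence a: "fpow (Suc r) s * v \<in> K" using f by (auto simp: frels_def simp del: fpow.simps)
  have "xg 0 * (fpow (Suc r) s * v) = fpow (Suc r) s * (xg 0 * v) + of_nat (Suc r) * (ypow r s * v)"
    using arg_cong[OF xg_fpow[of r s], of "\<lambda>u. u * v"] by (simp only: distrib_right mult.assoc)
  hence "of_nat (Suc r) * (ypow r s * v) \<in> K"
    using diff[OF mult[OF a, of "xg 0"] mult[OF hw_modD(1)[OF hw, of 0], of "fpow (Suc r) s"]]
    by (metis add_diff_cancel_left')
  thus "ypow r s * v \<in> K" by (rule of_nat_cancel) simp
qed

text \<open>With a single part every \<open>fg p\<close>, hence every \<open>yg p\<close>, with
  \<open>p > 0\<close> kills \<open>v\<close>. Only the copy of osp(1,2) in degree 0 acts by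
  lowering operators, and the vectors \<open>yg 0 ^ i * v\<close> with \<open>i \<le> 2 * n\<close>
  span.\<close>

lemma orbit_dim_le_single:
  assumes hw: "hw_mod K n v" and f: "frels K (min_sum [n]) v"
  shows "orbit_dim_le K v (2 * n + 1)"
proof -
  have f1: "fg p * v \<in> K" if "0 < p" for p
    by (rule fg_kills[OF f _ that]) simp
  have "fpow (Suc n) 0 * v \<in> K"
    using f by (auto simp: frels_def simp del: fpow.simps)
  hence fn: "fg 0 ^ Suc n * v \<in> K"
    by (simp only: fpow_zero_right)
  have y1: "yg p * v \<in> K" if "0 < p" for p
  proof -
    have "yg p * v = xg 0 * (fg p * v) - fg p * (xg 0 * v)"
      using uea_commutation(7)[of 0 p] by (simp add: distrib_right flip: mult.assoc)
    thus ?thesis using mult[OF f1[OF that]] mult hw_modD(1)[OF hw] by (auto intro: diff)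
  qed
  define w where "w = (\<lambda>i. yg 0 ^ i * v)"
  have ff: "fg p * w i \<in> K" if "0 < p" for p i
  proof -
    have "fg p * w i = yg 0 ^ i * (fg p * v)"
      using power_commuting_commutes[of "yg 0" "fg p" i] uea_commutation(3)[of p 0]
      by (simp add: w_def flip: mult.assoc)
    thus ?thesis using f1[OF that] by (simp add: mult)
  qed
  have yy: "yg p * w i \<in> K" if "0 < p" for p i
  proof (induction i)
    case 0
    show ?case using y1[OF that] by (simp add: w_def)
  next
    case (Suc i)
    have "yg p * yg 0 = - (yg 0 * yg p) - 2 * fg p"
      using uea_commutation(1)[of p 0] by (simp add: algebra_simps eq_neg_iff_add_eq_0)
    hence "yg p * w (Suc i) = (- (yg 0 * yg p) - 2 * fg p) * w i"
      by (simp add: w_def mult.assoc flip: mult.assoc[of "yg p"])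
    also have "\<dots> = - (yg 0 * (yg p * w i)) - 2 * (fg p * w i)"
      by (simp add: left_diff_distrib mult.assoc)
    finally show ?case using Suc ff[OF that] by (simp add: diff uminus mult)
  qed
  \<comment> \<open>The weight \<open>n - i\<close> becomes negative for \<open>i > n\<close>, so
    the subtraction takes place in the complex numbers.\<close>
  have hh: "hg p * w i - (if p = 0 then uscalar (of_nat n - of_nat i) * w i else 0) \<in> K" for p i
  proof (induction i)
    case 0
    show ?case using hw_modD(2,3)[OF hw] by (simp add: w_def uscalar_of_nat)
  next
    case (Suc i)
    have "hg p * w (Suc i) = yg 0 * (hg p * w i) - yg p * w i"
      using uea_commutation(5)[of p 0] by (simp add: w_def left_diff_distrib flip: mult.assoc)
    moreover have "yg 0 * (hg p * w i) - yg p * w i - (if p = 0 then uscalar (of_nat n - of_nat (Suc i)) * w (Suc i) else 0)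
        = yg 0 * (hg p * w i - (if p = 0 then uscalar (of_nat n - of_nat i) * w i else 0)) - (if p = 0 then 0 else yg p * w i)"
    proof (cases "p = 0")
      case True
      have "uscalar (of_nat n - of_nat (Suc i)) = uscalar (of_nat n - of_nat i) + uscalar (- 1)"
        by (simp add: algebra_simps flip: uscalar_add)
      thus ?thesis using True
        by (simp add: w_def right_diff_distrib left_diff_distrib distrib_right uscalar_left_commute uscalar_uminus mult.assoc)
    qed simp
    moreover have "\<dots> \<in> K"
      by (rule diff, rule mult[OF Suc]) (simp add: zero yy)
    ultimately show ?case by simp
  qed
  define S where "S = uvs.span (w ` {..2 * n} \<union> K)"
  have KS: "k \<in> K \<Longrightarrow> k \<in> S" for k
    by (simp add: S_def uvs.span_base)
  \<comment> \<open>The square of \<open>yg 0\<close> is \<open>- fg 0\<close>, so up to sign this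
    is \<open>yg 0 * (fg 0 ^ n * v)\<close>. That vector comes out of the relation
    \<open>fg 0 ^ Suc n * v \<in> K\<close> under \<open>xg 0\<close>.\<close>
  have "w (2 * n + 1) \<in> K"
  proof -
    have sq: "yg 0 ^ 2 = - fg 0"
    proof -
      have "2 * (yg 0 ^ 2 + fg 0) = 0"
        using uea_commutation(1)[of 0 0] by (simp add: power2_eq_square distrib_left mult_2)
      hence "uscalar (1 / 2) * (uscalar 2 * (yg 0 ^ 2 + fg 0)) = 0"
        by (simp add: uscalar_numeral)
      hence "yg 0 ^ 2 + fg 0 = 0"
        by (simp add: uscalar_mult[symmetric] flip: mult.assoc)
      thus ?thesis by (simp add: eq_neg_iff_add_eq_0)
    qed
    have "xg 0 * (fg 0 ^ Suc n * v) = fg 0 ^ Suc n * (xg 0 * v) + of_nat (Suc n) * (yg 0 * (fg 0 ^ n * v))"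
      using arg_cong[OF xg_power[of 0 0 n], of "\<lambda>u. u * v"] by (simp only: distrib_right mult.assoc add_0)
    hence "of_nat (Suc n) * (yg 0 * (fg 0 ^ n * v)) \<in> K"
      using diff[OF mult[OF fn, of "xg 0"] mult[OF hw_modD(1)[OF hw, of 0], of "fg 0 ^ Suc n"]]
      by (metis add_diff_cancel_left')
    hence *: "yg 0 * (fg 0 ^ n * v) \<in> K" by (rule of_nat_cancel) simp
    have "w (2 * n + 1) = yg 0 * ((- fg 0) ^ n * v)"
      by (simp add: w_def power_mult sq mult.assoc)
    also have "\<dots> = (- 1) ^ n * (yg 0 * (fg 0 ^ n * v))"
      unfolding power_minus[of "fg 0" n] by (cases "even n") (simp_all)
    finally show ?thesis using * by (simp add: mult)
  qed
  hence top: "w i \<in> S" if "i \<le> 2 * n + 1" for i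
    using that KS by (cases "i = 2 * n + 1") (auto simp: S_def intro: uvs.span_base)
  have closed: "g * a \<in> S" if "a \<in> S" "\<And>i. i \<le> 2 * n \<Longrightarrow> g * w i \<in> S" for g a
    using that(1) unfolding S_def
  proof (induction rule: uvs.span_induct)
    case base
    show ?case unfolding uvs.subspace_def
      by (auto simp: distrib_left uscalar_left_commute uvs.span_zero intro: uvs.span_add uvs.span_scale)
  next
    case (step b)
    thus ?case using that(2) KS mult unfolding S_def by auto
  qed
  have yS: "yg r * w i \<in> S" if "i \<le> 2 * n" for r i
    using that yy[of r i] KS top[of "Suc i"] by (cases "r = 0") (auto simp: w_def mult.assoc)
  have hS: "hg r * w i \<in> S" if "i \<le> 2 * n" for r i
  proof -
    let ?c = "if r = 0 then uscalar (of_nat n - of_nat i) * w i else 0"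
    have "(hg r * w i - ?c) + ?c \<in> S"
      using that KS[OF hh[of r i]] top[of i] unfolding S_def
      by (intro uvs.span_add) (auto intro: uvs.span_scale uvs.span_zero)
    thus ?thesis by simp
  qed
  have xS: "xg r * w i \<in> S" if "i \<le> 2 * n" for r i
    using that
  proof (induction i)
    case 0
    thus ?case using KS hw_modD(1)[OF hw] by (simp add: w_def)
  next
    case (Suc i)
    have "xg r * w (Suc i) = hg r * w i - yg 0 * (xg r * w i)"
      using uea_commutation(6)[of r 0] by (simp add: w_def left_diff_distrib flip: mult.assoc)
    moreover have "yg 0 * (xg r * w i) \<in> S"
      using Suc by (intro closed[OF Suc.IH] yS) auto
    ultimately show ?case
      using hS[of i r] Suc.prems unfolding S_def by (auto intro: uvs.span_diff)
  qed
  have "u * v \<in> S" for u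
  proof (rule orbit_in_subspace)
    show "uvs.subspace S" by (simp add: S_def)
    show "v \<in> S" using top[of 0] by (simp add: w_def)
  qed (erule closed, erule xS yS)+
  moreover have "card (w ` {..2 * n}) \<le> 2 * n + 1"
    using card_image_le[of "{..2 * n}" w] by simp
  ultimately show ?thesis
    unfolding orbit_dim_le_def S_def by (intro exI[of _ "w ` {..2 * n}"]) auto
qed

end

section \<open>Induction on the partition\<close>

definition osp_dim :: "nat list \<Rightarrow> nat" where
  "osp_dim xs = (\<Prod>x\<leftarrow>xs. 2 * x + 1)"

lemma osp_dim_simps [simp]: "osp_dim [] = 1" "osp_dim (x # xs) = (2 * x + 1) * osp_dim xs"
  by (simp_all add: osp_dim_def)

lemma osp_dim_mset: "mset xs = mset ys \<Longrightarrow> osp_dim xs = osp_dim ys"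
  unfolding osp_dim_def by (metis mset_map prod_mset_prod_list)

text \<open>Stated for all \<open>K\<close> and \<open>v\<close>, because the induction replaces the
  ideal by larger ones and the vector by others in its orbit.\<close>

definition bounded_profile :: "nat list \<Rightarrow> bool" where
  "bounded_profile xs \<longleftrightarrow> (\<forall>K v. uea_left_ideal K \<longrightarrow> hw_mod K (sum_list xs) v \<longrightarrow>
     frels K (min_sum xs) v \<longrightarrow> orbit_dim_le K v (osp_dim xs))"

lemma bounded_profile_mset:
  assumes "mset xs = mset ys" "bounded_profile xs"
  shows "bounded_profile ys"
proof -
  have "min_sum xs = min_sum ys" "osp_dim xs = osp_dim ys" "sum_list xs = sum_list ys"
    using min_sum_mset[OF assms(1)] osp_dim_mset[OF assms(1)] arg_cong[OF assms(1), of sum_mset]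
    by (simp_all add: fun_eq_iff sum_mset_sum_list)
  thus ?thesis using assms(2) by (simp add: bounded_profile_def)
qed

text \<open>With \<open>L + 1\<close> parts, of which \<open>b \<le> a\<close> are the smallest, put \<open>u\<^sub>0 = f\<^sub>L\<^sup>b v\<close> and
  \<open>u\<^sub>1 = y\<^sub>L f\<^sub>L\<^bsup>b-1\<^esup> v\<close>, where \<open>f\<^sub>L\<close>, \<open>y\<^sub>L\<close> lower by \<open>\<alpha>\<close>, \<open>\<delta>\<^sub>1\<close> in \<open>t\<close>-degree \<open>L\<close>. Modulo \<open>u\<^sub>0\<close>
  the parts \<open>a, b\<close> may be replaced by \<open>a + 1, b - 1\<close>; modulo \<open>u\<^sub>1\<close> the vector \<open>u\<^sub>0\<close> has
  \<open>a - b\<close> in place of \<open>a, b\<close>; and \<open>u\<^sub>1\<close> has \<open>a - b + 1\<close>. The dimensions add up, because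
  \<open>(2a+1)(2b+1) = (2a+3)(2b-1) + (2(a-b)+1) + (2(a-b)+3)\<close>.\<close>

lemma bounded_profile_step:
  assumes ord: "Suc b' \<le> a" "\<And>x. x \<in> set rho \<Longrightarrow> a \<le> x"
    and P2: "bounded_profile (b' # Suc a # rho)"
    and P0: "bounded_profile ((a - Suc b') # rho)"
    and P1: "bounded_profile (Suc (a - Suc b') # rho)"
  shows "bounded_profile (Suc b' # a # rho)"
  unfolding bounded_profile_def
proof (intro allI impI)
  fix K v
  assume K: "uea_left_ideal K" and hw: "hw_mod K (sum_list (Suc b' # a # rho)) v"
    and f: "frels K (min_sum (Suc b' # a # rho)) v"
  interpret uea_left_ideal K by (rule K)
  define b where "b = Suc b'"
  define L where "L = Suc (length rho)"
  define w where "w = (\<lambda>i. fg L ^ i * v)"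
  \<comment> \<open>All parts are positive, so at \<open>r = 1\<close> the profile counts them. Its
    value \<open>L + 1\<close> says that \<open>fg p\<close> kills \<open>v\<close> for
    \<open>p > L\<close>.\<close>
  have min1: "min_sum (Suc b' # a # rho) 1 = Suc L"
    using ord by (subst min_sum_all_ge) (fastforce simp: L_def)+
  have f1: "fg p * v \<in> K" if "L < p" for p
    by (rule fg_kills[OF f _ that]) (simp only: min1)
  have fw: "fg p * w i \<in> K" if "L < p" for p i
    using mult[OF f1[OF that], of "fg L ^ i"] fg_power_commute[of p L i]
    by (simp add: w_def flip: mult.assoc)
  have y1: "yg p * v \<in> K" if "L < p" for p
  proof -
    have "yg p * v = xg 0 * (fg p * v) - fg p * (xg 0 * v)"
      using uea_commutation(7)[of 0 p] by (simp add: distrib_right flip: mult.assoc)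
    thus ?thesis using mult[OF f1[OF that]] mult hw_modD(1)[OF hw] by (auto intro: diff)
  qed
  have yw: "yg p * w i \<in> K" if "L < p" for p i
    using mult[OF y1[OF that], of "fg L ^ i"] yg_power_commute[of p L i]
    by (simp add: w_def flip: mult.assoc)
  have wSuc: "w (Suc i) = fg L * w i" for i by (simp add: w_def mult.assoc)
  define D where "D = (\<lambda>i. min_sum ((b - i) # (a - i) # rho))"
  \<comment> \<open>The odd relations are followed with \<open>a + 1\<close> in place of
    \<open>a\<close>: \<open>yrels_fg\<close> allows \<open>D i\<close> to exceed the new
    \<open>E\<close> by 1 only. The parts \<open>b - i, a - i\<close> of \<open>D i\<close> satisfy
    this against the parts \<open>b - i - 1, a - i\<close> of \<open>E (Suc i)\<close>.\<close>
  define E where "E = (\<lambda>i. min_sum ((b - i) # (Suc a - i) # rho))"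
  have rels: "frels K (D i) (w i) \<and> yrels K (E i) (w i)" if "i \<le> b" for i
    using that
  proof (induction i)
    case 0
    have D0: "D 0 = min_sum (Suc b' # a # rho)"
      by (simp only: D_def b_def diff_zero)
    have "yrels K (D 0) v"
      using yrels_of_frels[OF hw f] by (simp only: D0)
    hence "yrels K (E 0) v"
      unfolding yrels_def D_def E_def by (auto simp: min_def split: if_splits)
    thus ?case using f by (simp only: D0 w_def power_0 mult_1 simp_thms)
  next
    case (Suc i)
    have i: "i < b" "i < a" using Suc.prems ord by (auto simp: b_def)
    have "D i r \<le> D (Suc i) r + 2" "E i r \<le> E (Suc i) r + 2" "D i r \<le> E (Suc i) r + 1"
      "D i (Suc r) \<le> D (Suc i) r + L + 1" "E i (Suc r) \<le> E (Suc i) r + L + 1" for r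
    proof -
      have m1: "min r (x - i) \<le> min r (x - Suc i) + 1" for x
        by (rule min_diff_le)
      have m2: "min (Suc r) (x - i) = min r (x - Suc i) + 1" if "i < x" for x
        using that by (rule min_Suc_diff)
      have add: "x + (y + m) \<le> x' + (y' + m) + 2" if "x \<le> x' + 1" "y \<le> y' + 1" for x y x' y' m :: nat
        using that by simp
      have SL: "x + 1 + (y + 1 + min_sum rho (Suc r)) \<le> x + (y + min_sum rho r) + Suc (length rho) + 1" for x y
        using min_sum_Suc[of rho r] by simp
      show "D i r \<le> D (Suc i) r + 2" "E i r \<le> E (Suc i) r + 2"
        unfolding D_def E_def min_sum_simps by (rule add[OF m1 m1])+
      show "D i r \<le> E (Suc i) r + 1"
        unfolding D_def E_def min_sum_simps diff_Suc_Suc using m1[of b] by (simp only: add_ac add_le_cancel_left)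
      show "D i (Suc r) \<le> D (Suc i) r + L + 1" "E i (Suc r) \<le> E (Suc i) r + L + 1"
        unfolding D_def E_def min_sum_simps m2[OF i(1)] m2[OF i(2)] m2[OF less_SucI[OF i(2)]] L_def
        by (rule SL)+
    qed
    moreover have "0 < L" by (simp add: L_def)
    moreover have "frels K (D i) (w i)" "yrels K (E i) (w i)"
      using Suc by simp_all
    ultimately show ?case
      unfolding wSuc by (intro conjI frels_fg[OF _ fw] yrels_fg[OF _ fw yw])
  qed
  have wb: "w b = fg L * w b'" by (simp add: b_def wSuc)
  have hgw: "hg r * w (Suc i) = fg L ^ Suc i * (hg r * v) - of_nat (2 * Suc i) * (fg (r + L) * w i)" for r i
    using arg_cong[OF hg_power[of r L i], of "\<lambda>u. u * v"]
    by (simp only: w_def mult.assoc left_diff_distrib)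
  have xgw: "xg r * w (Suc i) = fg L ^ Suc i * (xg r * v) + of_nat (Suc i) * (yg (r + L) * w i)" for r i
    using arg_cong[OF xg_power[of r L i], of "\<lambda>u. u * v"]
    by (simp only: w_def mult.assoc distrib_right)
  define n where "n = sum_list (Suc b' # a # rho)"
  have hpos: "hg r * w i \<in> K" if "0 < r" for r i
  proof (cases i)
    case 0
    thus ?thesis using hw_modD(3)[OF hw that] by (simp add: w_def)
  next
    case (Suc i')
    have "fg (r + L) * w i' \<in> K" using that by (intro fw) simp
    thus ?thesis unfolding Suc hgw by (intro diff[OF mult[OF hw_modD(3)[OF hw that]] mult])
  qed
  have h0: "hg 0 * w i - uscalar (of_nat n - of_nat (2 * i)) * w i \<in> K" for i
  proof (cases i)
    case 0
    show ?thesis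
      using hw_modD(2)[OF hw] unfolding n_def[symmetric] 0
      by (simp only: w_def power_0 mult_1 mult_0_right of_nat_0 diff_zero uscalar_of_nat)
  next
    case (Suc i')
    have "uscalar (of_nat n - of_nat (2 * i)) * w i = of_nat n * w i - of_nat (2 * i) * w i"
      using uscalar_add[of "of_nat n" "- of_nat (2 * i)"]
      by (simp only: diff_conv_add_uminus uscalar_uminus uscalar_of_nat distrib_right mult_minus_left)
    moreover have "of_nat (2 * i) * w i = of_nat (2 * i) * (fg (0 + L) * w i')"
      unfolding Suc wSuc by simp
    moreover have "of_nat n * w i = fg L ^ i * (of_nat n * v)"
      by (simp only: w_def mult_of_nat_swap)
    ultimately have "hg 0 * w i - uscalar (of_nat n - of_nat (2 * i)) * w i
        = fg L ^ i * (hg 0 * v - of_nat n * v)"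
      unfolding Suc hgw by (simp only: right_diff_distrib) simp
    thus ?thesis using hw_modD(2)[OF hw] by (simp only: n_def mult)
  qed
  have nb: "n = a + b + sum_list rho" by (simp add: n_def b_def)
  define u0 where "u0 = w b"
  define u1 where "u1 = yg L * w b'"
  define K1 where "K1 = ideal_plus K u1"
  define K2 where "K2 = ideal_plus K1 u0"
  interpret K1: uea_left_ideal K1 unfolding K1_def by (rule ideal_plus)
  have KK1: "k \<in> K \<Longrightarrow> k \<in> K1" for k using ideal_plus_superset by (auto simp: K1_def)
  have KK2: "k \<in> K1 \<Longrightarrow> k \<in> K2" for k using K1.ideal_plus_superset by (auto simp: K2_def)
  have "orbit_dim_le K u1 (osp_dim (Suc (a - b) # rho))"
  proof -
    have yy: "yg L * (yg (r + L) * w i) \<in> K" for r i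
    proof (cases "r = 0")
      case True
      have "2 * (yg L * (yg L * w i)) = - (2 * (fg (L + L) * w i))"
        using arg_cong[OF uea_commutation(1)[of L L], of "\<lambda>u. u * w i"]
        by (simp add: distrib_right left_diff_distrib mult_2 mult.assoc)
      moreover have "fg (L + L) * w i \<in> K" by (rule fw) (simp add: L_def)
      ultimately have "of_nat 2 * (yg L * (yg L * w i)) \<in> K"
        by (simp add: uminus mult)
      hence "yg L * (yg L * w i) \<in> K" by (rule of_nat_cancel) simp
      thus ?thesis using True by simp
    next
      case False
      thus ?thesis by (intro mult[OF yw]) simp
    qed
    \<comment> \<open>Passing \<open>yg L\<close> leaves \<open>hg (r + L)\<close>, which kills
      \<open>w b'\<close> since \<open>L > 0\<close>. Passing the powers of \<open>fg L\<close>
      leaves a second odd factor, and the product of two such factors kills by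
      \<open>yy\<close>.\<close>
    have "xg r * u1 \<in> K" for r
    proof -
      have "xg r * u1 = hg (r + L) * w b' - yg L * (xg r * w b')"
        using uea_commutation(6)[of r L] by (simp add: u1_def left_diff_distrib flip: mult.assoc)
      moreover have "yg L * (xg r * w b') \<in> K"
      proof (cases b')
        case 0
        thus ?thesis using hw_modD(1)[OF hw] by (simp add: w_def mult)
      next
        case (Suc i)
        have "yg L * (xg r * w b') = yg L * (fg L ^ Suc i * (xg r * v))
            + of_nat (Suc i) * (yg L * (yg (r + L) * w i))"
          unfolding Suc xgw by (simp only: distrib_left mult_of_nat_swap)
        thus ?thesis using hw_modD(1)[OF hw] yy by (simp only: add mult)
      qed
      ultimately show ?thesis using hpos[of "r + L"] by (simp add: L_def diff)
    qed
    moreover have hu1: "hg r * u1 = yg L * (hg r * w b') - yg (r + L) * w b'" for r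
      using uea_commutation(5)[of r L] by (simp add: u1_def left_diff_distrib flip: mult.assoc)
    have "hg r * u1 \<in> K" if "0 < r" for r
      unfolding hu1 using that by (intro diff[OF mult[OF hpos[OF that]] yw]) simp
    moreover have "hg 0 * u1 - of_nat (sum_list (Suc (a - b) # rho)) * u1 \<in> K"
    proof -
      have "of_nat (sum_list (Suc (a - b) # rho)) = (of_nat n - of_nat (2 * b') - 1 :: complex)"
        using ord by (simp add: nb b_def of_nat_diff)
      moreover have e: "uscalar (c - 1) = uscalar c - 1" for c
        using uscalar_add[of c "- 1"] by (simp add: uscalar_uminus)
      ultimately have "uscalar (of_nat (sum_list (Suc (a - b) # rho))) = uscalar (of_nat n - of_nat (2 * b')) - 1"
        by (simp only: e)
      hence "of_nat (sum_list (Suc (a - b) # rho)) = uscalar (of_nat n - of_nat (2 * b')) - 1"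
        by (simp only: uscalar_of_nat)
      hence "hg 0 * u1 - of_nat (sum_list (Suc (a - b) # rho)) * u1
          = yg L * (hg 0 * w b' - uscalar (of_nat n - of_nat (2 * b')) * w b')"
        unfolding hu1 by (simp add: u1_def left_diff_distrib right_diff_distrib uscalar_left_commute mult.assoc)
      thus ?thesis using h0[of b'] by (simp only: mult)
    qed
    ultimately have "hw_mod K (sum_list (Suc (a - b) # rho)) u1"
      by (simp add: hw_mod_def)
    \<comment> \<open>At \<open>i = b - 1\<close> the parts \<open>b, a\<close> have become
      \<open>1, a - b + 1\<close> in \<open>D\<close> and \<open>1, a - b + 2\<close> in
      \<open>E\<close>. The last step, by \<open>yg L\<close>, removes the part 1.\<close>
    moreover have "frels K (min_sum (Suc (a - b) # rho)) u1"
      unfolding u1_def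
    proof (rule frels_yg)
      show "frels K (D b') (w b')" "yrels K (E b') (w b')"
        using rels[of b'] by (simp_all add: b_def)
      fix r
      show "D b' r \<le> min_sum (Suc (a - b) # rho) r + 1"
        "E b' (Suc r) \<le> min_sum (Suc (a - b) # rho) r + L + 1"
        using ord min_sum_Suc[of rho r] by (auto simp: D_def E_def b_def L_def)
    qed (rule yw)
    ultimately show ?thesis
      using P1 K by (auto simp: bounded_profile_def b_def)
  qed
  moreover have "orbit_dim_le K1 u0 (osp_dim ((a - b) # rho))"
  proof -
    \<comment> \<open>Modulo \<open>K\<close> the vector \<open>xg 0 * u0\<close> is
      \<open>b\<close> times \<open>u1\<close>. This is why \<open>u1\<close> has to be divided out
      before \<open>u0\<close>.\<close>
    have "xg r * u0 \<in> K1" for r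
    proof (cases "r = 0")
      case True
      have "of_nat (Suc b') * u1 \<in> K1"
        unfolding K1_def by (rule ideal_plus_generator)
      moreover have "fg L ^ Suc b' * (xg r * v) \<in> K1"
        by (rule KK1[OF mult[OF hw_modD(1)[OF hw]]])
      ultimately show ?thesis
        using True unfolding u0_def b_def xgw by (simp add: u1_def K1.add)
    next
      case False
      have "yg (r + L) * w b' \<in> K" using False by (intro yw) simp
      thus ?thesis
        unfolding u0_def b_def xgw
        by (intro KK1[OF add[OF mult[OF hw_modD(1)[OF hw]] mult]])
    qed
    moreover have "hg r * u0 \<in> K1" if "0 < r" for r
      using hpos[OF that] by (simp add: u0_def KK1)
    moreover have "hg 0 * u0 - of_nat (sum_list ((a - b) # rho)) * u0 \<in> K1"
    proof -
      have "of_nat (sum_list ((a - b) # rho)) = (of_nat n - of_nat (2 * b) :: complex)"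
        using ord by (simp add: nb b_def of_nat_diff)
      thus ?thesis using h0[of b] KK1 by (simp add: u0_def flip: uscalar_of_nat)
    qed
    ultimately have "hw_mod K1 (sum_list ((a - b) # rho)) u0"
      by (simp add: hw_mod_def)
    moreover have "frels K1 (min_sum ((a - b) # rho)) u0"
      using rels[of b] KK1 by (auto simp: frels_def u0_def D_def)
    ultimately show ?thesis
      using P0 K1.uea_left_ideal_axioms by (auto simp: bounded_profile_def b_def)
  qed
  moreover have "orbit_dim_le K2 v (osp_dim (b' # Suc a # rho))"
  proof -
    have "frels K2 (min_sum (b' # Suc a # rho)) v"
      unfolding frels_def
    proof (intro allI impI)
      fix r s assume rs: "min_sum (b' # Suc a # rho) r < r + s"
      show "fpow r s * v \<in> K2"
      proof (cases "min_sum (Suc b' # a # rho) r < r + s")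
        case True
        thus ?thesis using f KK1 KK2 by (auto simp: frels_def)
      next
        \<comment> \<open>The two profiles differ only for \<open>b \<le> r \<le> a\<close>, and
          there by 1. In this range all parts in \<open>rho\<close> are at least \<open>r\<close>,
          so the new relation has \<open>L * r + b \<le> r + s\<close>, and
          \<open>fpow_concentrated\<close> puts it into the ideal generated by
          \<open>u0\<close>.\<close>
        case False
        have r: "b \<le> r" "r \<le> a"
          using False rs ord by (auto simp: b_def min_def split: if_splits)
        hence "min_sum rho r = r * length rho"
          using ord by (intro min_sum_all_ge) (meson le_trans)
        hence "L * r + b \<le> r + s"
          using rs r by (simp add: L_def b_def algebra_simps min_def split: if_splits)
        hence "fpow r s * v \<in> ideal_plus K (fg L ^ b * v)"
          using f1 by (intro fpow_concentrated) (simp_all add: L_def)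
        also have "\<dots> \<subseteq> K2"
          using KK1 by (auto simp: ideal_plus_def K2_def u0_def w_def)
        finally show ?thesis .
      qed
    qed
    moreover have "hw_mod K2 (sum_list (b' # Suc a # rho)) v"
      using hw KK1 KK2 by (auto simp: hw_mod_def)
    moreover have "uea_left_ideal K2" unfolding K2_def by (rule K1.ideal_plus)
    ultimately show ?thesis using P2 by (auto simp: bounded_profile_def)
  qed
  ultimately have "orbit_dim_le K v (osp_dim (b' # Suc a # rho) + osp_dim ((a - b) # rho)
      + osp_dim (Suc (a - b) # rho))"
    unfolding K1_def K2_def by (intro orbit_dim_le_extend)
  moreover have "osp_dim (b' # Suc a # rho) + osp_dim ((a - b) # rho) + osp_dim (Suc (a - b) # rho)
      = osp_dim (Suc b' # a # rho)"
  proof -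
    obtain c where "a = b + c" using ord(1) by (metis le_Suc_ex b_def)
    thus ?thesis by (simp add: b_def algebra_simps)
  qed
  ultimately show "orbit_dim_le K v (osp_dim (Suc b' # a # rho))" by (simp only:)
qed

lemma bounded_profile_drop_zero: "bounded_profile xs \<Longrightarrow> bounded_profile (0 # xs)"
proof -
  have "min_sum (0 # xs) = min_sum xs" by (simp add: fun_eq_iff)
  thus "bounded_profile xs \<Longrightarrow> bounded_profile (0 # xs)"
    by (simp only: bounded_profile_def sum_list.Cons add_0 osp_dim_simps) simp
qed

lemma bounded_profile_single: "bounded_profile [n]"
  using uea_left_ideal.orbit_dim_le_single by (simp add: bounded_profile_def del: min_sum_simps)

theorem bounded_profile: "bounded_profile xs"
proof (induction "length xs" arbitrary: xs rule: less_induct)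
  case (less xs)
  have two: "bounded_profile (b # a # rho)"
    if "length (b # a # rho) = length xs" "b \<le> a" "\<And>x. x \<in> set rho \<Longrightarrow> a \<le> x" for a b rho
    using that
  proof (induction b arbitrary: a rho)
    case 0
    thus ?case by (intro bounded_profile_drop_zero less) simp
  next
    case (Suc b)
    have P2: "bounded_profile (b # Suc a # rho)"
    proof -
      \<comment> \<open>Enlarging \<open>a\<close> can spoil the order, so the remaining parts are
        sorted again. The new second part is still at least \<open>b\<close>, as the inner
        hypothesis requires.\<close>
      obtain a' rho' where s: "sort (Suc a # rho) = a' # rho'"
        by (metis length_sort length_Suc_conv)
      have set: "set (a' # rho') = set (Suc a # rho)" and len: "length (a' # rho') = Suc (length rho)"
        unfolding s[symmetric] by (simp_all only: set_sort length_sort list.size)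
      have "sorted (a' # rho')" unfolding s[symmetric] by (rule sorted_sort)
      moreover have "a' \<in> set (Suc a # rho)" using set by (metis list.set_intros(1))
      hence "b \<le> a'" using Suc.prems(2,3) by force
      ultimately have "bounded_profile (b # a' # rho')"
        using Suc.prems(1) len by (intro Suc.IH) auto
      moreover have "mset (b # a' # rho') = mset (b # Suc a # rho)"
        by (metis mset.simps(2) mset_sort s)
      ultimately show ?thesis by (rule bounded_profile_mset[rotated])
    qed
    show ?case
      by (rule bounded_profile_step[OF _ _ P2 less less]) (use Suc.prems in auto)
  qed
  have "bounded_profile (sort xs)"
  proof (cases "sort xs")
    case Nil
    \<comment> \<open>The empty partition has the profile, size and dimension of the partition with
      the single part 0.\<close>
    have "min_sum [0] = min_sum []" by (simp add: fun_eq_iff)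
    thus ?thesis using bounded_profile_single[of 0] unfolding Nil
      by (simp add: bounded_profile_def del: min_sum_simps)
  next
    case (Cons b ys)
    show ?thesis
    proof (cases ys)
      case Nil
      thus ?thesis by (simp add: Cons bounded_profile_single)
    next
      case ys: (Cons a rho)
      have "sorted (b # a # rho)" "length (b # a # rho) = length xs"
        using Cons ys by (metis sorted_sort, metis length_sort)
      thus ?thesis unfolding Cons ys by (intro two) auto
    qed
  qed
  thus ?case by (rule bounded_profile_mset[rotated]) simp
qed

section \<open>The irreducible osp(1,2)-modules in coordinates\<close>

text \<open>\<open>raising m a\<close> is the coefficient in \<open>x\<^sub>\<delta>\<^sup>+ e\<^sub>a = raising m a * e\<^bsub>a-1\<^esub>\<close>, where
  \<open>e\<^sub>a = (x\<^sub>\<delta>\<^sup>-)\<^sup>a v\<close>. The coordinates of \<open>z w\<close> are \<open>b \<mapsto> weight m z b * (coordinate source z b of w)\<close>.\<close>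

primrec raising :: "nat \<Rightarrow> nat \<Rightarrow> complex" where
  "raising m 0 = 0"
| "raising m (Suc a) = of_nat m - of_nat a - raising m a"

fun source :: "osp \<Rightarrow> nat \<Rightarrow> nat" where
  "source Xap b = b + 2" | "source Xam b = b - 2" | "source Hal b = b"
| "source Xdp b = b + 1" | "source Xdm b = b - 1"

fun weight :: "nat \<Rightarrow> osp \<Rightarrow> nat \<Rightarrow> complex" where
  "weight m Xap b = raising m (b + 1) * raising m (b + 2)"
| "weight m Xam b = (if 2 \<le> b then -1 else 0)"
| "weight m Hal b = of_nat m - of_nat b"
| "weight m Xdp b = raising m (b + 1)"
| "weight m Xdm b = (if 1 \<le> b then 1 else 0)"

lemma raising_double: "raising m (2 * i) = - of_nat i" "raising m (2 * i + 1) = of_nat m - of_nat i"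
proof (induction i)
  case (Suc i)
  { case 1 show ?case using Suc by simp }
  { case 2 show ?case using Suc by simp }
qed simp_all

lemma raising_top: "raising m (2 * m + 1) = 0"
  using raising_double(2)[of m m] by simp

lemma raising_nonzero: "raising m (Suc a) \<noteq> 0" if "a \<noteq> 2 * m"
proof (cases "even a")
  case True
  then obtain i where "a = 2 * i" by (rule evenE)
  hence "raising m (Suc a) = of_nat m - of_nat i"
    using raising_double(2)[of m i] by (simp only: Suc_eq_plus1)
  thus ?thesis using that \<open>a = 2 * i\<close> by (simp del: raising.simps)
next
  case False
  then obtain i where "a = 2 * i + 1" by (rule oddE)
  hence "raising m (Suc a) = - of_nat (Suc i)"
    using raising_double(1)[of m "Suc i"] by (simp del: raising.simps of_nat_Suc)
  thus ?thesis by (simp only: neg_equal_0_iff_equal of_nat_eq_0_iff)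
qed

section \<open>The basis \<open>e 0, ..., e (2 * m)\<close> of the irreducible module\<close>

locale highest_weight_module =
  fixes M :: "(osp, 'm) supermodule" (structure) and m :: nat and v :: 'm
  assumes hw: "irreducible_highest_weight M m v"

sublocale highest_weight_module \<subseteq> lie_supermodule osp_odd osp_bracket M
  using hw by (simp add: irreducible_highest_weight_def)

context highest_weight_module
begin

lemma part_subset: "a \<in> part M p \<Longrightarrow> a \<in> carrier M"
  using part_submodule[of p] submoduleE(1) by blast

lemma act_closed [simp]: "a \<in> carrier M \<Longrightarrow> act M z a \<in> carrier M"
proof -
  assume "a \<in> carrier M"
  then obtain b c where bc: "b \<in> part M False" "c \<in> part M True" "a = b \<oplus> c"
    using parts_sum by blast
  thus ?thesis
    using act_add[of b c z] act_part[OF bc(1), of z] act_part[OF bc(2), of z]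
    by (auto dest!: part_subset)
qed

lemma v: "v \<in> carrier M" "v \<in> part M False" "v \<noteq> \<zero>" "act M Xdp v = \<zero>" "act M Hal v = of_nat m \<odot> v"
  using hw part_subset[of v False] by (auto simp: irreducible_highest_weight_def part_def)

lemma smult_closed' [simp]: "a \<in> carrier M \<Longrightarrow> c \<odot> a \<in> carrier M"
  by (rule smult_closed) simp_all

lemma smult_add_left: "a \<in> carrier M \<Longrightarrow> (c + d) \<odot> a = c \<odot> a \<oplus> d \<odot> a"
  using smult_l_distr[of c d a] by simp

lemma smult_add_right: "a \<in> carrier M \<Longrightarrow> b \<in> carrier M \<Longrightarrow> c \<odot> (a \<oplus> b) = c \<odot> a \<oplus> c \<odot> b"
  using smult_r_distr[of c a b] by simp

lemma smult_smult: "a \<in> carrier M \<Longrightarrow> c \<odot> (d \<odot> a) = (c * d) \<odot> a"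
  using smult_assoc1[of c d a] by simp

lemma smult_1 [simp]: "a \<in> carrier M \<Longrightarrow> 1 \<odot> a = a"
  using smult_one[of a] by simp

lemma smult_0 [simp]: "a \<in> carrier M \<Longrightarrow> 0 \<odot> a = \<zero>"
  using smult_l_null[of a] by simp

lemma smult_zero [simp]: "c \<odot> \<zero> = \<zero>"
  using smult_r_null[of c] by simp

lemma minus_smult: "a \<in> carrier M \<Longrightarrow> \<ominus> a = (- 1) \<odot> a"
  by (metis add.right_inverse minus_equality smult_0 smult_1 smult_add_left smult_closed' M.add.m_comm)

lemma diff_smult: "a \<in> carrier M \<Longrightarrow> b \<in> carrier M \<Longrightarrow> a \<ominus> b = a \<oplus> (- 1) \<odot> b"
  by (simp add: a_minus_def minus_smult)

lemma smult_eq_zero: "a \<in> carrier M \<Longrightarrow> c \<odot> a = \<zero> \<Longrightarrow> c = 0 \<or> a = \<zero>"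
  by (metis left_inverse smult_1 smult_smult smult_zero)

lemma act_zero [simp]: "act M z \<zero> = \<zero>"
  using act_smult[of \<zero> z 0] by simp

lemma act_bracket_single:
  assumes "osp_bracket z z' = Poly_Mapping.single w c" "a \<in> carrier M"
  shows "act M z (act M z' a) = ksign (osp_odd z) (osp_odd z') \<odot> act M z' (act M z a) \<oplus> c \<odot> act M w a"
proof -
  let ?s = "ksign (osp_odd z) (osp_odd z')"
  have "act M z (act M z' a) \<ominus> ?s \<odot> act M z' (act M z a) = c \<odot> act M w a"
    using act_bracket[OF assms(2), of z z'] assms by (cases "c = 0") (simp_all add: finsum_insert)
  hence "act M z (act M z' a) \<ominus> ?s \<odot> act M z' (act M z a) \<oplus> ?s \<odot> act M z' (act M z a)
      = ?s \<odot> act M z' (act M z a) \<oplus> c \<odot> act M w a"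
    using assms(2) by (simp add: M.add.m_comm)
  thus ?thesis using assms(2) by (simp add: a_minus_def M.add.m_assoc M.l_neg)
qed

lemma act_Xdp_Xdm: "a \<in> carrier M \<Longrightarrow>
    act M Xdp (act M Xdm a) = (- 1) \<odot> act M Xdm (act M Xdp a) \<oplus> act M Hal a"
  using act_bracket_single[of Xdp Xdm Hal 1 a] by (simp add: ksign_def)

lemma act_Hal_Xdm: "a \<in> carrier M \<Longrightarrow>
    act M Hal (act M Xdm a) = act M Xdm (act M Hal a) \<oplus> (- 1) \<odot> act M Xdm a"
  using act_bracket_single[of Hal Xdm Xdm "-1" a] by (simp add: ksign_def)

text \<open>The bracket of an odd element with itself is twice its square. The even root vectors
  therefore act as multiples of squares, and only the odd ones and \<open>Hal\<close> need separate
  computations.\<close>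

lemma act_square:
  assumes "osp_bracket z z = Poly_Mapping.single w (2 * c)" "osp_odd z" "a \<in> carrier M" "c \<noteq> 0"
  shows "act M w a = (1 / c) \<odot> act M z (act M z a)"
proof -
  let ?q = "act M z (act M z a)"
  have "?q = (- 1) \<odot> ?q \<oplus> (2 * c) \<odot> act M w a"
    using act_bracket_single[OF assms(1,3)] assms(2) by (simp add: ksign_def)
  hence "(1 / (2 * c)) \<odot> (?q \<oplus> ?q) = (1 / (2 * c)) \<odot> (?q \<oplus> ((- 1) \<odot> ?q \<oplus> (2 * c) \<odot> act M w a))"
    by simp
  moreover have "?q \<oplus> ?q = 2 \<odot> ?q"
    using smult_add_left[of ?q 1 1] assms(3) by simp
  moreover have "?q \<oplus> ((- 1) \<odot> ?q \<oplus> (2 * c) \<odot> act M w a) = (2 * c) \<odot> act M w a"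
    using assms(3) smult_add_left[of ?q 1 "- 1"] by (simp flip: M.add.m_assoc)
  ultimately show ?thesis using assms(3,4) by (simp add: smult_smult)
qed

lemma act_Xap: "a \<in> carrier M \<Longrightarrow> act M Xap a = act M Xdp (act M Xdp a)"
  using act_square[of Xdp Xap 1 a] by simp

lemma act_Xam: "a \<in> carrier M \<Longrightarrow> act M Xam a = (- 1) \<odot> act M Xdm (act M Xdm a)"
  using act_square[of Xdm Xam "-1" a] by simp

primrec e :: "nat \<Rightarrow> 'm" where
  "e 0 = v"
| "e (Suc a) = act M Xdm (e a)"

lemma e_closed [simp]: "e a \<in> carrier M"
  by (induction a) (simp_all add: v)

lemma e_part: "e a \<in> part M (odd a)"
proof (induction a)
  case (Suc a)
  show ?case using act_part[OF Suc, of Xdm] by simp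
qed (simp add: v)

lemma act_Hal_e: "act M Hal (e a) = (of_nat m - of_nat a) \<odot> e a"
proof (induction a)
  case (Suc a)
  thus ?case
    using act_Hal_Xdm[of "e a"]
    by (simp add: act_smult algebra_simps flip: smult_add_left[of "act M Xdm (e a)"])
qed (simp add: v)

lemma act_Xdp_e: "act M Xdp (e (Suc a)) = raising m (Suc a) \<odot> e a" "act M Xdp (e 0) = \<zero>"
proof (induction a)
  case 0
  { case 1 show ?case using act_Xdp_Xdm[of v] by (simp add: v) }
  { case 2 show ?case by (simp add: v) }
next
  case (Suc a)
  { case 1
    have "act M Xdp (e (Suc (Suc a))) = (- 1) \<odot> (raising m (Suc a) \<odot> e (Suc a)) \<oplus> (of_nat m - of_nat (Suc a)) \<odot> e (Suc a)"
      using act_Xdp_Xdm[of "e (Suc a)"] Suc(1) act_Hal_e[of "Suc a"]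
      by (simp del: raising.simps add: act_smult)
    also have "\<dots> = raising m (Suc (Suc a)) \<odot> e (Suc a)"
      by (simp only: smult_smult[OF e_closed] smult_add_left[OF e_closed, symmetric] raising.simps(2)[of m "Suc a"])
         simp
    finally show ?case . }
  { case 2 show ?case by (simp add: v) }
qed

text \<open>The sum of the \<open>c i \<odot> e (k + i)\<close> over \<open>i < n\<close>, by
  recursion so that linearity is proved by induction from the module laws alone.\<close>

primrec comb :: "nat \<Rightarrow> (nat \<Rightarrow> complex) \<Rightarrow> nat \<Rightarrow> 'm" where
  "comb k c 0 = \<zero>"
| "comb k c (Suc n) = comb k c n \<oplus> c n \<odot> e (k + n)"

lemma comb_closed [simp]: "comb k c n \<in> carrier M"
  by (induction n) simp_all

lemma comb_add: "comb k (\<lambda>i. c i + d i) n = comb k c n \<oplus> comb k d n"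
  by (induction n) (simp_all add: smult_add_left M.add.m_ac)

lemma comb_smult: "comb k (\<lambda>i. a * c i) n = a \<odot> comb k c n"
  by (induction n) (simp_all add: smult_add_right smult_smult)

lemma comb_cong: "(\<And>i. i < n \<Longrightarrow> c i = d i) \<Longrightarrow> comb k c n = comb k d n"
  by (induction n) auto

lemma comb_extend: "(\<And>i. n \<le> i \<Longrightarrow> c i \<odot> e (k + i) = \<zero>) \<Longrightarrow> comb k c (n + j) = comb k c n"
  by (induction j) simp_all

lemma comb_pad: "comb k (\<lambda>i. if i < n then c i else 0) (n + j) = comb k c n"
proof -
  have "comb k (\<lambda>i. if i < n then c i else 0) (n + j) = comb k (\<lambda>i. if i < n then c i else 0) n"
    by (rule comb_extend) simp
  also have "\<dots> = comb k c n" by (rule comb_cong) simp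
  finally show ?thesis .
qed

definition tail :: "nat \<Rightarrow> 'm set" where
  "tail k = {comb k c n | c n. True}"

lemma tail_closed:
  "\<zero> \<in> tail k" "a \<in> tail k \<Longrightarrow> a \<in> carrier M" "a \<in> tail k \<Longrightarrow> c \<odot> a \<in> tail k"
  "a \<in> tail k \<Longrightarrow> b \<in> tail k \<Longrightarrow> a \<oplus> b \<in> tail k" "c \<odot> e (k + i) \<in> tail k"
proof -
  show "\<zero> \<in> tail k"
    unfolding tail_def by (intro CollectI exI[of _ "\<lambda>_. 0"] exI[of _ 0]) simp
  show "a \<in> tail k \<Longrightarrow> a \<in> carrier M" by (auto simp: tail_def)
  show "a \<in> tail k \<Longrightarrow> c \<odot> a \<in> tail k"
    unfolding tail_def by clarify (metis comb_smult)
  show "a \<oplus> b \<in> tail k" if mem: "a \<in> tail k" "b \<in> tail k"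
  proof -
    obtain c n d l where ab: "a = comb k c n" "b = comb k d l"
      using mem by (auto simp: tail_def)
    have "a = comb k (\<lambda>i. if i < n then c i else 0) (n + l)"
      "b = comb k (\<lambda>i. if i < l then d i else 0) (n + l)"
      using comb_pad[of k n c l] comb_pad[of k l d n] by (simp_all add: ab add.commute)
    thus ?thesis unfolding tail_def by (auto simp flip: comb_add)
  qed
  have "comb k (\<lambda>j. if j = i then c else 0) i = \<zero>"
    using comb_cong[of i "\<lambda>j. if j = i then c else 0" "\<lambda>j. 0 * 0" k] comb_smult[of k 0 "\<lambda>_. 0" i] by simp
  hence "comb k (\<lambda>j. if j = i then c else 0) (Suc i) = c \<odot> e (k + i)"
    by simp
  thus "c \<odot> e (k + i) \<in> tail k"
    unfolding tail_def by (intro CollectI exI conjI TrueI) (rule sym)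
qed

text \<open>Only the raising operator could leave the span of \<open>e k, e (k + 1), ...\<close>,
  namely from \<open>e k\<close> to \<open>e (k - 1)\<close>, and the coefficient of that step is
  \<open>raising m k\<close>.\<close>

lemma tail_act:
  assumes "a \<in> tail k" "raising m k = 0"
  shows "act M z a \<in> tail k"
proof -
  have y: "act M Xdm a \<in> tail k" if "a \<in> tail k" for a
  proof -
    have "act M Xdm (comb k c n) \<in> tail k" for c n
    proof (induction n)
      case (Suc n)
      thus ?case using tail_closed(5)[of "c n" k "Suc n"]
        by (simp add: act_add act_smult tail_closed)
    qed (simp add: tail_closed)
    thus ?thesis using that by (auto simp: tail_def)
  qed
  have x: "act M Xdp a \<in> tail k" if "a \<in> tail k" for a
  proof -
    have 1: "act M Xdp (e (k + n)) \<in> tail k" for n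
    proof (cases n)
      case 0
      thus ?thesis using assms(2) act_Xdp_e by (cases k) (simp_all add: tail_closed del: e.simps)
    next
      case (Suc i)
      thus ?thesis using act_Xdp_e(1)[of "k + i"] tail_closed(5)
        by (simp del: e.simps raising.simps)
    qed
    have "act M Xdp (comb k c n) \<in> tail k" for c n
    proof (induction n)
      case (Suc n)
      thus ?case using 1 by (simp add: act_add act_smult tail_closed)
    qed (simp add: tail_closed)
    thus ?thesis using that by (auto simp: tail_def)
  qed
  have h: "act M Hal a \<in> tail k"
  proof -
    have "act M Hal (comb k c n) \<in> tail k" for c n
    proof (induction n)
      case (Suc n)
      thus ?case by (simp add: act_add act_smult act_Hal_e smult_smult tail_closed)
    qed (simp add: tail_closed)
    thus ?thesis using assms by (auto simp: tail_def)
  qed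
  note c = tail_closed(2)[OF assms(1)]
  show ?thesis
    using x[OF assms(1)] y[OF assms(1)] x[OF x[OF assms(1)]] y[OF y[OF assms(1)]] h c
    by (cases z) (simp_all add: act_Xap act_Xam tail_closed)
qed

lemma part_zero: "\<zero> \<in> part M p"
  using parts_disjoint by (cases p) auto

lemma comb_part:
  assumes "\<And>i. i < n \<Longrightarrow> c i \<noteq> 0 \<Longrightarrow> odd (k + i) = p"
  shows "comb k c n \<in> part M p"
  using assms
proof (induction n)
  case 0
  show ?case by (simp add: part_zero)
next
  case (Suc n)
  have "c n \<odot> e (k + n) \<in> part M p"
  proof (cases "c n = 0")
    case True
    thus ?thesis by (simp add: part_zero)
  next
    case False
    thus ?thesis using Suc.prems[of n] e_part[of "k + n"] submoduleE(4)[OF part_submodule[of p]] by auto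
  qed
  moreover have "comb k c n \<in> part M p" using Suc by simp
  ultimately show ?case
    using submoduleE(5)[OF part_submodule[of p]] by simp
qed

lemma comb_split:
  "comb k c n = comb k (\<lambda>i. if odd (k + i) then 0 else c i) n \<oplus> comb k (\<lambda>i. if odd (k + i) then c i else 0) n"
  unfolding comb_add[symmetric] by (rule comb_cong) simp

lemma tail_invariant:
  assumes "raising m k = 0"
  shows "graded_invariant M (tail k)"
  unfolding graded_invariant_def
proof (intro conjI allI ballI)
  show "submodule (tail k) complex_field M"
    by (rule submoduleI) (auto simp: tail_closed minus_smult intro: tail_closed(2))
  fix a assume a: "a \<in> tail k"
  thus "act M z a \<in> tail k" for z by (rule tail_act[OF _ assms])
  obtain c n where c: "a = comb k c n" using a by (auto simp: tail_def)
  show "\<exists>b\<in>tail k \<inter> part M False. \<exists>d\<in>tail k \<inter> part M True. a = b \<oplus> d"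
    using comb_split[of k c n] unfolding c
    by (intro bexI[of _ "comb k (\<lambda>i. if odd (k + i) then 0 else c i) n"]
        bexI[of _ "comb k (\<lambda>i. if odd (k + i) then c i else 0) n"] IntI comb_part)
      (auto simp: tail_def split: if_splits)
qed

lemma tail_cases: "raising m k = 0 \<Longrightarrow> tail k = {\<zero>} \<or> tail k = carrier M"
  using tail_invariant[of k] hw
  by (simp add: irreducible_highest_weight_def irreducible_supermodule_def)

lemma carrier_eq_tail: "carrier M = tail 0"
  using tail_cases[of 0] tail_closed(5)[of 1 0 0] v by auto

text \<open>By \<open>raising_top\<close> the tail from \<open>2 * m + 1\<close> is an invariant
  subspace, so it is zero or everything. It does not contain \<open>v\<close>, whose weight is
  larger than all weights in the tail.\<close>

lemma e_top: "e (2 * m + 1) = \<zero>"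
proof -
  let ?k = "2 * m + 1"
  have "r = 0" if "r \<odot> v = comb ?k c n" for r c n
    using that
  proof (induction n arbitrary: r c)
    case 0
    thus ?case using v smult_eq_zero[of v r] by auto
  next
    case (Suc n)
    let ?t = "of_nat m - of_nat (?k + n) :: complex"
    \<comment> \<open>\<open>Hal\<close> minus the weight of the last summand: this deletes that
      summand and multiplies \<open>v\<close> by the non-zero number \<open>?k + n\<close>.\<close>
    let ?T = "\<lambda>a. act M Hal a \<oplus> (- ?t) \<odot> a"
    have add: "?T (a \<oplus> b) = ?T a \<oplus> ?T b" if "a \<in> carrier M" "b \<in> carrier M" for a b
      using that by (simp add: act_add smult_add_right M.add.m_ac)
    have eT: "?T (s \<odot> e a) = (s * (of_nat m - of_nat a - ?t)) \<odot> e a" for s a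
      by (simp only: act_smult[OF e_closed] act_Hal_e smult_smult[OF e_closed]
          smult_add_left[OF e_closed, symmetric]) (simp add: algebra_simps)
    have combT: "?T (comb ?k d l) = comb ?k (\<lambda>i. d i * (of_nat m - of_nat (?k + i) - ?t)) l" for d l
    proof (induction l)
      case (Suc l)
      show ?case using Suc eT[of "d l" "?k + l"] add[of "comb ?k d l" "d l \<odot> e (?k + l)"] by simp
    qed simp
    have "?T (r \<odot> v) = ?T (comb ?k c (Suc n))"
      using Suc.prems by simp
    hence "(r * (of_nat m - of_nat 0 - ?t)) \<odot> v = comb ?k (\<lambda>i. c i * (of_nat m - of_nat (?k + i) - ?t)) (Suc n)"
      using eT[of r 0] combT[of c "Suc n"] by simp
    hence "(r * (of_nat m - of_nat 0 - ?t)) \<odot> v = comb ?k (\<lambda>i. c i * (of_nat m - of_nat (?k + i) - ?t)) n"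
      by simp
    from Suc.IH[OF this] have "r * (of_nat m - of_nat 0 - ?t) = 0" .
    moreover have "of_nat m - of_nat 0 - ?t = of_nat (?k + n)" by simp
    ultimately have "r * of_nat (?k + n) = 0" by (simp only:)
    hence "r = 0 \<or> ?k + n = 0" by (simp only: mult_eq_0_iff of_nat_eq_0_iff)
    thus ?case by simp
  qed
  hence "v \<notin> tail ?k"
    using v by (auto simp: tail_def) (metis one_neq_zero smult_1)
  hence "tail ?k = {\<zero>}"
    using tail_cases[OF raising_top] v by auto
  thus ?thesis using tail_closed(5)[of 1 ?k 0] by simp
qed

lemma e_above: "2 * m < a \<Longrightarrow> e a = \<zero>"
proof -
  have "e (2 * m + 1 + j) = \<zero>" for j
    by (induction j) (use e_top in simp_all)
  from this[of "a - (2 * m + 1)"] show "2 * m < a \<Longrightarrow> e a = \<zero>" by simp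
qed

text \<open>The n-th power of \<open>Xdp\<close> kills \<open>e 0, ..., e (n - 1)\<close> and takes
  \<open>e n\<close> to a non-zero multiple of \<open>v\<close>. So the top coefficient vanishes,
  and the others follow by induction.\<close>

lemma comb_independent:
  assumes "comb 0 c n = \<zero>" "n \<le> 2 * m + 1" "i < n"
  shows "c i = 0"
  using assms
proof (induction n arbitrary: i)
  case (Suc n)
  define T where "T = act M Xdp ^^ n"
  have lin: "(act M Xdp ^^ k) (a \<oplus> s \<odot> b) = (act M Xdp ^^ k) a \<oplus> s \<odot> (act M Xdp ^^ k) b
      \<and> (act M Xdp ^^ k) a \<in> carrier M"
    if "a \<in> carrier M" "b \<in> carrier M" for k a b s
    using that
  proof (induction k arbitrary: a b)
    case (Suc k)
    thus ?case using Suc.IH[of a b] Suc.IH[of b b] by (simp add: act_add act_smult)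
  qed simp
  have zero: "(act M Xdp ^^ k) \<zero> = \<zero>" for k by (induction k) simp_all
  have low: "(act M Xdp ^^ k) (e a) = \<zero>" if "a < k" for k a
    using that
  proof (induction k arbitrary: a)
    case (Suc k)
    thus ?case
      using act_Xdp_e lin[of "\<zero>" "e (a - 1)" k "raising m a"]
      by (cases a) (simp_all add: funpow_Suc_right zero del: funpow.simps e.simps)
  qed simp
  have top: "\<exists>s. s \<noteq> 0 \<and> (act M Xdp ^^ k) (e k) = s \<odot> v" if "k \<le> 2 * m" for k
    using that
  proof (induction k)
    case 0
    show ?case using v by (intro exI[of _ 1]) simp
  next
    case (Suc k)
    then obtain s where "s \<noteq> 0" "(act M Xdp ^^ k) (e k) = s \<odot> v" by auto
    moreover have "(act M Xdp ^^ Suc k) (e (Suc k)) = raising m (Suc k) \<odot> (act M Xdp ^^ k) (e k)"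
      using act_Xdp_e(1)[of k] lin[of "\<zero>" "e k" k "raising m (Suc k)"]
      by (simp add: funpow_Suc_right zero del: funpow.simps e.simps raising.simps)
        (use lin[of "e k" "e k" k] in simp)
    ultimately show ?case
      using raising_nonzero[of k m] Suc.prems v
      by (intro exI[of _ "raising m (Suc k) * s"]) (simp add: smult_smult)
  qed
  have "T (comb 0 c l) = \<zero>" if "l \<le> n" for l
    using that
  proof (induction l)
    case (Suc l)
    thus ?case using lin[of "comb 0 c l" "e l" n "c l"] low[of l n] by (simp add: T_def)
  qed (simp add: T_def zero)
  from this[of n] have "T (comb 0 c (Suc n)) = c n \<odot> T (e n)"
    using lin[of "comb 0 c n" "e n" n "c n"] lin[of "e n" "e n" n] by (simp add: T_def)
  moreover have "T (comb 0 c (Suc n)) = \<zero>"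
    unfolding Suc.prems(1) by (simp add: T_def zero)
  moreover obtain s where "s \<noteq> 0" "T (e n) = s \<odot> v"
    using top[of n] Suc.prems(2) by (auto simp: T_def)
  ultimately have "c n = 0"
    using smult_eq_zero[of v "c n * s"] v by (auto simp: smult_smult)
  thus ?case using Suc by (cases "i = n") auto
qed simp

subsection \<open>Coordinates\<close>

text \<open>The requirement to vanish above \<open>2 * m\<close> makes the chosen function unique,
  by \<open>comb_independent\<close>.\<close>

definition coords :: "'m \<Rightarrow> nat \<Rightarrow> complex" where
  "coords w = (SOME c. (\<forall>b>2 * m. c b = 0) \<and> w = comb 0 c (2 * m + 1))"

lemma coords:
  assumes "w \<in> carrier M"
  shows "comb 0 (coords w) (2 * m + 1) = w" "2 * m < b \<Longrightarrow> coords w b = 0"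
proof -
  obtain c n where c: "w = comb 0 c n"
    using assms by (auto simp: carrier_eq_tail tail_def)
  define d where "d = (\<lambda>i. if i < n \<and> i \<le> 2 * m then c i else 0)"
  have "comb 0 d (2 * m + 1) = comb 0 d (2 * m + 1 + n)"
    by (rule comb_extend[symmetric]) (simp add: d_def)
  also have "\<dots> = comb 0 d (n + (2 * m + 1))" by (simp add: add.commute)
  also have "\<dots> = comb 0 d n" by (rule comb_extend) (simp add: d_def)
  also have "\<dots> = comb 0 c n"
  proof -
    have "comb 0 d l = comb 0 c l" if "l \<le> n" for l
      using that by (induction l) (auto simp: d_def e_above not_le)
    thus ?thesis by simp
  qed
  finally have "\<exists>c. (\<forall>b>2 * m. c b = 0) \<and> w = comb 0 c (2 * m + 1)"
    unfolding c by (intro exI[of _ d]) (simp add: d_def)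
  from someI_ex[OF this]
  show "comb 0 (coords w) (2 * m + 1) = w" "2 * m < b \<Longrightarrow> coords w b = 0"
    by (simp_all add: coords_def)
qed

lemma coords_comb:
  assumes "b \<le> 2 * m"
  shows "coords (comb 0 c (2 * m + 1)) b = c b"
proof -
  let ?w = "comb 0 c (2 * m + 1)" and ?n = "2 * m + 1"
  have "comb 0 (\<lambda>i. c i + (- 1) * coords ?w i) ?n = ?w \<oplus> (- 1) \<odot> comb 0 (coords ?w) ?n"
    by (simp only: comb_add comb_smult)
  also have "\<dots> = \<zero>"
    unfolding coords(1)[OF comb_closed] using smult_add_left[of ?w 1 "- 1"] by (simp del: comb.simps)
  finally have "c b + (- 1) * coords ?w b = 0"
    by (rule comb_independent[of "\<lambda>i. c i + (- 1) * coords ?w i"]) (use assms in simp_all)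
  thus ?thesis by simp
qed

lemma coords_eqI: "w = comb 0 c (2 * m + 1) \<Longrightarrow> b \<le> 2 * m \<Longrightarrow> coords w b = c b"
  by (simp only: coords_comb)

lemma coords_add:
  assumes "u \<in> carrier M" "w \<in> carrier M"
  shows "coords (u \<oplus> w) b = coords u b + coords w b"
proof (cases "b \<le> 2 * m")
  case True
  thus ?thesis
    by (intro coords_eqI) (simp_all only: comb_add coords(1)[OF assms(1)] coords(1)[OF assms(2)])
qed (use assms in \<open>simp add: coords(2)\<close>)

lemma coords_smult:
  assumes "w \<in> carrier M"
  shows "coords (c \<odot> w) b = c * coords w b"
proof (cases "b \<le> 2 * m")
  case True
  thus ?thesis by (intro coords_eqI) (simp_all only: comb_smult coords(1)[OF assms])
qed (use assms in \<open>simp add: coords(2)\<close>)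

lemma coords_e: "a \<le> 2 * m \<Longrightarrow> b \<le> 2 * m \<Longrightarrow> coords (e a) b = (if b = a then 1 else 0)"
proof (rule coords_eqI)
  assume a: "a \<le> 2 * m"
  let ?d = "\<lambda>b. if b = a then 1 else 0 :: complex"
  have "comb 0 ?d a = comb 0 (\<lambda>_. 0 * 0) a" by (rule comb_cong) simp
  hence "comb 0 ?d a = \<zero>" by (simp only: comb_smult smult_0 comb_closed)
  hence "comb 0 ?d (Suc a) = e a" by simp
  moreover have "comb 0 ?d (Suc a + (2 * m - a)) = comb 0 ?d (Suc a)"
    by (rule comb_extend) simp
  ultimately show "e a = comb 0 ?d (2 * m + 1)" using a by simp
qed

lemma coords_act:
  assumes w: "w \<in> carrier M" and b: "b \<le> 2 * m"
  shows "coords (act M z w) b = weight m z b * coords w (source z b)"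
proof -
  let ?n = "2 * m + 1"
  have y: "coords (act M Xdm w) b = weight m Xdm b * coords w (b - 1)"
    if w: "w \<in> carrier M" and b: "b \<le> 2 * m" for w b
  proof -
    let ?c = "\<lambda>b. weight m Xdm b * coords w (b - 1)"
    have "act M Xdm (comb 0 (coords w) n) = comb 0 ?c (Suc n)" for n
      by (induction n) (simp_all add: act_add act_smult v(1))
    from this[of ?n] have "act M Xdm w = comb 0 ?c (Suc ?n)"
      unfolding coords(1)[OF w] .
    hence "act M Xdm w = comb 0 ?c ?n"
      using e_top by (simp del: e.simps)
    from coords_eqI[OF this b] show ?thesis .
  qed
  have x: "coords (act M Xdp w) b = weight m Xdp b * coords w (b + 1)"
    if w: "w \<in> carrier M" and b: "b \<le> 2 * m" for w b
  proof -
    let ?c = "\<lambda>b. raising m (b + 1) * coords w (b + 1)"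
    have "act M Xdp (comb 0 (coords w) (Suc n)) = comb 0 ?c n" for n
    proof (induction n)
      case 0
      show ?case using act_Xdp_e(2) v by (simp add: act_add act_smult)
    next
      case (Suc n)
      have "act M Xdp (comb 0 (coords w) (Suc (Suc n)))
          = act M Xdp (comb 0 (coords w) (Suc n)) \<oplus> coords w (Suc n) \<odot> act M Xdp (e (Suc n))"
        by (simp add: act_add act_smult del: e.simps)
      thus ?case using Suc act_Xdp_e(1)[of n]
        by (simp add: smult_smult mult.commute del: e.simps raising.simps)
    qed
    from this[of "2 * m"] have "act M Xdp w = comb 0 ?c (2 * m)"
      using coords(1)[OF w] by simp
    also have "\<dots> = comb 0 ?c ?n"
      using raising_top[of m] by (simp del: raising.simps)
    finally have "act M Xdp w = comb 0 ?c ?n" .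
    from coords_eqI[OF this b] show ?thesis by (simp only: weight.simps)
  qed
  have h: "coords (act M Hal w) b = weight m Hal b * coords w b"
  proof -
    have "act M Hal (comb 0 (coords w) n) = comb 0 (\<lambda>b. (of_nat m - of_nat b) * coords w b) n" for n
      by (induction n) (simp_all add: act_add act_smult act_Hal_e smult_smult mult.commute)
    from this[of ?n] have "act M Hal w = comb 0 (\<lambda>b. (of_nat m - of_nat b) * coords w b) ?n"
      unfolding coords(1)[OF w] .
    from coords_eqI[OF this b] show ?thesis by (simp only: weight.simps)
  qed
  show ?thesis
  proof (cases z)
    case Xap
    have "raising m (b + 1) * coords (act M Xdp w) (b + 1)
        = raising m (b + 1) * (raising m (b + 2) * coords w (b + 2))"
    proof (cases "b = 2 * m")
      case True
      thus ?thesis using raising_top[of m] by (simp del: raising.simps)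
    next
      case False
      thus ?thesis using x[OF w, of "b + 1"] b by (simp del: raising.simps)
    qed
    thus ?thesis using x[of "act M Xdp w" b] w b
      by (simp add: Xap act_Xap del: raising.simps)
  next
    case Xam
    show ?thesis
      using y[of "act M Xdm w" b] y[OF w, of "b - 1"] w b
      by (auto simp add: Xam act_Xam coords_smult numeral_2_eq_2)
  qed (use x[OF w b] y[OF w b] h in simp_all)
qed

lemma parity_involution:
  assumes "w \<in> carrier M"
  shows "parity_involution M w \<in> carrier M"
    and "b \<le> 2 * m \<Longrightarrow> coords (parity_involution M w) b = (- 1) ^ b * coords w b"
    and "w \<in> part M p \<Longrightarrow> parity_involution M w \<in> part M p"
proof -
  have unique: "a = a' \<and> b = b'"
    if "a \<in> part M False" "a' \<in> part M False" "b \<in> part M True" "b' \<in> part M True" "a \<oplus> b = a' \<oplus> b'"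
    for a a' b b'
  proof -
    note c = that(1-4)[THEN part_subset]
    have cancel: "u \<oplus> (- 1) \<odot> u = \<zero>" if "u \<in> carrier M" for u
      using that smult_add_left[of u 1 "- 1"] by simp
    have "a \<oplus> (- 1) \<odot> a' = (a \<oplus> (- 1) \<odot> a') \<oplus> (b \<oplus> (- 1) \<odot> b)"
      using c by (simp add: cancel)
    also have "\<dots> = (a \<oplus> b) \<oplus> ((- 1) \<odot> a' \<oplus> (- 1) \<odot> b)"
      using c by (simp add: M.add.m_ac)
    also have "\<dots> = (a' \<oplus> (- 1) \<odot> a') \<oplus> (b' \<oplus> (- 1) \<odot> b)"
      unfolding that(5) using c by (simp add: M.add.m_ac)
    also have "\<dots> = b' \<oplus> (- 1) \<odot> b"
      using c by (simp add: cancel)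
    finally have eq: "a \<oplus> (- 1) \<odot> a' = b' \<oplus> (- 1) \<odot> b" .
    have "a \<oplus> (- 1) \<odot> a' \<in> part M False" "b' \<oplus> (- 1) \<odot> b \<in> part M True"
      using that submoduleE(4,5)[OF part_submodule] by auto
    hence "a \<oplus> (- 1) \<odot> a' = \<zero>" "b' \<oplus> (- 1) \<odot> b = \<zero>"
      using eq parts_disjoint by auto
    moreover have "u = w" if "u \<oplus> (- 1) \<odot> w = \<zero>" "u \<in> carrier M" "w \<in> carrier M" for u w
    proof -
      have "u = u \<oplus> (w \<oplus> (- 1) \<odot> w)" using that by (simp add: cancel)
      also have "\<dots> = (u \<oplus> (- 1) \<odot> w) \<oplus> w" using that(2,3) by (simp add: M.add.m_ac)
      finally show ?thesis using that by simp
    qed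
    ultimately show ?thesis using c by metis
  qed
  have the: "parity_involution M (a \<oplus> b) = a \<ominus> b" if "a \<in> part M False" "b \<in> part M True" for a b
    unfolding parity_involution_def
  proof (rule the_equality)
    show "\<exists>a'\<in>part M False. \<exists>b'\<in>part M True. a \<oplus> b = a' \<oplus> b' \<and> a \<ominus> b = a' \<ominus> b'"
      using that by blast
    fix m' assume "\<exists>a'\<in>part M False. \<exists>b'\<in>part M True. a \<oplus> b = a' \<oplus> b' \<and> m' = a' \<ominus> b'"
    thus "m' = a \<ominus> b" using unique that by blast
  qed
  let ?c = "coords w" and ?n = "2 * m + 1"
  let ?a = "comb 0 (\<lambda>i. if odd (0 + i) then 0 else ?c i) ?n" and ?b = "comb 0 (\<lambda>i. if odd (0 + i) then ?c i else 0) ?n"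
  have ab: "?a \<in> part M False" "?b \<in> part M True"
    by (rule comb_part; simp split: if_splits)+
  have "w = ?a \<oplus> ?b"
    unfolding comb_split[symmetric] by (rule coords(1)[OF assms, symmetric])
  from trans[OF arg_cong[OF this, of "parity_involution M"] the[OF ab]]
  have "parity_involution M w = ?a \<ominus> ?b" .
  also have "\<dots> = comb 0 (\<lambda>i. (- 1) ^ i * ?c i) ?n"
    unfolding diff_smult[OF comb_closed comb_closed] comb_smult[symmetric] comb_add[symmetric]
    by (rule comb_cong) simp
  finally have w: "parity_involution M w = comb 0 (\<lambda>i. (- 1) ^ i * ?c i) ?n" .
  show "parity_involution M w \<in> carrier M" unfolding w by (rule comb_closed)
  show "b \<le> 2 * m \<Longrightarrow> coords (parity_involution M w) b = (- 1) ^ b * coords w b"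
    using coords_eqI[OF w] .
  show "parity_involution M w \<in> part M p" if "w \<in> part M p"
  proof (cases p)
    case True
    hence "parity_involution M w = \<zero> \<ominus> w"
      using the[OF part_zero, of w] that assms by simp
    also have "\<dots> = (- 1) \<odot> w" using assms by (simp add: diff_smult)
    finally show ?thesis using submoduleE(4)[OF part_submodule[of p]] that by auto
  next
    case False
    hence "parity_involution M w = w \<ominus> \<zero>"
      using the[OF _ part_zero, of w] that assms by simp
    thus ?thesis using assms that by (simp add: diff_smult)
  qed
qed

end

section \<open>Linear extensions and actions of the free algebra\<close>

text \<open>One form for all sums over keys that occur: module actions, the action on tuples,
  coordinates and homogeneous components.\<close>

definition lin_ext :: "('k \<Rightarrow> complex \<Rightarrow> 'b::comm_monoid_add) \<Rightarrow> ('k \<Rightarrow>\<^sub>0 complex) \<Rightarrow> 'b" where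
  "lin_ext G p = (\<Sum>k\<in>Poly_Mapping.keys p. G k (Poly_Mapping.lookup p k))"

lemma lin_ext_superset:
  assumes "\<And>k. G k 0 = 0" "finite A" "Poly_Mapping.keys p \<subseteq> A"
  shows "lin_ext G p = (\<Sum>k\<in>A. G k (Poly_Mapping.lookup p k))"
  unfolding lin_ext_def using assms by (intro sum.mono_neutral_left) (auto simp: in_keys_iff)

lemma lin_ext_add:
  assumes "\<And>k. G k 0 = 0" "\<And>k a b. G k (a + b) = G k a + G k b"
  shows "lin_ext G (p + q) = lin_ext G p + lin_ext G q"
proof -
  let ?A = "Poly_Mapping.keys p \<union> Poly_Mapping.keys q"
  have "lin_ext G r = (\<Sum>k\<in>?A. G k (Poly_Mapping.lookup r k))" if "Poly_Mapping.keys r \<subseteq> ?A" for r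
    using that by (intro lin_ext_superset assms(1)) auto
  thus ?thesis
    using Poly_Mapping.keys_add[of p q] by (simp add: assms(2) lookup_add sum.distrib)
qed

lemma lin_ext_single: "G k 0 = 0 \<Longrightarrow> lin_ext G (Poly_Mapping.single k c) = G k c"
  by (simp add: lin_ext_def)

lemma lin_ext_zero [simp]: "lin_ext G 0 = 0"
  by (simp add: lin_ext_def)

lemma keys_map_scale: "Poly_Mapping.keys (Poly_Mapping.map ((*) c) p) \<subseteq> Poly_Mapping.keys (p :: 'k \<Rightarrow>\<^sub>0 complex)"
  by (auto simp: in_keys_iff map.rep_eq when_def)

lemma lookup_map_scale: "Poly_Mapping.lookup (Poly_Mapping.map ((*) c) p) k = c * Poly_Mapping.lookup (p :: 'k \<Rightarrow>\<^sub>0 complex) k"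
  by (simp add: map.rep_eq when_def)

lemma lin_ext_map_scale:
  assumes "\<And>k. G k 0 = 0"
  shows "lin_ext G (Poly_Mapping.map ((*) c) p) = lin_ext (\<lambda>k a. G k (c * a)) p"
  using lin_ext_superset[of G "Poly_Mapping.keys p" "Poly_Mapping.map ((*) c) p"] keys_map_scale[of c p] assms
  by (simp add: lookup_map_scale lin_ext_def)

text \<open>Presents a record as the image of a concrete additive monoid, so that its finite sums
  and the action of the free algebra are computed upstairs. It serves the evaluation tensor product,
  its associated graded module and the presented modules.\<close>

locale module_image =
  fixes M :: "(gen, 'm) supermodule" and \<Phi> :: "'b :: comm_monoid_add \<Rightarrow> 'm" and C :: "'b set"
    and sc :: "complex \<Rightarrow> 'b \<Rightarrow> 'b" and op :: "gen \<Rightarrow> 'b \<Rightarrow> 'b"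
  assumes C: "0 \<in> C" "\<And>a b. a \<in> C \<Longrightarrow> b \<in> C \<Longrightarrow> a + b \<in> C"
      "\<And>c a. a \<in> C \<Longrightarrow> sc c a \<in> C" "\<And>g a. a \<in> C \<Longrightarrow> op g a \<in> C"
    and carrier: "carrier M = \<Phi> ` C" and zero: "\<Phi> 0 = \<zero>\<^bsub>M\<^esub>"
    and add: "\<And>a b. a \<in> C \<Longrightarrow> b \<in> C \<Longrightarrow> \<Phi> (a + b) = \<Phi> a \<oplus>\<^bsub>M\<^esub> \<Phi> b"
    and sc: "\<And>c a. a \<in> C \<Longrightarrow> \<Phi> (sc c a) = c \<odot>\<^bsub>M\<^esub> \<Phi> a"
    and op: "\<And>g a. a \<in> C \<Longrightarrow> \<Phi> (op g a) = act M g (\<Phi> a)"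
begin

lemma abelian_monoid: "abelian_monoid M"
  by (rule abelian_monoidI) (auto simp: carrier C zero[symmetric] add[symmetric] add_ac)

lemma finsum_image:
  assumes "finite I" "\<And>i. i \<in> I \<Longrightarrow> h i \<in> C"
  shows "(\<Oplus>\<^bsub>M\<^esub>i\<in>I. \<Phi> (h i)) = \<Phi> (\<Sum>i\<in>I. h i)"
proof -
  interpret abelian_monoid M by (rule abelian_monoid)
  have "(\<Oplus>\<^bsub>M\<^esub>i\<in>I. \<Phi> (h i)) = \<Phi> (\<Sum>i\<in>I. h i) \<and> (\<Sum>i\<in>I. h i) \<in> C"
    using assms
  proof (induction I)
    case (insert i I)
    have "(\<lambda>i. \<Phi> (h i)) \<in> I \<rightarrow> carrier M" using insert.prems carrier by auto
    moreover have "\<Phi> (h i) \<in> carrier M" using insert.prems carrier by auto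
    ultimately show ?case using insert C(2) by (simp add: finsum_insert add)
  qed (simp add: C zero)
  thus ?thesis by simp
qed

lemma foldr_image: "a \<in> C \<Longrightarrow> foldr op gs a \<in> C \<and> foldr (act M) gs (\<Phi> a) = \<Phi> (foldr op gs a)"
  by (induction gs) (auto simp: C op)

lemma lin_ext_closed: "a \<in> C \<Longrightarrow> lin_ext (\<lambda>w c. sc c (foldr op (letters w) a)) p \<in> C"
proof -
  assume a: "a \<in> C"
  have "finite W \<Longrightarrow> (\<Sum>w\<in>W. sc (Poly_Mapping.lookup p w) (foldr op (letters w) a)) \<in> C" for W
    by (induction W rule: finite_induct) (use foldr_image[OF a] C in auto)
  thus ?thesis by (simp add: lin_ext_def)
qed

lemma free_act_image:
  assumes a: "a \<in> C"
  shows "free_act M p (\<Phi> a) = \<Phi> (lin_ext (\<lambda>w c. sc c (foldr op (letters w) a)) p)"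
proof -
  interpret abelian_monoid M by (rule abelian_monoid)
  have "free_act M p (\<Phi> a) = (\<Oplus>\<^bsub>M\<^esub>w\<in>Poly_Mapping.keys p. \<Phi> (sc (Poly_Mapping.lookup p w) (foldr op (letters w) a)))"
    unfolding free_act_def
  proof (rule finsum_cong')
    show "(\<lambda>w. \<Phi> (sc (Poly_Mapping.lookup p w) (foldr op (letters w) a))) \<in> Poly_Mapping.keys p \<rightarrow> carrier M"
      using foldr_image[OF a] C(3) carrier by auto
  qed (use foldr_image[OF a] sc in auto)
  also have "\<dots> = \<Phi> (lin_ext (\<lambda>w c. sc c (foldr op (letters w) a)) p)"
    unfolding lin_ext_def by (rule finsum_image) (use foldr_image[OF a] C(3) in auto)
  finally show ?thesis .
qed

end

subsection \<open>Homogeneous components in the free algebra\<close>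

definition component :: "nat \<Rightarrow> free_alg \<Rightarrow> free_alg" where
  "component j = lin_ext (\<lambda>w c. if word_degree w = j then Poly_Mapping.single w c else 0)"

lemma component_add: "component j (p + q) = component j p + component j q"
  unfolding component_def by (rule lin_ext_add) (auto simp: single_add)

lemma component_zero [simp]: "component j 0 = 0"
  by (simp add: component_def)

lemma component_single:
  "component j (Poly_Mapping.single w c) = (if word_degree w = j then Poly_Mapping.single w c else 0)"
  unfolding component_def by (rule lin_ext_single) simp

lemma lookup_component: "Poly_Mapping.lookup (component j p) w = (if word_degree w = j then Poly_Mapping.lookup p w else 0)"
  by (induction p rule: poly_mapping_additive_induct)
    (auto simp: component_add component_single lookup_add lookup_single when_def)

lemma component_uminus: "component j (- p) = - component j p"
  by (rule poly_mapping_eqI) (simp add: lookup_component)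

lemma component_diff: "component j (p - q) = component j p - component j q"
  using component_add[of j p "- q"] by (simp add: component_uminus)

lemma component_sum: "component j (sum f A) = (\<Sum>a\<in>A. component j (f a))"
  by (induction A rule: infinite_finite_induct) (simp_all add: component_add)

definition homogeneous :: "nat \<Rightarrow> free_alg set" where
  "homogeneous j = {p. \<forall>w\<in>Poly_Mapping.keys p. word_degree w = j}"

text \<open>The strict inequality gives the zero space for \<open>j = 0\<close>, in accordance with
  \<open>previous_filtration\<close>.\<close>

definition degree_less :: "nat \<Rightarrow> free_alg set" where
  "degree_less j = {p. \<forall>w\<in>Poly_Mapping.keys p. word_degree w < j}"

lemma homogeneous_component: "component j p \<in> homogeneous j"
  by (auto simp: homogeneous_def in_keys_iff lookup_component split: if_splits)

lemma component_homogeneous: "p \<in> homogeneous i \<Longrightarrow> component j p = (if i = j then p else 0)"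
  by (rule poly_mapping_eqI) (auto simp: lookup_component homogeneous_def in_keys_iff)

lemma homogeneous_degree_less: "p \<in> homogeneous i \<Longrightarrow> i < j \<Longrightarrow> p \<in> degree_less j"
  by (auto simp: homogeneous_def degree_less_def)

lemma degree_less_mono: "i \<le> j \<Longrightarrow> degree_less i \<subseteq> degree_less j"
  by (force simp: degree_less_def)

lemma degree_less_zero [simp]: "0 \<in> degree_less j" "degree_less 0 = {0}"
  by (auto simp: degree_less_def simp flip: keys_eq_empty)

lemma degree_less_add: "p \<in> degree_less j \<Longrightarrow> q \<in> degree_less j \<Longrightarrow> p + q \<in> degree_less j"
  using Poly_Mapping.keys_add[of p q] by (auto simp: degree_less_def)

lemma degree_less_uminus: "p \<in> degree_less j \<Longrightarrow> - p \<in> degree_less j"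
  by (simp add: degree_less_def)

lemma degree_less_diff: "p \<in> degree_less j \<Longrightarrow> q \<in> degree_less j \<Longrightarrow> p - q \<in> degree_less j"
  using degree_less_add[of p j "- q"] degree_less_uminus[of q j] by simp

lemma degree_less_diff_component: "p \<in> degree_less (Suc j) \<Longrightarrow> p - component j p \<in> degree_less j"
  by (force simp: degree_less_def in_keys_iff lookup_minus lookup_component split: if_splits)

lemma homogeneous_add: "p \<in> homogeneous j \<Longrightarrow> q \<in> homogeneous j \<Longrightarrow> p + q \<in> homogeneous j"
  using Poly_Mapping.keys_add[of p q] by (auto simp: homogeneous_def)

lemma homogeneous_zero [simp]: "0 \<in> homogeneous j"
  by (simp add: homogeneous_def)

lemma word_degree_plus: "word_degree (u + w) = word_degree u + word_degree w"
  by (simp add: word_degree_def plus_uword_def)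

lemma homogeneous_mult: "p \<in> homogeneous i \<Longrightarrow> q \<in> homogeneous j \<Longrightarrow> p * q \<in> homogeneous (i + j)"
  using keys_mult[of p q] by (force simp: homogeneous_def word_degree_plus)

lemma homogeneous_single: "Poly_Mapping.single w c \<in> homogeneous (word_degree w)"
  by (simp add: homogeneous_def)

lemma homogeneous_gen: "free_gen g \<in> homogeneous (snd g)"
  by (simp add: free_gen_def homogeneous_def word_degree_def)

lemma homogeneous_scalar: "free_scalar c \<in> homogeneous 0"
  by (simp add: free_scalar_def homogeneous_def word_degree_def zero_uword_def)

lemma homogeneous_scalar_mult: "p \<in> homogeneous i \<Longrightarrow> free_scalar c * p \<in> homogeneous i"
  using homogeneous_mult[OF homogeneous_scalar[of c], of p i] by simp

lemma homogeneous_sum: "(\<And>a. a \<in> A \<Longrightarrow> f a \<in> homogeneous j) \<Longrightarrow> sum f A \<in> homogeneous j"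
  by (induction A rule: infinite_finite_induct) (auto intro: homogeneous_add)

lemma homogeneous_uminus: "p \<in> homogeneous j \<Longrightarrow> - p \<in> homogeneous j"
  by (simp add: homogeneous_def)

lemma degree_less_sum: "(\<And>a. a \<in> A \<Longrightarrow> f a \<in> degree_less j) \<Longrightarrow> sum f A \<in> degree_less j"
  by (induction A rule: infinite_finite_induct) (auto intro: degree_less_add)

lemma degree_less_mult_gen: "p \<in> degree_less j \<Longrightarrow> free_gen g * p \<in> degree_less (snd g + j)"
proof -
  have "word_degree (UWord [g]) = snd g" by (simp add: word_degree_def)
  moreover have "Poly_Mapping.keys (free_gen g * p) \<subseteq> {UWord [g] + w | w. w \<in> Poly_Mapping.keys p}"
    using keys_mult[of "free_gen g" p] by (force simp: free_gen_def)
  ultimately show "p \<in> degree_less j \<Longrightarrow> ?thesis"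
    by (force simp: degree_less_def word_degree_plus)
qed

lemma component_gen_mult:
  "component j (free_gen g * p) = (if snd g \<le> j then free_gen g * component (j - snd g) p else 0)"
proof (induction p rule: poly_mapping_additive_induct)
  case (single w c)
  have "free_gen g * Poly_Mapping.single w c \<in> homogeneous (snd g + word_degree w)"
    by (intro homogeneous_mult homogeneous_gen homogeneous_single)
  from component_homogeneous[OF this, of j] show ?case
    by (auto simp: component_single)
qed (simp add: component_add distrib_left)

lemma component_scalar_mult: "component j (free_scalar c * p) = free_scalar c * component j p"
proof (induction p rule: poly_mapping_additive_induct)
  case (single w a)
  have "free_scalar c * Poly_Mapping.single w a \<in> homogeneous (word_degree w)"
    by (intro homogeneous_scalar_mult homogeneous_single)
  from component_homogeneous[OF this, of j] show ?case
    by (auto simp: component_single)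
qed (simp add: component_add distrib_left)

lemma finite_components: "finite {j. component j p \<noteq> 0}"
proof (rule finite_subset)
  show "{j. component j p \<noteq> 0} \<subseteq> word_degree ` Poly_Mapping.keys p"
  proof
    fix j assume "j \<in> {j. component j p \<noteq> 0}"
    then obtain w where "Poly_Mapping.lookup (component j p) w \<noteq> 0"
      by (metis lookup_zero mem_Collect_eq poly_mapping_eqI)
    thus "j \<in> word_degree ` Poly_Mapping.keys p"
      by (auto simp: lookup_component in_keys_iff split: if_splits)
  qed
qed simp

lemma sum_components: "finite A \<Longrightarrow> {j. component j p \<noteq> 0} \<subseteq> A \<Longrightarrow> (\<Sum>j\<in>A. component j p) = p"
proof (rule poly_mapping_eqI)
  fix w assume A: "finite A" "{j. component j p \<noteq> 0} \<subseteq> A"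
  show "Poly_Mapping.lookup (\<Sum>j\<in>A. component j p) w = Poly_Mapping.lookup p w"
  proof (cases "word_degree w \<in> A")
    case True
    thus ?thesis using A by (simp add: lookup_sum lookup_component)
  next
    case False
    hence "component (word_degree w) p = 0" using A by auto
    hence "Poly_Mapping.lookup p w = 0"
      by (metis lookup_component lookup_zero)
    thus ?thesis by (auto simp: lookup_sum lookup_component intro!: sum.neutral)
  qed
qed

lemma bracket_relator_homogeneous: "bracket_relator g h \<in> homogeneous (snd g + snd h)"
proof -
  have z: "snd z = snd g + snd h" if "z \<in> Poly_Mapping.keys (gen_bracket g h)" for z
  proof -
    have "Poly_Mapping.keys (gen_bracket g h) \<subseteq> (\<Union>x. Poly_Mapping.keys (Poly_Mapping.single (x, snd g + snd h)
        (Poly_Mapping.lookup (osp_bracket (fst g) (fst h)) x)))"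
      unfolding gen_bracket_def by (rule keys_sum)
    thus ?thesis using that by (auto split: if_splits)
  qed
  have "free_gen g * free_gen h \<in> homogeneous (snd g + snd h)"
    by (intro homogeneous_mult homogeneous_gen)
  moreover have "free_scalar c * free_gen h * free_gen g \<in> homogeneous (snd g + snd h)" for c
    using homogeneous_mult[OF homogeneous_scalar_mult[OF homogeneous_gen[of h]] homogeneous_gen[of g], of c]
    by (simp add: add.commute)
  moreover have "(\<Sum>z\<in>Poly_Mapping.keys (gen_bracket g h).
      free_scalar (Poly_Mapping.lookup (gen_bracket g h) z) * free_gen z) \<in> homogeneous (snd g + snd h)"
    using z homogeneous_gen by (intro homogeneous_sum homogeneous_scalar_mult) metis
  ultimately show ?thesis
    unfolding bracket_relator_def diff_conv_add_uminus by (intro homogeneous_add homogeneous_uminus)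
qed

text \<open>The relators are homogeneous in the degree of t, so the ideal is graded. Hence classes
  in the associated graded module, which look at one component at a time, depend only on the element
  of the enveloping algebra.\<close>

lemma uea_ideal_component: "p \<in> uea_ideal \<Longrightarrow> component j p \<in> uea_ideal"
proof (induction p rule: uea_ideal.induct)
  case (relator a g h b)
  show ?case
  proof (induction a rule: poly_mapping_additive_induct)
    case a: (single u c)
    show ?case
    proof (induction b rule: poly_mapping_additive_induct)
      case (single w d)
      have "Poly_Mapping.single u c * bracket_relator g h * Poly_Mapping.single w d
          \<in> homogeneous (word_degree u + (snd g + snd h) + word_degree w)"
        by (intro homogeneous_mult homogeneous_single bracket_relator_homogeneous)
      from component_homogeneous[OF this, of j] show ?case
        using uea_ideal.relator uea_ideal.zero by simp
    qed (simp add: distrib_left component_add uea_ideal.add)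
  qed (simp add: distrib_right component_add uea_ideal.add)
qed (simp_all add: component_add uea_ideal.zero uea_ideal.add)

section \<open>The tensor product in coordinates\<close>

text \<open>There is no bound on \<open>b\<close>: the formulas without truncation at
  \<open>2 * m\<close> are those of a Verma module, where the relations of osp(1,2) hold
  already.\<close>

lemma weight_source_bracket:
  "weight m x b * weight m y (source x b) * G (source y (source x b))
     - ksign (osp_odd x) (osp_odd y) * (weight m y b * weight m x (source y b) * G (source x (source y b)))
   = (\<Sum>z\<in>UNIV. Poly_Mapping.lookup (osp_bracket x y) z * (weight m z b * G (source z b)))"
proof -
  \<comment> \<open>Two lowering steps lower the index by at most 4, so from 4 on the subtraction in
    \<open>source\<close> is never truncated.\<close>
  consider "b = 0" | "b = 1" | "b = 2" | "b = 3" | b' where "b = Suc (Suc (Suc (Suc b')))"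
    by (metis One_nat_def Suc_1 numeral_3_eq_3 not0_implies_Suc)
  thus ?thesis
    by cases (cases x; cases y; simp add: UNIV_osp ksign_def lookup_single algebra_simps numeral_eq_Suc)+
qed

lemma weight_source_parity:
  "weight m x b \<noteq> 0 \<Longrightarrow> (-1 :: complex) ^ source x b = (if osp_odd x then - 1 else 1) * (-1) ^ b"
  by (cases x; cases b; cases "b - 1") (auto simp: numeral_2_eq_2 split: if_splits)

lemma sum_fun_apply: "(sum f A) x = (\<Sum>a\<in>A. f a x)"
  by (induction A rule: infinite_finite_induct) simp_all

lemma weight_source_bound:
  assumes "b \<le> 2 * m"
  shows "source x b \<le> 2 * m \<or> weight m x b = 0"
proof (cases x)
  case Xap
  consider "b + 2 \<le> 2 * m" | "b + 1 = 2 * m + 1" | "b + 2 = 2 * m + 1" using assms by linarith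
  thus ?thesis using raising_top[of m] by cases (simp_all add: Xap del: raising.simps)
next
  case Xdp
  consider "b + 1 \<le> 2 * m" | "b + 1 = 2 * m + 1" using assms by linarith
  thus ?thesis using raising_top[of m] by cases (simp_all add: Xdp del: raising.simps)
qed (use assms in auto)

lemma osp_bracket_parity:
  "Poly_Mapping.lookup (osp_bracket x y) z \<noteq> 0 \<Longrightarrow> osp_odd z = (osp_odd x \<noteq> osp_odd y)"
  by (cases x; cases y) (auto simp: lookup_single when_def split: if_splits)

text \<open>The operators act on all functions of the multi-index, as on coordinates for a product
  of Verma modules. The relations are thus checked without range conditions, and \<open>res\<close>
  imposes the ranges afterwards.\<close>

locale tensor_operators =
  fixes ms :: "nat list" and zs :: "complex list"
begin

abbreviation "r \<equiv> length ms"

definition sgn_before :: "nat \<Rightarrow> nat list \<Rightarrow> complex" where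
  "sgn_before i bs = (\<Prod>l<i. (-1) ^ (bs ! l))"

text \<open>The basis vector with index b has the parity of b, so the Koszul sign can be read off
  from the entries before position \<open>i\<close>.\<close>

definition fact_op :: "osp \<Rightarrow> nat \<Rightarrow> (nat list \<Rightarrow> complex) \<Rightarrow> nat list \<Rightarrow> complex" where
  "fact_op x i g bs = (if osp_odd x then sgn_before i bs else 1) * weight (ms ! i) x (bs ! i)
     * g (bs[i := source x (bs ! i)])"

definition dact :: "gen \<Rightarrow> (nat list \<Rightarrow> complex) \<Rightarrow> nat list \<Rightarrow> complex" where
  "dact h g bs = (if length bs = r then \<Sum>i<r. (zs ! i) ^ snd h * fact_op (fst h) i g bs else 0)"

lemma sgn_before_square [simp]: "sgn_before i bs * sgn_before i bs = 1"
  unfolding sgn_before_def by (simp flip: prod.distrib power_mult_distrib)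

lemma sgn_before_update:
  "i \<le> j \<Longrightarrow> sgn_before i (bs[j := a]) = sgn_before i bs"
  unfolding sgn_before_def by (intro prod.cong) auto

lemma sgn_before_update_source:
  assumes "i < j" "i < length bs" "weight m x (bs ! i) \<noteq> 0"
  shows "sgn_before j (bs[i := source x (bs ! i)]) = (if osp_odd x then - 1 else 1) * sgn_before j bs"
proof -
  have "sgn_before j (bs[i := source x (bs ! i)])
      = (-1) ^ (source x (bs ! i)) * (\<Prod>l\<in>{..<j} - {i}. (-1) ^ (bs ! l))"
    unfolding sgn_before_def using assms by (subst prod.remove[of _ i]) (auto intro!: prod.cong)
  also have "\<dots> = (if osp_odd x then - 1 else 1) * ((-1) ^ (bs ! i) * (\<Prod>l\<in>{..<j} - {i}. (-1) ^ (bs ! l)))"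
    using weight_source_parity[OF assms(3)] by simp
  also have "(-1) ^ (bs ! i) * (\<Prod>l\<in>{..<j} - {i}. (-1) ^ (bs ! l)) = sgn_before j bs"
    unfolding sgn_before_def using assms by (subst prod.remove[of "{..<j}" i]) auto
  finally show ?thesis .
qed

text \<open>For \<open>i < j\<close> an odd operator at \<open>i\<close> changes the parity of an
  entry that enters the sign of the operator at \<open>j\<close>; this one change is the Koszul
  sign.\<close>

lemma fact_op_supercommute:
  assumes "i < r" "j < r" "i \<noteq> j" "length bs = r"
  shows "fact_op x i (fact_op y j g) bs = ksign (osp_odd x) (osp_odd y) * fact_op y j (fact_op x i g) bs"
proof -
  have main: "fact_op x i (fact_op y j g) bs = ksign (osp_odd x) (osp_odd y) * fact_op y j (fact_op x i g) bs"
    if "i < j" "i < r" "j < r" for i j x y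
  proof (cases "weight (ms ! i) x (bs ! i) = 0")
    case True
    thus ?thesis using that by (simp add: fact_op_def)
  next
    case False
    have "bs[j := source y (bs ! j), i := source x (bs ! i)] = bs[i := source x (bs ! i), j := source y (bs ! j)]"
      using that by (intro list_update_swap) simp
    thus ?thesis
      using that assms(4) sgn_before_update_source[OF _ _ False, of j]
      by (simp add: fact_op_def sgn_before_update ksign_def)
  qed
  show ?thesis
  proof (cases "i < j")
    case True
    thus ?thesis using main assms by simp
  next
    case False
    hence "fact_op y j (fact_op x i g) bs = ksign (osp_odd y) (osp_odd x) * fact_op x i (fact_op y j g) bs"
      using main[of j i y x] assms by simp
    thus ?thesis by (simp add: ksign_def split: if_splits)
  qed
qed

lemma fact_op_bracket:
  assumes "i < r" "length bs = r"
  shows "fact_op x i (fact_op y i g) bs - ksign (osp_odd x) (osp_odd y) * fact_op y i (fact_op x i g) bs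
    = (\<Sum>z\<in>UNIV. Poly_Mapping.lookup (osp_bracket x y) z * fact_op z i g bs)"
proof -
  define S where "S = (\<lambda>x. if osp_odd x then sgn_before i bs else 1)"
  have f2: "fact_op x i (fact_op y i g) bs = S x * S y * (weight (ms ! i) x (bs ! i)
      * weight (ms ! i) y (source x (bs ! i)) * g (bs[i := source y (source x (bs ! i))]))" for x y
    using assms by (simp add: fact_op_def S_def sgn_before_update)
  have S: "Poly_Mapping.lookup (osp_bracket x y) z * (S x * S y) = Poly_Mapping.lookup (osp_bracket x y) z * S z" for z
    using osp_bracket_parity[of x y z] by (cases "Poly_Mapping.lookup (osp_bracket x y) z = 0") (auto simp: S_def)
  have "(\<Sum>z\<in>UNIV. Poly_Mapping.lookup (osp_bracket x y) z * fact_op z i g bs)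
      = (\<Sum>z\<in>UNIV. (Poly_Mapping.lookup (osp_bracket x y) z * S z)
          * (weight (ms ! i) z (bs ! i) * g (bs[i := source z (bs ! i)])))"
    by (simp add: fact_op_def S_def mult.assoc)
  also have "\<dots> = S x * S y * (\<Sum>z\<in>UNIV. Poly_Mapping.lookup (osp_bracket x y) z
          * (weight (ms ! i) z (bs ! i) * g (bs[i := source z (bs ! i)])))"
    unfolding S[symmetric] by (simp add: sum_distrib_left mult_ac)
  also have "\<dots> = S x * S y * (weight (ms ! i) x (bs ! i) * weight (ms ! i) y (source x (bs ! i))
        * g (bs[i := source y (source x (bs ! i))])
      - ksign (osp_odd x) (osp_odd y) * (weight (ms ! i) y (bs ! i) * weight (ms ! i) x (source y (bs ! i))
        * g (bs[i := source x (source y (bs ! i))])))"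
    using weight_source_bracket[of "ms ! i" x "bs ! i" y "\<lambda>a. g (bs[i := a])"] by simp
  also have "\<dots> = fact_op x i (fact_op y i g) bs - ksign (osp_odd x) (osp_odd y) * fact_op y i (fact_op x i g) bs"
    unfolding f2 by (simp add: algebra_simps)
  finally show ?thesis ..
qed

lemma fact_op_sum: "fact_op x i (\<lambda>bs. \<Sum>a\<in>A. h a bs) bs = (\<Sum>a\<in>A. fact_op x i (h a) bs)"
  by (simp add: fact_op_def sum_distrib_left)

lemma fact_op_scale: "fact_op x i (\<lambda>bs. c * g bs) bs = c * fact_op x i g bs"
  by (simp add: fact_op_def)

lemma fact_op_add: "fact_op x i (g + g') bs = fact_op x i g bs + fact_op x i g' bs"
  by (simp add: fact_op_def algebra_simps)

lemma dact_add: "dact h (g + g') = dact h g + dact h g'"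
  by (rule ext) (simp add: dact_def fact_op_add sum.distrib algebra_simps)

lemma dact_scale: "dact h (\<lambda>bs. c * g bs) = (\<lambda>bs. c * dact h g bs)"
  by (rule ext) (simp add: dact_def fact_op_scale sum_distrib_left algebra_simps)

lemma dact_dact:
  assumes "length bs = r"
  shows "dact h (dact h' g) bs = (\<Sum>i<r. \<Sum>j<r. (zs ! i) ^ snd h * (zs ! j) ^ snd h'
     * fact_op (fst h) i (fact_op (fst h') j g) bs)"
proof -
  have "fact_op x i (dact h' g) bs = fact_op x i (\<lambda>bs. \<Sum>j<r. (zs ! j) ^ snd h' * fact_op (fst h') j g bs) bs" for x i
    using assms by (simp add: fact_op_def dact_def)
  thus ?thesis
    using assms by (simp add: dact_def fact_op_sum fact_op_scale sum_distrib_left mult.assoc)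
qed

lemma dact_bracket:
  "dact h (dact h' g) bs - ksign (gen_odd h) (gen_odd h') * dact h' (dact h g) bs
     = (\<Sum>z\<in>UNIV. Poly_Mapping.lookup (osp_bracket (fst h) (fst h')) z * dact (z, snd h + snd h') g bs)"
proof (cases "length bs = r")
  case True
  let ?s = "ksign (gen_odd h) (gen_odd h')" and ?L = "Poly_Mapping.lookup (osp_bracket (fst h) (fst h'))"
  have "dact h (dact h' g) bs - ?s * dact h' (dact h g) bs
      = (\<Sum>i<r. \<Sum>j<r. (zs ! i) ^ snd h * (zs ! j) ^ snd h' * fact_op (fst h) i (fact_op (fst h') j g) bs)
        - ?s * (\<Sum>i<r. \<Sum>j<r. (zs ! j) ^ snd h' * (zs ! i) ^ snd h * fact_op (fst h') j (fact_op (fst h) i g) bs)"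
    by (simp add: dact_dact[OF True]) (subst sum.swap, simp)
  also have "\<dots> = (\<Sum>i<r. \<Sum>j<r. (zs ! i) ^ snd h * (zs ! j) ^ snd h'
        * (fact_op (fst h) i (fact_op (fst h') j g) bs - ?s * fact_op (fst h') j (fact_op (fst h) i g) bs))"
    by (simp add: sum_distrib_left sum_subtractf algebra_simps)
  also have "\<dots> = (\<Sum>i<r. \<Sum>j<r. if i = j then (zs ! i) ^ (snd h + snd h')
        * (\<Sum>z\<in>UNIV. ?L z * fact_op z i g bs) else 0)"
  proof (intro sum.cong refl)
    fix i j assume "i \<in> {..<r}" "j \<in> {..<r}"
    thus "(zs ! i) ^ snd h * (zs ! j) ^ snd h'
          * (fact_op (fst h) i (fact_op (fst h') j g) bs - ?s * fact_op (fst h') j (fact_op (fst h) i g) bs)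
        = (if i = j then (zs ! i) ^ (snd h + snd h') * (\<Sum>z\<in>UNIV. ?L z * fact_op z i g bs) else 0)"
      using fact_op_supercommute[of i j bs "fst h" "fst h'" g] fact_op_bracket[of i bs "fst h" "fst h'" g] True
      by (cases "i = j") (simp_all add: gen_odd_def power_add)
  qed
  also have "\<dots> = (\<Sum>i<r. \<Sum>z\<in>UNIV. ?L z * ((zs ! i) ^ (snd h + snd h') * fact_op z i g bs))"
    by (simp add: sum_distrib_left mult_ac)
  also have "\<dots> = (\<Sum>z\<in>UNIV. ?L z * dact (z, snd h + snd h') g bs)"
    using True by (subst sum.swap) (simp add: dact_def sum_distrib_left)
  finally show ?thesis .
next
  case False
  thus ?thesis by (simp add: dact_def)
qed

definition dev :: "free_alg \<Rightarrow> (nat list \<Rightarrow> complex) \<Rightarrow> nat list \<Rightarrow> complex" where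
  "dev p g = lin_ext (\<lambda>w c bs. c * foldr dact (letters w) g bs) p"

lemma dev_add: "dev (p + q) g = dev p g + dev q g"
  unfolding dev_def by (rule lin_ext_add) (auto simp: algebra_simps fun_eq_iff)

lemma dev_single: "dev (Poly_Mapping.single w c) g = (\<lambda>bs. c * foldr dact (letters w) g bs)"
  unfolding dev_def by (rule lin_ext_single) (auto simp: fun_eq_iff)

lemma dev_zero [simp]: "dev 0 g = 0"
  by (simp add: dev_def)

lemma foldr_dact_add: "foldr dact hs (g + g') = foldr dact hs g + foldr dact hs g'"
  by (induction hs) (simp_all add: dact_add[unfolded plus_fun_def])

lemma foldr_dact_scale: "foldr dact hs (\<lambda>bs. c * g bs) = (\<lambda>bs. c * foldr dact hs g bs)"
  by (induction hs) (simp_all add: dact_scale)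

lemma dev_add_right: "dev p (g + g') = dev p g + dev p g'"
  by (induction p rule: poly_mapping_additive_induct)
    (simp_all add: dev_single dev_add foldr_dact_add[unfolded plus_fun_def] algebra_simps fun_eq_iff)

lemma dev_scale_right: "dev p (\<lambda>bs. c * g bs) = (\<lambda>bs. c * dev p g bs)"
  by (induction p rule: poly_mapping_additive_induct)
    (simp_all add: dev_single dev_add foldr_dact_scale algebra_simps fun_eq_iff)

lemma dev_mult: "dev (p * q) g = dev p (dev q g)"
proof (induction p rule: poly_mapping_additive_induct)
  case (single u c)
  show ?case
  proof (induction q rule: poly_mapping_additive_induct)
    case (single w d)
    show ?case
      by (simp add: mult_single dev_single plus_uword_def foldr_dact_scale mult.assoc)
  qed (simp add: distrib_left dev_add dev_add_right[unfolded plus_fun_def])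
qed (simp add: distrib_right dev_add)

lemma dev_scalar: "dev (free_scalar c * p) g = (\<lambda>bs. c * dev p g bs)"
  unfolding dev_mult by (simp add: free_scalar_def dev_single zero_uword_def)

lemma dev_uminus: "dev (- p) g = - dev p g"
  using dev_add[of p "- p" g] by (simp add: eq_neg_iff_add_eq_0 add.commute)

lemma dev_diff: "dev (p - q) g = dev p g - dev q g"
  using dev_add[of p "- q" g] by (simp add: dev_uminus)

lemma dev_gen: "dev (free_gen h) g = dact h g"
  by (simp add: free_gen_def dev_single)

lemma dev_gen_mult: "dev (free_gen h * p) g = dact h (dev p g)"
  by (simp add: dev_mult dev_gen)

lemma dev_one: "dev 1 g = g"
  unfolding single_one[symmetric] dev_single by (simp add: zero_uword_def)

lemma dev_sum: "dev (sum f A) g = (\<Sum>a\<in>A. dev (f a) g)"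
  by (induction A rule: infinite_finite_induct) (simp_all add: dev_add)

lemma dev_bracket_relator: "dev (bracket_relator h h') g = 0"
proof (rule ext)
  fix bs
  have lookup: "Poly_Mapping.lookup (gen_bracket h h') (z, s)
      = (if s = snd h + snd h' then Poly_Mapping.lookup (osp_bracket (fst h) (fst h')) z else 0)" for z s
  proof -
    have "Poly_Mapping.lookup (gen_bracket h h') (z, s) =
        (\<Sum>z'\<in>UNIV. if z' = z \<and> s = snd h + snd h' then Poly_Mapping.lookup (osp_bracket (fst h) (fst h')) z else 0)"
      unfolding gen_bracket_def lookup_sum
      by (intro sum.cong) (auto simp: lookup_single when_def)
    also have "\<dots> = (if s = snd h + snd h' then Poly_Mapping.lookup (osp_bracket (fst h) (fst h')) z else 0)"
      by (cases "s = snd h + snd h'") simp_all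
    finally show ?thesis .
  qed
  have "(\<Sum>z\<in>Poly_Mapping.keys (gen_bracket h h'). Poly_Mapping.lookup (gen_bracket h h') z * dact z g bs)
      = (\<Sum>z\<in>(\<lambda>z. (z, snd h + snd h')) ` UNIV. Poly_Mapping.lookup (gen_bracket h h') z * dact z g bs)"
    by (intro sum.mono_neutral_left) (auto simp: in_keys_iff lookup split: if_splits)
  also have "\<dots> = (\<Sum>z\<in>UNIV. Poly_Mapping.lookup (osp_bracket (fst h) (fst h')) z * dact (z, snd h + snd h') g bs)"
    by (subst sum.reindex) (auto simp: inj_on_def lookup)
  finally show "dev (bracket_relator h h') g bs = 0 bs"
    using dact_bracket[of h h' g bs]
    by (simp add: bracket_relator_def dev_diff dev_sum dev_scalar dev_gen dev_gen_mult mult.assoc sum_fun_apply)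
qed

lemma dev_uea_ideal: "p \<in> uea_ideal \<Longrightarrow> dev p g = 0"
proof (induction p rule: uea_ideal.induct)
  case (relator a h h' b)
  have "dev a 0 = 0"
    using dev_scale_right[of a 0 0] by (simp add: fun_eq_iff zero_fun_def)
  thus ?case by (simp add: dev_mult dev_bracket_relator)
qed (simp_all add: dev_add)

end

section \<open>Quotients of concrete modules\<close>

text \<open>Computes the operations of \<open>quotient_supermodule\<close>, which are unions of
  cosets, on representatives. It is used for tensors modulo the multilinear relations and for the
  algebra modulo a left ideal.\<close>

locale concrete_module =
  fixes M :: "('x, 'b :: ab_group_add) supermodule" and K :: "'b set"
  assumes add: "add M = (+)"
    and C: "0 \<in> carrier M" "\<And>a b. a \<in> carrier M \<Longrightarrow> b \<in> carrier M \<Longrightarrow> a + b \<in> carrier M"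
      "\<And>c a. a \<in> carrier M \<Longrightarrow> module.smult M c a \<in> carrier M"
      "\<And>x a. a \<in> carrier M \<Longrightarrow> act M x a \<in> carrier M"
    and smult_add: "\<And>c a b. a \<in> carrier M \<Longrightarrow> b \<in> carrier M \<Longrightarrow> module.smult M c (a + b) = module.smult M c a + module.smult M c b"
    and act_add: "\<And>x a b. a \<in> carrier M \<Longrightarrow> b \<in> carrier M \<Longrightarrow> act M x (a + b) = act M x a + act M x b"
    and K: "K \<subseteq> carrier M" "0 \<in> K" "\<And>a b. a \<in> K \<Longrightarrow> b \<in> K \<Longrightarrow> a + b \<in> K" "\<And>a. a \<in> K \<Longrightarrow> - a \<in> K"
      "\<And>c a. a \<in> K \<Longrightarrow> module.smult M c a \<in> K" "\<And>x a. a \<in> K \<Longrightarrow> act M x a \<in> K"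
begin

definition cls :: "'b \<Rightarrow> 'b set" where
  "cls a = K +>\<^bsub>M\<^esub> a"

lemma cls_eq: "cls a = {k + a | k. k \<in> K}"
  by (auto simp: cls_def a_r_coset_def r_coset_def add)

lemma cls_cong: "cls a = cls b \<longleftrightarrow> a - b \<in> K"
proof
  assume "cls a = cls b"
  moreover have "a \<in> cls a" using K(2) unfolding cls_eq by force
  ultimately obtain k where "k \<in> K" "a = k + b" unfolding cls_eq by auto
  thus "a - b \<in> K" by simp
next
  have sub: "cls a \<subseteq> cls b" if "a - b \<in> K" for a b
    using K(3)[OF _ that] unfolding cls_eq by (force simp: algebra_simps)
  assume "a - b \<in> K"
  moreover from K(4)[OF this] have "b - a \<in> K" by simp
  ultimately show "cls a = cls b" using sub by auto
qed

lemma self_in_cls: "a \<in> cls a"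
  using K(2) unfolding cls_eq by force

lemma quotient_zero: "\<zero>\<^bsub>quotient_supermodule M K\<^esub> = cls 0"
  by (auto simp: quotient_supermodule_def cls_eq)

lemma quotient_carrier: "carrier (quotient_supermodule M K) = cls ` carrier M"
  by (simp add: quotient_supermodule_def cls_def)

lemma quotient_add:
  "cls a \<oplus>\<^bsub>quotient_supermodule M K\<^esub> cls b = cls (a + b)"
proof -
  have "cls a \<oplus>\<^bsub>quotient_supermodule M K\<^esub> cls b = {x + y | x y. x \<in> cls a \<and> y \<in> cls b}"
    by (auto simp: quotient_supermodule_def set_add_def set_mult_def add)
  also have "\<dots> = cls (a + b)"
  proof (intro equalityI subsetI)
    fix z assume "z \<in> {x + y | x y. x \<in> cls a \<and> y \<in> cls b}"
    then obtain k k' where "k \<in> K" "k' \<in> K" "z = (k + a) + (k' + b)" by (auto simp: cls_eq)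
    thus "z \<in> cls (a + b)"
      unfolding cls_eq using K(3)[of k k'] by (auto simp: algebra_simps intro!: exI[of _ "k + k'"])
  next
    fix z assume "z \<in> cls (a + b)"
    then obtain k where "k \<in> K" "z = (k + a) + b" by (auto simp: cls_eq add.assoc)
    moreover from this have "k + a \<in> cls a" by (auto simp: cls_eq)
    ultimately show "z \<in> {x + y | x y. x \<in> cls a \<and> y \<in> cls b}"
      using self_in_cls[of b] by blast
  qed
  finally show ?thesis .
qed

lemma additive_diff:
  assumes "\<And>a b. a \<in> carrier M \<Longrightarrow> b \<in> carrier M \<Longrightarrow> T (a + b) = T a + T b"
    and "\<And>a. a \<in> K \<Longrightarrow> T a \<in> K" "a \<in> carrier M" "x \<in> cls a"
  shows "cls (T x) = cls (T a)"
proof -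
  obtain k where k: "k \<in> K" "x = k + a" using assms(4) by (auto simp: cls_eq)
  hence "T x - T a = T k" using assms(1)[of k a] K(1) assms(3) by auto
  thus ?thesis using assms(2)[OF k(1)] by (simp add: cls_cong)
qed

lemma quotient_smult:
  "a \<in> carrier M \<Longrightarrow> c \<odot>\<^bsub>quotient_supermodule M K\<^esub> cls a = cls (module.smult M c a)"
proof -
  assume a: "a \<in> carrier M"
  have "cls (module.smult M c y) = cls (module.smult M c a)" if "y \<in> cls a" for y
    by (rule additive_diff[OF smult_add K(5) a that])
  hence "(\<Union>y\<in>cls a. cls (module.smult M c y)) = (\<Union>y\<in>cls a. cls (module.smult M c a))"
    by (intro SUP_cong refl)
  also have "\<dots> = cls (module.smult M c a)" using self_in_cls[of a] by auto
  finally have "(\<Union>y\<in>cls a. cls (module.smult M c y)) = cls (module.smult M c a)" .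
  thus ?thesis by (simp add: quotient_supermodule_def cls_def)
qed

lemma quotient_act:
  "a \<in> carrier M \<Longrightarrow> act (quotient_supermodule M K) x (cls a) = cls (act M x a)"
proof -
  assume a: "a \<in> carrier M"
  have "cls (act M x y) = cls (act M x a)" if "y \<in> cls a" for y
    by (rule additive_diff[OF act_add K(6) a that])
  hence "(\<Union>y\<in>cls a. cls (act M x y)) = (\<Union>y\<in>cls a. cls (act M x a))"
    by (intro SUP_cong refl)
  also have "\<dots> = cls (act M x a)" using self_in_cls[of a] by auto
  finally have "(\<Union>y\<in>cls a. cls (act M x y)) = cls (act M x a)" .
  thus ?thesis by (simp add: quotient_supermodule_def cls_def)
qed

lemma quotient_part: "part (quotient_supermodule M K) p = cls ` part M p"
  by (simp add: part_def quotient_supermodule_def cls_def)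

end

section \<open>The multilinear relations are the kernel of the coordinates\<close>

lemma poly_mapping_induct_on [consumes 1, case_names single zero add]:
  assumes "Poly_Mapping.keys p \<subseteq> T"
    and "\<And>k c. k \<in> T \<Longrightarrow> P (Poly_Mapping.single k c)" "P 0"
    and "\<And>p q. Poly_Mapping.keys p \<subseteq> T \<Longrightarrow> Poly_Mapping.keys q \<subseteq> T \<Longrightarrow> P p \<Longrightarrow> P q \<Longrightarrow> P (p + q)"
  shows "P (p :: 'k \<Rightarrow>\<^sub>0 'c :: comm_monoid_add)"
proof -
  let ?s = "\<lambda>A. \<Sum>k\<in>A. Poly_Mapping.single k (Poly_Mapping.lookup p k)"
  have "P (?s A) \<and> Poly_Mapping.keys (?s A) \<subseteq> T" if "finite A" "A \<subseteq> T" for A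
    using that
  proof (induction A)
    case (insert k A)
    have "Poly_Mapping.keys (Poly_Mapping.single k (Poly_Mapping.lookup p k)) \<subseteq> T"
      using insert.prems by simp
    moreover have "P (?s A)" "Poly_Mapping.keys (?s A) \<subseteq> T" using insert by auto
    ultimately show ?case
      using insert.hyps insert.prems assms(2)[of k] assms(4)
        Poly_Mapping.keys_add[of "Poly_Mapping.single k (Poly_Mapping.lookup p k)" "?s A"]
      by (simp del: keys_single) blast
  qed (simp add: assms(3))
  from this[OF finite_keys assms(1)] show ?thesis by (simp add: poly_mapping_eq_sum)
qed

lemma in_listset_iff:
  "us \<in> listset Ss \<longleftrightarrow> length us = length Ss \<and> (\<forall>i<length Ss. us ! i \<in> Ss ! i)"
proof (induction Ss arbitrary: us)
  case (Cons S Ss)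
  thus ?case
    by (cases us) (auto simp: set_Cons_def All_less_Suc2)
qed auto

locale osp_tensor = tensor_operators ms zs
  for ms :: "nat list" and zs :: "complex list" +
  fixes V :: "nat \<Rightarrow> (osp, 'v) supermodule" and v :: "nat \<Rightarrow> 'v"
  assumes V: "\<And>m. irreducible_highest_weight (V m) m (v m)"
    and zs: "length zs = length ms" "distinct zs"

sublocale osp_tensor \<subseteq> H: highest_weight_module "V m" m "v m" for m
  by standard (rule V)

context osp_tensor
begin

abbreviation "Ms \<equiv> map V ms"
abbreviation "FT \<equiv> free_tensor Ms zs"
abbreviation "ET \<equiv> evaluation_tensor Ms zs"
abbreviation "Kt \<equiv> multilinear_relations Ms"

lemma in_tuples: "us \<in> tensor_tuples Ms \<longleftrightarrow> length us = r \<and> (\<forall>i<r. us ! i \<in> carrier (V (ms ! i)))"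
  by (simp add: tensor_tuples_def in_listset_iff)

lemma FT_simps: "carrier FT = {p. Poly_Mapping.keys p \<subseteq> tensor_tuples Ms}" "add FT = (+)" "\<zero>\<^bsub>FT\<^esub> = 0"
  "module.smult FT c = Poly_Mapping.map ((*) c)"
  by (simp_all add: free_tensor_def)

lemma act_FT: "act FT h = lin_ext (\<lambda>us c. \<Sum>i<r. Poly_Mapping.single (apply_factor Ms (fst h) i us) (c * (zs ! i) ^ snd h))"
  by (rule ext) (cases h, simp add: free_tensor_def lin_ext_def)

definition tprod :: "'v list \<Rightarrow> nat list \<Rightarrow> complex" where
  "tprod us bs = (\<Prod>i<r. H.coords (ms ! i) (us ! i) (bs ! i))"

definition box :: "nat list set" where
  "box = {bs. length bs = r \<and> (\<forall>i<r. bs ! i \<le> 2 * ms ! i)}"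

text \<open>Passage from the product of Verma modules to the tensor product of the irreducible
  modules: the basis vectors outside \<open>box\<close> span a submodule, and their coordinates are
  discarded.\<close>

definition res :: "(nat list \<Rightarrow> complex) \<Rightarrow> nat list \<Rightarrow> complex" where
  "res g bs = (if bs \<in> box then g bs else 0)"

definition tcoords :: "('v list \<Rightarrow>\<^sub>0 complex) \<Rightarrow> nat list \<Rightarrow> complex" where
  "tcoords = lin_ext (\<lambda>us c bs. c * tprod us bs)"

lemma tcoords_add: "tcoords (p + q) = tcoords p + tcoords q"
  unfolding tcoords_def by (rule lin_ext_add) (auto simp: fun_eq_iff algebra_simps)

lemma tcoords_single: "tcoords (Poly_Mapping.single us c) = (\<lambda>bs. c * tprod us bs)"
  unfolding tcoords_def by (rule lin_ext_single) (auto simp: fun_eq_iff)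

lemma tcoords_zero [simp]: "tcoords 0 = 0"
  by (simp add: tcoords_def)

lemma tcoords_uminus: "tcoords (- p) = - tcoords p"
  using tcoords_add[of p "- p"] by (simp add: eq_neg_iff_add_eq_0 add.commute)

lemma tcoords_diff: "tcoords (p - q) = tcoords p - tcoords q"
  using tcoords_add[of p "- q"] by (simp add: tcoords_uminus)

lemma tcoords_sum: "tcoords (sum f A) = (\<Sum>a\<in>A. tcoords (f a))"
  by (induction A rule: infinite_finite_induct) (simp_all add: tcoords_add)

lemma tcoords_map: "tcoords (Poly_Mapping.map ((*) c) p) = (\<lambda>bs. c * tcoords p bs)"
proof -
  have "tcoords (Poly_Mapping.map ((*) c) p) = lin_ext (\<lambda>us a bs. (c * a) * tprod us bs) p"
    unfolding tcoords_def by (rule lin_ext_map_scale) (auto simp: fun_eq_iff)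
  thus ?thesis
    by (simp add: tcoords_def lin_ext_def fun_eq_iff sum_fun_apply sum_distrib_left mult.assoc)
qed

lemma res_add: "res (g + g') = res g + res g'"
  by (rule ext) (simp add: res_def)

lemma res_zero [simp]: "res 0 = 0"
  by (rule ext) (simp add: res_def)

text \<open>At an index in \<open>box\<close> an operator reads an index in \<open>box\<close> or
  has weight 0, by \<open>weight_source_bound\<close>.\<close>

lemma res_dact: "res (dact h (res g)) = res (dact h g)"
proof (rule ext)
  fix bs
  have "fact_op x i (res g) bs = fact_op x i g bs" if "bs \<in> box" "i < r" for x i
  proof -
    have b: "length bs = r" "bs ! i \<le> 2 * ms ! i" using that by (auto simp: box_def)
    show ?thesis
    proof (cases "weight (ms ! i) x (bs ! i) = 0")
      case False
      hence "source x (bs ! i) \<le> 2 * ms ! i"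
        using weight_source_bound[OF b(2), of x] by blast
      hence "bs[i := source x (bs ! i)] \<in> box"
        using that b unfolding box_def by (auto simp: nth_list_update)
      thus ?thesis by (simp add: fact_op_def res_def)
    qed (simp add: fact_op_def)
  qed
  thus "res (dact h (res g)) bs = res (dact h g) bs"
    unfolding res_def[of "dact h _"] dact_def by auto
qed

lemma length_apply_factor: "length us = r \<Longrightarrow> i < r \<Longrightarrow> length (apply_factor Ms x i us) = r"
  by (simp add: apply_factor_def)

lemma nth_apply_factor:
  assumes "length us = r" "i < r" "l < r"
  shows "apply_factor Ms x i us ! l = (if l < i then (if osp_odd x then parity_involution (V (ms ! l)) (us ! l) else us ! l)
     else if l = i then act (V (ms ! i)) x (us ! i) else us ! l)"
  using assms by (auto simp: apply_factor_def nth_append nth_Cons')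

lemma apply_factor_tuple:
  assumes "us \<in> tensor_tuples Ms" "i < r"
  shows "apply_factor Ms x i us \<in> tensor_tuples Ms"
  using assms H.parity_involution(1)
  by (auto simp: in_tuples length_apply_factor nth_apply_factor)

lemma tprod_apply_factor:
  assumes us: "us \<in> tensor_tuples Ms" and i: "i < r" and bs: "bs \<in> box"
  shows "tprod (apply_factor Ms x i us) bs = fact_op x i (tprod us) bs"
proof -
  note us' = us[unfolded in_tuples]
  let ?b = "bs[i := source x (bs ! i)]"
  have len: "length bs = r" using bs by (simp add: box_def)
  have "tprod (apply_factor Ms x i us) bs
      = (\<Prod>l<r. (if l < i then (if osp_odd x then (- 1) ^ (bs ! l) else 1) else 1)
          * ((if l = i then weight (ms ! i) x (bs ! i) else 1) * H.coords (ms ! l) (us ! l) (?b ! l)))"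
    unfolding tprod_def
  proof (intro prod.cong refl)
    fix l assume l: "l \<in> {..<r}"
    hence "bs ! l \<le> 2 * ms ! l" "us ! l \<in> carrier (V (ms ! l))"
      using bs us' by (auto simp: box_def)
    thus "H.coords (ms ! l) (apply_factor Ms x i us ! l) (bs ! l) =
        (if l < i then (if osp_odd x then (- 1) ^ (bs ! l) else 1) else 1)
          * ((if l = i then weight (ms ! i) x (bs ! i) else 1) * H.coords (ms ! l) (us ! l) (?b ! l))"
      using l i us' len H.parity_involution(2) H.coords_act
      by (auto simp: nth_apply_factor nth_list_update)
  qed
  also have "\<dots> = (\<Prod>l<r. (if l < i then (if osp_odd x then (- 1) ^ (bs ! l) else 1) else 1))
      * (weight (ms ! i) x (bs ! i) * tprod us ?b)"
    using i by (simp add: prod.distrib tprod_def)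
  also have "(\<Prod>l<r. (if l < i then (if osp_odd x then (- 1) ^ (bs ! l) else 1) else 1))
      = (if osp_odd x then sgn_before i bs else 1)"
  proof -
    have "{..<r} \<inter> {l. l < i} = {..<i}" using i by auto
    thus ?thesis by (simp add: prod.If_cases sgn_before_def)
  qed
  finally show ?thesis by (simp add: fact_op_def mult.assoc)
qed

lemma act_FT_single:
  "act FT h (Poly_Mapping.single us c) = (\<Sum>i<r. Poly_Mapping.single (apply_factor Ms (fst h) i us) (c * (zs ! i) ^ snd h))"
  unfolding act_FT by (rule lin_ext_single) simp

lemma act_FT_add: "act FT h (p + q) = act FT h p + act FT h q"
  unfolding act_FT by (rule lin_ext_add) (auto simp: single_add distrib_right sum.distrib)

lemma act_FT_zero [simp]: "act FT h 0 = 0"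
  by (simp add: act_FT)

lemma act_FT_keys:
  assumes "\<And>us i. us \<in> T \<Longrightarrow> i < r \<Longrightarrow> apply_factor Ms (fst h) i us \<in> T'" "Poly_Mapping.keys p \<subseteq> T"
  shows "Poly_Mapping.keys (act FT h p) \<subseteq> T'"
  using assms(2)
proof (induction p rule: poly_mapping_induct_on)
  case (single us c)
  show ?case
    unfolding act_FT_single
    using keys_sum[of "\<lambda>i. Poly_Mapping.single (apply_factor Ms (fst h) i us) (c * (zs ! i) ^ snd h)" "{..<r}"]
      assms(1)[OF single] by (auto split: if_splits)
next
  case (add p q)
  thus ?case
    unfolding act_FT_add using Poly_Mapping.keys_add[of "act FT h p" "act FT h q"] by blast
qed simp

lemma act_FT_carrier: "p \<in> carrier FT \<Longrightarrow> act FT h p \<in> carrier FT"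
  using act_FT_keys[OF apply_factor_tuple] by (simp add: FT_simps)

lemma tcoords_act: "p \<in> carrier FT \<Longrightarrow> res (tcoords (act FT h p)) = res (dact h (tcoords p))"
  unfolding FT_simps mem_Collect_eq
proof (induction p rule: poly_mapping_induct_on)
  case (single us c)
  show ?case
  proof (rule ext)
    fix bs
    show "res (tcoords (act FT h (Poly_Mapping.single us c))) bs = res (dact h (tcoords (Poly_Mapping.single us c))) bs"
    proof (cases "bs \<in> box")
      case True
      hence len: "length bs = r" by (simp add: box_def)
      have "res (tcoords (act FT h (Poly_Mapping.single us c))) bs
          = (\<Sum>i<r. c * (zs ! i) ^ snd h * tprod (apply_factor Ms (fst h) i us) bs)"
        using True by (simp add: res_def act_FT_single tcoords_sum tcoords_single sum_fun_apply)
      also have "\<dots> = (\<Sum>i<r. (zs ! i) ^ snd h * fact_op (fst h) i (\<lambda>bs. c * tprod us bs) bs)"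
        using tprod_apply_factor[OF single _ True] by (intro sum.cong refl) (simp add: fact_op_scale)
      also have "\<dots> = res (dact h (tcoords (Poly_Mapping.single us c))) bs"
        using True len by (simp add: res_def dact_def tcoords_single)
      finally show ?thesis .
    qed (simp add: res_def)
  qed
next
  case (add p q)
  thus ?case by (simp only: act_FT_add tcoords_add res_add dact_add)
next
  show "res (tcoords (act FT h 0)) = res (dact h (tcoords 0))"
    using dact_scale[of h 0 0] by (simp add: zero_fun_def)
qed

lemma tprod_update:
  assumes "length us = r" "i < r"
  shows "tprod (us[i := a]) bs = H.coords (ms ! i) a (bs ! i) * (\<Prod>l\<in>{..<r} - {i}. H.coords (ms ! l) (us ! l) (bs ! l))"
proof -
  have "tprod (us[i := a]) bs = H.coords (ms ! i) (us[i := a] ! i) (bs ! i)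
      * (\<Prod>l\<in>{..<r} - {i}. H.coords (ms ! l) (us[i := a] ! l) (bs ! l))"
    unfolding tprod_def using assms by (intro prod.remove) auto
  thus ?thesis using assms by simp
qed

lemma tuple_update: "us \<in> tensor_tuples Ms \<Longrightarrow> a \<in> carrier (V (ms ! i)) \<Longrightarrow> us[i := a] \<in> tensor_tuples Ms"
  by (cases "i < r") (auto simp: in_tuples nth_list_update)

lemma multilinear_relations_kernel:
  assumes "p \<in> Kt"
  shows "p \<in> carrier FT" "res (tcoords p) = 0"
proof -
  have single: "Poly_Mapping.single us c \<in> carrier FT" if "us \<in> tensor_tuples Ms" for us c
    using that by (simp add: FT_simps)
  have diff: "p - q \<in> carrier FT" if "p \<in> carrier FT" "q \<in> carrier FT" for p q
    using that keys_diff[of p q] by (auto simp: FT_simps)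
  have "p \<in> carrier FT \<and> tcoords p = 0"
    using assms
  proof (induction p rule: multilinear_relations.induct)
    case zero
    show ?case by (simp add: FT_simps)
  next
    case (additive us i a b c)
    hence a: "a \<in> carrier (V (ms ! i))" "b \<in> carrier (V (ms ! i))" "length us = r" "i < r"
      by (auto simp: in_tuples)
    show ?case
    proof
      show "Poly_Mapping.single (us[i := a \<oplus>\<^bsub>Ms ! i\<^esub> b]) c - Poly_Mapping.single (us[i := a]) c
          - Poly_Mapping.single (us[i := b]) c \<in> carrier FT"
        using a additive(1) by (intro diff single tuple_update) auto
      show "tcoords (Poly_Mapping.single (us[i := a \<oplus>\<^bsub>Ms ! i\<^esub> b]) c - Poly_Mapping.single (us[i := a]) c
          - Poly_Mapping.single (us[i := b]) c) = 0"
        unfolding tcoords_diff tcoords_single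
        by (rule ext) (use a in \<open>simp add: tprod_update H.coords_add algebra_simps\<close>)
    qed
  next
    case (homogeneous us i a d c)
    hence a: "a \<in> carrier (V (ms ! i))" "length us = r" "i < r" by (auto simp: in_tuples)
    show ?case
    proof
      show "Poly_Mapping.single (us[i := d \<odot>\<^bsub>Ms ! i\<^esub> a]) c - Poly_Mapping.single (us[i := a]) (c * d) \<in> carrier FT"
        using a homogeneous(1) by (intro diff single tuple_update) auto
      show "tcoords (Poly_Mapping.single (us[i := d \<odot>\<^bsub>Ms ! i\<^esub> a]) c - Poly_Mapping.single (us[i := a]) (c * d)) = 0"
        unfolding tcoords_diff tcoords_single
        by (rule ext) (use a in \<open>simp add: tprod_update H.coords_smult\<close>)
    qed
  next
    case (add p q)
    thus ?case using Poly_Mapping.keys_add[of p q] by (simp add: FT_simps tcoords_add) blast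
  qed
  thus "p \<in> carrier FT" "res (tcoords p) = 0" by simp_all
qed

lemma single_comb_expand:
  assumes us: "us \<in> tensor_tuples Ms" and i: "i < r"
  shows "Poly_Mapping.single (us[i := H.comb (ms ! i) 0 cc n]) c
     - (\<Sum>a<n. Poly_Mapping.single (us[i := H.e (ms ! i) a]) (c * cc a)) \<in> Kt"
proof (induction n)
  case 0
  have "Poly_Mapping.single (us[i := 0 \<odot>\<^bsub>Ms ! i\<^esub> v (ms ! i)]) c - Poly_Mapping.single (us[i := v (ms ! i)]) (c * 0) \<in> Kt"
    using us i H.v(1) by (intro multilinear_relations.homogeneous) auto
  thus ?case using i H.v(1) by simp
next
  case (Suc n)
  let ?C = "H.comb (ms ! i) 0 cc n" and ?e = "H.e (ms ! i) n"
  have "Poly_Mapping.single (us[i := ?C \<oplus>\<^bsub>Ms ! i\<^esub> (cc n \<odot>\<^bsub>Ms ! i\<^esub> ?e)]) c - Poly_Mapping.single (us[i := ?C]) c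
      - Poly_Mapping.single (us[i := cc n \<odot>\<^bsub>Ms ! i\<^esub> ?e]) c \<in> Kt"
    using us i by (intro multilinear_relations.additive) auto
  moreover have "Poly_Mapping.single (us[i := cc n \<odot>\<^bsub>Ms ! i\<^esub> ?e]) c - Poly_Mapping.single (us[i := ?e]) (c * cc n) \<in> Kt"
    using us i by (intro multilinear_relations.homogeneous) auto
  ultimately have "Poly_Mapping.single (us[i := ?C \<oplus>\<^bsub>Ms ! i\<^esub> (cc n \<odot>\<^bsub>Ms ! i\<^esub> ?e)]) c - Poly_Mapping.single (us[i := ?C]) c
      - Poly_Mapping.single (us[i := cc n \<odot>\<^bsub>Ms ! i\<^esub> ?e]) c
      + (Poly_Mapping.single (us[i := cc n \<odot>\<^bsub>Ms ! i\<^esub> ?e]) c - Poly_Mapping.single (us[i := ?e]) (c * cc n))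
      + (Poly_Mapping.single (us[i := ?C]) c - (\<Sum>a<n. Poly_Mapping.single (us[i := H.e (ms ! i) a]) (c * cc a))) \<in> Kt"
    using Suc by (intro multilinear_relations.add)
  thus ?case using i by (simp add: algebra_simps)
qed

lemma basis_representative:
  assumes "k \<le> r" "p \<in> carrier FT"
  shows "\<exists>q\<in>carrier FT. p - q \<in> Kt \<and>
    (\<forall>us\<in>Poly_Mapping.keys q. \<forall>i<k. \<exists>a\<le>2 * ms ! i. us ! i = H.e (ms ! i) a)"
  using assms(1)
proof (induction k)
  case 0
  show ?case using assms(2) multilinear_relations.zero by (intro bexI[of _ p]) auto
next
  case (Suc k)
  let ?good = "\<lambda>k us. \<forall>i<k. \<exists>a\<le>2 * ms ! i. us ! i = H.e (ms ! i) a"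
  obtain q where q: "q \<in> carrier FT" "p - q \<in> Kt" "\<forall>us\<in>Poly_Mapping.keys q. ?good k us"
    using Suc by auto
  have "Poly_Mapping.keys q \<subseteq> {us \<in> tensor_tuples Ms. ?good k us}"
    using q by (auto simp: FT_simps)
  hence "\<exists>q'\<in>carrier FT. q - q' \<in> Kt \<and> (\<forall>us\<in>Poly_Mapping.keys q'. ?good (Suc k) us)"
  proof (induction q rule: poly_mapping_induct_on)
    case (single us c)
    hence us: "us \<in> tensor_tuples Ms" "?good k us" by auto
    have k: "k < r" using Suc.prems by simp
    have uk: "us ! k \<in> carrier (V (ms ! k))" using us k by (auto simp: in_tuples)
    let ?n = "2 * ms ! k + 1" and ?cc = "H.coords (ms ! k) (us ! k)"
    let ?q = "\<Sum>a<?n. Poly_Mapping.single (us[k := H.e (ms ! k) a]) (c * ?cc a)"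
    have keys: "\<exists>a<?n. ws = us[k := H.e (ms ! k) a]" if "ws \<in> Poly_Mapping.keys ?q" for ws
      using that keys_sum[of "\<lambda>a. Poly_Mapping.single (us[k := H.e (ms ! k) a]) (c * ?cc a)" "{..<?n}"]
      by (force split: if_splits)
    show ?case
    proof (intro bexI[of _ ?q] conjI ballI)
      show "Poly_Mapping.single us c - ?q \<in> Kt"
        using single_comb_expand[OF us(1) k, of ?cc ?n c] unfolding H.coords(1)[OF uk] by simp
      show "?q \<in> carrier FT"
        using keys us(1) by (fastforce simp: FT_simps intro: tuple_update)
      fix ws assume "ws \<in> Poly_Mapping.keys ?q"
      then obtain a where "a < ?n" "ws = us[k := H.e (ms ! k) a]" using keys by blast
      moreover have "length us = r" using us by (simp add: in_tuples)
      ultimately have "ws ! k = H.e (ms ! k) a" "a \<le> 2 * ms ! k" "i < k \<Longrightarrow> ws ! i = us ! i" for i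
        using k by auto
      thus "?good (Suc k) ws"
        using us(2) unfolding less_Suc_eq by metis
    qed
  next
    case (add p q)
    then obtain p' q' where "p' \<in> carrier FT" "p - p' \<in> Kt" "\<forall>us\<in>Poly_Mapping.keys p'. ?good (Suc k) us"
      "q' \<in> carrier FT" "q - q' \<in> Kt" "\<forall>us\<in>Poly_Mapping.keys q'. ?good (Suc k) us" by blast
    moreover have "p + q - (p' + q') = (p - p') + (q - q')" by simp
    ultimately show ?case
      using multilinear_relations.add[of "p - p'" Ms "q - q'"] Poly_Mapping.keys_add[of p' q']
      unfolding FT_simps mem_Collect_eq by (intro exI[of _ "p' + q'"] bexI[of _ "p' + q'"]) (metis UnE subsetD, blast)
  next
    show "\<exists>q'\<in>carrier FT. 0 - q' \<in> Kt \<and> (\<forall>us\<in>Poly_Mapping.keys q'. ?good (Suc k) us)"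
      by (intro bexI[of _ 0]) (auto simp: FT_simps multilinear_relations.zero)
  qed
  then obtain q' where "q' \<in> carrier FT" "q - q' \<in> Kt" "\<forall>us\<in>Poly_Mapping.keys q'. ?good (Suc k) us"
    by blast
  thus ?case
    using multilinear_relations.add[OF q(2), of "q - q'"] by (intro bexI[of _ q']) auto
qed

text \<open>Modulo the relations every element has a representative supported on tuples of basis
  vectors. Its coordinates are its coefficients, so zero coordinates leave only the representative
  0.\<close>

lemma multilinear_relations_eq: "Kt = {p \<in> carrier FT. res (tcoords p) = 0}"
proof (intro equalityI subsetI)
  fix p assume p: "p \<in> {p \<in> carrier FT. res (tcoords p) = 0}"
  then obtain q where q: "q \<in> carrier FT" "p - q \<in> Kt"
    and good: "\<forall>us\<in>Poly_Mapping.keys q. \<forall>i<r. \<exists>a\<le>2 * ms ! i. us ! i = H.e (ms ! i) a"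
    using basis_representative[of r p] by auto
  have "res (tcoords (p - q) + tcoords q) = 0"
    using p by (simp add: tcoords_diff)
  hence zero: "res (tcoords q) = 0"
    using multilinear_relations_kernel(2)[OF q(2)] by (simp only: res_add add_0)
  have "q = 0"
  proof (rule ccontr)
    assume "q \<noteq> 0"
    then obtain us where us: "us \<in> Poly_Mapping.keys q" by (metis all_not_in_conv keys_eq_empty)
    have basis: "\<exists>bs\<in>box. ws = map (\<lambda>i. H.e (ms ! i) (bs ! i)) [0..<r]" if ws: "ws \<in> Poly_Mapping.keys q" for ws
    proof -
      obtain f where f: "\<And>i. i < r \<Longrightarrow> f i \<le> 2 * ms ! i \<and> ws ! i = H.e (ms ! i) (f i)"
        using good ws by metis
      have "length ws = r" using q(1) ws by (auto simp: FT_simps in_tuples)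
      hence "ws = map (\<lambda>i. H.e (ms ! i) (map f [0..<r] ! i)) [0..<r]"
        using f by (intro nth_equalityI) auto
      moreover have "map f [0..<r] \<in> box" using f by (simp add: box_def)
      ultimately show ?thesis by blast
    qed
    have tp: "tprod (map (\<lambda>i. H.e (ms ! i) (as ! i)) [0..<r]) bs = (if bs = as then 1 else 0)"
      if ab: "as \<in> box" "bs \<in> box" for as bs
    proof -
      have "tprod (map (\<lambda>i. H.e (ms ! i) (as ! i)) [0..<r]) bs = (\<Prod>i<r. if bs ! i = as ! i then 1 else 0)"
        unfolding tprod_def using that by (intro prod.cong) (auto simp: box_def H.coords_e)
      also have "\<dots> = (if bs = as then 1 else 0)"
      proof (cases "bs = as")
        case False
        then obtain i where "i < r" "bs ! i \<noteq> as ! i"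
          using ab nth_equalityI[of bs as] by (auto simp: box_def)
        thus ?thesis using False by (auto intro!: prod_zero)
      qed simp
      finally show ?thesis .
    qed
    obtain bs where bs: "bs \<in> box" "us = map (\<lambda>i. H.e (ms ! i) (bs ! i)) [0..<r]"
      using basis[OF us] by blast
    have tpw: "tprod ws bs = (if ws = us then 1 else 0)" if ws: "ws \<in> Poly_Mapping.keys q" for ws
    proof -
      obtain as where as: "as \<in> box" "ws = map (\<lambda>i. H.e (ms ! i) (as ! i)) [0..<r]"
        using basis[OF ws] by blast
      have "tprod ws bs = (if bs = as then 1 else 0)" "tprod us bs = 1"
        using tp[OF as(1) bs(1)] tp[OF bs(1) bs(1)] unfolding as(2) bs(2) by simp_all
      thus ?thesis using as(2) bs(2) by (metis zero_neq_one)
    qed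
    have "tcoords q bs = (\<Sum>ws\<in>Poly_Mapping.keys q. Poly_Mapping.lookup q ws * tprod ws bs)"
      by (simp add: tcoords_def lin_ext_def sum_fun_apply)
    also have "\<dots> = (\<Sum>ws\<in>Poly_Mapping.keys q. if ws = us then Poly_Mapping.lookup q ws else 0)"
      using tpw by (intro sum.cong) auto
    also have "\<dots> = Poly_Mapping.lookup q us" using us by simp
    finally have "Poly_Mapping.lookup q us = 0"
      using fun_cong[OF zero, of bs] bs(1) by (simp add: res_def)
    thus False using us by (simp add: in_keys_iff)
  qed
  thus "p \<in> Kt" using q by simp
qed (auto dest: multilinear_relations_kernel)

end

section \<open>The fusion product as a quotient of the free algebra\<close>

lemma odd_count_flip:
  "i < length ps \<Longrightarrow> odd (length (filter id (ps[i := \<not> ps ! i]))) = even (length (filter id ps))"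
proof (induction ps arbitrary: i)
  case (Cons p ps)
  thus ?case by (cases i) auto
qed simp

definition word_parity :: "bool \<Rightarrow> free_alg set" where
  "word_parity b = {q. \<forall>w\<in>Poly_Mapping.keys q. word_odd w = b}"

lemma lin_ext_regular:
  "lin_ext (\<lambda>w c. free_scalar c * foldr (\<lambda>g q. free_gen g * q) (letters w) q) p = p * q"
proof (induction p rule: poly_mapping_additive_induct)
  case (single w c)
  have "foldr (\<lambda>g q. free_gen g * q) gs q = Poly_Mapping.single (UWord gs) 1 * q" for gs
  proof (induction gs)
    case Nil
    have "Poly_Mapping.single (UWord []) 1 = (1 :: free_alg)"
      by (simp flip: zero_uword_def)
    thus ?case by simp
  next
    case (Cons g gs)
    thus ?case by (simp add: free_gen_def mult_single plus_uword_def flip: mult.assoc)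
  qed
  moreover have "free_scalar c * Poly_Mapping.single w 1 = Poly_Mapping.single w c"
    by (simp add: free_scalar_def mult_single)
  ultimately show ?case
    by (subst lin_ext_single) (simp_all add: free_scalar_0 flip: mult.assoc)
next
  case (add p p')
  show ?case
    using add by (subst lin_ext_add) (simp_all add: free_scalar_0 free_scalar_add distrib_right)
qed

context osp_tensor
begin

lemma FT_concrete: "concrete_module FT Kt"
proof
  have K0: "p \<in> Kt \<longleftrightarrow> p \<in> carrier FT \<and> res (tcoords p) = 0" for p
    by (subst multilinear_relations_eq) simp
  have Kz: "tcoords p bs = 0" if "p \<in> Kt" "bs \<in> box" for p bs
  proof -
    have "res (tcoords p) bs = 0" using that K0 by simp
    thus ?thesis using that by (simp add: res_def)
  qed
  show "a + b \<in> carrier FT" if "a \<in> carrier FT" "b \<in> carrier FT" for a b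
    using that Poly_Mapping.keys_add[of a b] by (auto simp: FT_simps)
  show cs: "module.smult FT c a \<in> carrier FT" if "a \<in> carrier FT" for c a
    using that keys_map_scale[of c a] by (auto simp: FT_simps)
  show "module.smult FT c (a + b) = module.smult FT c a + module.smult FT c b" for c a b
    by (rule poly_mapping_eqI) (simp add: FT_simps lookup_map_scale lookup_add distrib_left)
  show "- a \<in> Kt" if "a \<in> Kt" for a
    using that Kz[OF that] unfolding K0 by (auto simp: FT_simps tcoords_uminus res_def fun_eq_iff)
  show "module.smult FT c a \<in> Kt" if "a \<in> Kt" for c a
    using cs[of a c] that Kz[OF that] unfolding K0
    by (auto simp: FT_simps tcoords_map res_def fun_eq_iff)
  show "act FT x a \<in> Kt" if "a \<in> Kt" for x a
  proof -
    have a: "a \<in> carrier FT" "res (tcoords a) = 0" using that K0 by auto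
    have "res (tcoords (act FT x a)) = res (dact x (res (tcoords a)))"
      by (simp only: tcoords_act[OF a(1)] res_dact)
    also have "\<dots> = 0" unfolding a(2) using dact_scale[of x 0 0] by (simp add: zero_fun_def fun_eq_iff res_def)
    finally show ?thesis unfolding K0 using act_FT_carrier[OF a(1)] by simp
  qed
  show "Kt \<subseteq> carrier FT" using K0 by blast
  show "0 \<in> Kt" by (rule multilinear_relations.zero)
  show "a + b \<in> Kt" if "a \<in> Kt" "b \<in> Kt" for a b
    using that by (rule multilinear_relations.add)
qed (simp_all add: FT_simps act_FT_add act_FT_carrier[unfolded FT_simps mem_Collect_eq])

end

sublocale osp_tensor \<subseteq> F: concrete_module FT Kt
  by (rule FT_concrete)

context osp_tensor
begin

lemma cls_FT_eq:
  assumes "p \<in> carrier FT" "q \<in> carrier FT"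
  shows "F.cls p = F.cls q \<longleftrightarrow> res (tcoords p) = res (tcoords q)"
proof -
  have "p - q \<in> carrier FT" using assms keys_diff[of p q] by (auto simp: FT_simps)
  hence "F.cls p = F.cls q \<longleftrightarrow> res (tcoords (p - q)) = 0"
    unfolding F.cls_cong by (subst multilinear_relations_eq) simp
  also have "\<dots> \<longleftrightarrow> res (tcoords p) = res (tcoords q)"
    by (auto simp: tcoords_diff res_def fun_eq_iff)
  finally show ?thesis .
qed

abbreviation "s0 \<equiv> Poly_Mapping.single (map v ms) (1 :: complex)"

text \<open>The vector \<open>p (v\<^sub>1 \<otimes> \<dots> \<otimes> v\<^sub>r)\<close>: \<open>T0 p\<close> is a representative on tuples, \<open>Tc p\<close> its coordinates,
  \<open>Q p\<close> the vector itself. Below, \<open>Psi p\<close> is the image of the generator under \<open>p\<close> in the associated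
  graded module.\<close>

definition T0 :: "free_alg \<Rightarrow> 'v list \<Rightarrow>\<^sub>0 complex" where
  "T0 = lin_ext (\<lambda>w c. module.smult FT c (foldr (act FT) (letters w) s0))"

definition Tc :: "free_alg \<Rightarrow> nat list \<Rightarrow> complex" where
  "Tc p = res (dev p (tcoords s0))"

definition Q :: "free_alg \<Rightarrow> ('v list \<Rightarrow>\<^sub>0 complex) set" where
  "Q p = F.cls (T0 p)"

lemma s0_carrier: "s0 \<in> carrier FT"
  using H.v(1) by (simp add: FT_simps in_tuples)

sublocale E: module_image ET F.cls "carrier FT" "module.smult FT" "act FT"
  unfolding evaluation_tensor_def
  by unfold_locales
    (simp_all only: F.C F.quotient_carrier F.quotient_zero F.quotient_add F.quotient_smult F.quotient_act)

lemma T0_carrier: "T0 p \<in> carrier FT"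
  unfolding T0_def by (rule E.lin_ext_closed[OF s0_carrier])

lemma res_dact_cong: "res g = res g' \<Longrightarrow> res (dact h g) = res (dact h g')"
  by (metis res_dact)

lemma tcoords_T0: "res (tcoords (T0 p)) = Tc p"
proof (induction p rule: poly_mapping_additive_induct)
  case (single w c)
  have "foldr (act FT) gs s0 \<in> carrier FT \<and> res (tcoords (foldr (act FT) gs s0)) = res (foldr dact gs (tcoords s0))" for gs
  proof (induction gs)
    case Nil
    show ?case using s0_carrier by simp
  next
    case (Cons g gs)
    have "res (tcoords (foldr (act FT) (g # gs) s0)) = res (dact g (tcoords (foldr (act FT) gs s0)))"
      using Cons by (simp only: foldr.simps o_apply tcoords_act)
    also have "\<dots> = res (foldr dact (g # gs) (tcoords s0))"
      unfolding foldr.simps o_apply by (rule res_dact_cong) (use Cons in simp)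
    finally show ?case using Cons F.C(4) by simp
  qed
  note fold = fun_cong[OF conjunct2[OF this[of "letters w"]]]
  have "tcoords (foldr (act FT) (letters w) s0) bs = foldr dact (letters w) (tcoords s0) bs" if "bs \<in> box" for bs
    using fold[of bs] that by (simp add: res_def)
  moreover have "T0 (Poly_Mapping.single w c) = module.smult FT c (foldr (act FT) (letters w) s0)"
    unfolding T0_def
    by (rule lin_ext_single) (rule poly_mapping_eqI, simp add: FT_simps lookup_map_scale)
  ultimately show ?case
    by (auto simp: Tc_def dev_single FT_simps tcoords_map res_def fun_eq_iff)
next
  case (add p q)
  have "T0 (p + q) = T0 p + T0 q"
    unfolding T0_def by (rule lin_ext_add)
      (auto intro!: poly_mapping_eqI simp: FT_simps lookup_map_scale lookup_add distrib_right)
  thus ?case using add by (simp only: tcoords_add res_add Tc_def dev_add)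
qed

lemma Q_eq_iff: "Q p = Q q \<longleftrightarrow> Tc p = Tc q"
  unfolding Q_def by (simp add: cls_FT_eq T0_carrier tcoords_T0)

lemma Tc_add: "Tc (p + q) = Tc p + Tc q"
  by (simp only: Tc_def dev_add res_add)

lemma Tc_zero [simp]: "Tc 0 = 0"
  by (simp add: Tc_def)

lemma Tc_diff: "Tc (p - q) = Tc p - Tc q"
  using Tc_add[of "p - q" q] by simp

lemma Tc_sum: "Tc (sum f A) = (\<Sum>a\<in>A. Tc (f a))"
  by (induction A rule: infinite_finite_induct) (simp_all add: Tc_add)

lemma Tc_scalar: "Tc (free_scalar c * p) = (\<lambda>bs. c * Tc p bs)"
  by (simp add: Tc_def dev_scalar res_def fun_eq_iff)

lemma Tc_mult: "Tc (p * q) = res (dev p (Tc q))"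
proof (induction p rule: poly_mapping_additive_induct)
  case (single w c)
  have "res (foldr dact gs (res g)) = res (foldr dact gs g)" for gs g
  proof (induction gs)
    case Nil
    show ?case by (simp add: res_def fun_eq_iff)
  next
    case (Cons h gs)
    thus ?case by (metis res_dact foldr.simps(2) o_apply)
  qed
  from fun_cong[OF this]
  have "foldr dact (letters w) (res g) bs = foldr dact (letters w) g bs" if "bs \<in> box" for g bs
    using that by (metis res_def)
  thus ?case by (auto simp: Tc_def dev_mult dev_single res_def[of "\<lambda>bs. c * _ bs"] fun_eq_iff)
next
  case (add p q)
  thus ?case by (simp only: distrib_right Tc_add dev_add res_add)
qed

lemma Tc_uea_ideal: "p \<in> uea_ideal \<Longrightarrow> Tc p = 0"
  by (simp add: Tc_def dev_uea_ideal)

lemma Tc_gen: "Tc (free_gen h * p) = res (dact h (Tc p))"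
  by (simp add: Tc_mult dev_gen)

lemma Q_carrier: "Q p \<in> carrier ET"
  using T0_carrier F.quotient_carrier by (auto simp: Q_def evaluation_tensor_def)

lemma cls_eq_Q: "p \<in> carrier FT \<Longrightarrow> res (tcoords p) = Tc q \<Longrightarrow> F.cls p = Q q"
  unfolding Q_def by (simp add: cls_FT_eq T0_carrier tcoords_T0)

lemma Q_add: "Q p \<oplus>\<^bsub>ET\<^esub> Q q = Q (p + q)"
proof -
  have "Q p \<oplus>\<^bsub>ET\<^esub> Q q = F.cls (T0 p + T0 q)"
    unfolding Q_def evaluation_tensor_def by (rule F.quotient_add)
  also have "\<dots> = Q (p + q)"
    by (rule cls_eq_Q) (simp_all only: F.C T0_carrier tcoords_add res_add tcoords_T0 Tc_add)
  finally show ?thesis .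
qed

lemma Q_smult: "c \<odot>\<^bsub>ET\<^esub> Q p = Q (free_scalar c * p)"
proof -
  have "c \<odot>\<^bsub>ET\<^esub> Q p = F.cls (module.smult FT c (T0 p))"
    unfolding Q_def evaluation_tensor_def by (rule F.quotient_smult[OF T0_carrier])
  also have "\<dots> = Q (free_scalar c * p)"
  proof (rule cls_eq_Q)
    show "res (tcoords (module.smult FT c (T0 p))) = Tc (free_scalar c * p)"
    proof (rule ext)
      fix bs
      show "res (tcoords (module.smult FT c (T0 p))) bs = Tc (free_scalar c * p) bs"
        using fun_cong[OF tcoords_T0[of p], of bs]
        by (cases "bs \<in> box") (auto simp: FT_simps tcoords_map Tc_scalar res_def)
    qed
  qed (simp add: F.C T0_carrier)
  finally show ?thesis .
qed

lemma Q_act: "act ET h (Q p) = Q (free_gen h * p)"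
proof -
  have "act ET h (Q p) = F.cls (act FT h (T0 p))"
    unfolding Q_def evaluation_tensor_def by (rule F.quotient_act[OF T0_carrier])
  also have "\<dots> = Q (free_gen h * p)"
  proof (rule cls_eq_Q)
    show "res (tcoords (act FT h (T0 p))) = Tc (free_gen h * p)"
      by (simp only: tcoords_act[OF T0_carrier] res_dact[symmetric, of h "tcoords (T0 p)"] tcoords_T0 Tc_gen)
  qed (simp add: F.C T0_carrier)
  finally show ?thesis .
qed

lemma Q_zero: "Q 0 = \<zero>\<^bsub>ET\<^esub>"
  using F.quotient_zero by (simp add: Q_def T0_def evaluation_tensor_def)

abbreviation "vv \<equiv> pure_tensor Ms zs (map v ms)"

lemma vv_eq: "vv = F.cls s0"
  by (simp add: pure_tensor_def F.cls_def)

lemma uea_act_vv: "uea_act ET (abs_uea p) vv = Q p"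
proof -
  have "uea_act ET (abs_uea p) vv = F.cls (T0 (rep_uea (abs_uea p)))"
    unfolding uea_act_def vv_eq T0_def by (rule E.free_act_image[OF s0_carrier])
  also have "\<dots> = Q p"
    using Tc_uea_ideal[OF rep_abs_uea[of p]] unfolding Q_def[symmetric] Q_eq_iff by (simp add: Tc_diff)
  finally show ?thesis .
qed

lemma ET_finsum_Q:
  assumes "finite I"
  shows "(\<Oplus>\<^bsub>ET\<^esub>i\<in>I. Q (p i)) = Q (\<Sum>i\<in>I. p i)"
proof -
  have "(\<Oplus>\<^bsub>ET\<^esub>i\<in>I. Q (p i)) = F.cls (\<Sum>i\<in>I. T0 (p i))"
    unfolding Q_def by (rule E.finsum_image) (rule assms, rule T0_carrier)
  also have "\<dots> = Q (\<Sum>i\<in>I. p i)"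
  proof (rule cls_eq_Q)
    show "(\<Sum>i\<in>I. T0 (p i)) \<in> carrier FT"
      using assms by (induction I rule: finite_induct) (simp_all add: F.C T0_carrier)
    show "res (tcoords (\<Sum>i\<in>I. T0 (p i))) = Tc (\<Sum>i\<in>I. p i)"
      using assms
    proof (induction I rule: finite_induct)
      case empty
      show ?case by (simp only: sum.empty tcoords_zero Tc_zero res_zero)
    next
      case (insert i I)
      thus ?case by (simp only: sum.insert[OF insert.hyps] tcoords_add res_add tcoords_T0 Tc_add)
    qed
  qed
  finally show ?thesis .
qed

lemma degree_filtration_eq: "degree_filtration ET vv j = Q ` degree_less (Suc j)"
proof (intro equalityI subsetI)
  fix X assume "X \<in> degree_filtration ET vv j"
  then obtain u where u: "X = (\<Oplus>\<^bsub>ET\<^esub>m\<in>{..j}. uea_act ET (u m) vv)" "\<forall>m\<le>j. u m \<in> uea_degree m"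
    by (auto simp: degree_filtration_def)
  hence "\<forall>m. m \<le> j \<longrightarrow> (\<exists>p. p \<in> homogeneous m \<and> u m = abs_uea p)"
    by (auto simp: uea_degree_def homogeneous_def)
  then obtain p where p: "\<And>m. m \<le> j \<Longrightarrow> p m \<in> homogeneous m \<and> u m = abs_uea (p m)" by metis
  define p' where "p' = (\<lambda>m. if m \<le> j then p m else 0)"
  interpret abelian_monoid ET by (rule E.abelian_monoid)
  have "X = (\<Oplus>\<^bsub>ET\<^esub>m\<in>{..j}. Q (p' m))"
    unfolding u(1) by (rule finsum_cong') (auto simp: p p'_def uea_act_vv Q_carrier)
  also have "\<dots> = Q (\<Sum>m\<in>{..j}. p' m)" by (rule ET_finsum_Q) simp
  finally show "X \<in> Q ` degree_less (Suc j)"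
    using p homogeneous_degree_less[of "p m" m "Suc j" for m]
    by (auto simp: p'_def less_Suc_eq_le intro!: imageI degree_less_sum)
next
  fix X assume "X \<in> Q ` degree_less (Suc j)"
  then obtain p where p: "p \<in> degree_less (Suc j)" "X = Q p" by auto
  have "{i. component i p \<noteq> 0} \<subseteq> {..j}"
  proof
    fix i assume "i \<in> {i. component i p \<noteq> 0}"
    then obtain w where "Poly_Mapping.lookup (component i p) w \<noteq> 0"
      by (metis lookup_zero mem_Collect_eq poly_mapping_eqI)
    thus "i \<in> {..j}" using p(1) by (auto simp: lookup_component degree_less_def in_keys_iff less_Suc_eq_le split: if_splits)
  qed
  hence "X = Q (\<Sum>i\<in>{..j}. component i p)" using p(2) sum_components[of "{..j}" p] by simp
  also have "\<dots> = (\<Oplus>\<^bsub>ET\<^esub>m\<in>{..j}. uea_act ET (abs_uea (component m p)) vv)"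
    by (simp add: ET_finsum_Q uea_act_vv)
  finally show "X \<in> degree_filtration ET vv j"
    unfolding degree_filtration_def uea_degree_def
    using homogeneous_component[of _ p] by (auto simp: homogeneous_def intro!: exI[of _ "\<lambda>m. abs_uea (component m p)"])
qed

lemma previous_filtration_eq: "previous_filtration ET vv j = Q ` degree_less j"
proof (cases j)
  case 0
  thus ?thesis by (simp add: previous_filtration_def Q_zero)
qed (simp add: previous_filtration_def degree_filtration_eq)

definition gcls :: "nat \<Rightarrow> free_alg \<Rightarrow> ('v list \<Rightarrow>\<^sub>0 complex) set set" where
  "gcls j p = {Q (q + p) | q. q \<in> degree_less j}"

lemma coset_eq_gcls: "previous_filtration ET vv j +>\<^bsub>ET\<^esub> Q p = gcls j p"
  by (auto simp: a_r_coset_def r_coset_def previous_filtration_eq gcls_def Q_add)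

lemma gcls_eq_iff: "gcls j p = gcls j p' \<longleftrightarrow> Tc (p - p') \<in> Tc ` degree_less j"
proof
  assume "gcls j p = gcls j p'"
  moreover have "Q (0 + p) \<in> gcls j p" unfolding gcls_def using degree_less_zero by blast
  ultimately obtain q where "q \<in> degree_less j" "Q (0 + p) = Q (q + p')" by (auto simp: gcls_def)
  thus "Tc (p - p') \<in> Tc ` degree_less j"
    by (intro image_eqI[of _ _ q]) (simp_all add: Q_eq_iff Tc_add Tc_diff)
next
  have sub: "gcls j p \<subseteq> gcls j p'" if "q \<in> degree_less j" "Tc (p - p') = Tc q" for p p' q
  proof
    fix X assume "X \<in> gcls j p"
    then obtain q' where "q' \<in> degree_less j" "X = Q (q' + p)" by (auto simp: gcls_def)
    moreover have "Q (q' + p) = Q ((q' + q) + p')"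
      unfolding Q_eq_iff using that(2) by (simp add: Tc_add Tc_diff algebra_simps)
    ultimately show "X \<in> gcls j p'"
      unfolding gcls_def using degree_less_add[of q' j q] that(1) by blast
  qed
  assume "Tc (p - p') \<in> Tc ` degree_less j"
  then obtain q where q: "q \<in> degree_less j" "Tc (p - p') = Tc q" by auto
  hence "Tc (p' - p) = Tc (- q)"
    using Tc_diff[of 0 q] Tc_diff[of p p'] Tc_diff[of p' p] by (simp add: algebra_simps)
  thus "gcls j p = gcls j p'"
    using sub[OF q] sub[OF degree_less_uminus[OF q(1)]] by auto
qed

lemma gcls_nonempty: "gcls j p \<noteq> {}"
  unfolding gcls_def using degree_less_zero(1) by blast

lemma gcls_zero: "gcls j 0 = previous_filtration ET vv j"
  by (auto simp: gcls_def previous_filtration_eq)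

abbreviation "GR \<equiv> associated_graded ET vv"

definition Psi :: "free_alg \<Rightarrow> nat \<Rightarrow> ('v list \<Rightarrow>\<^sub>0 complex) set set" where
  "Psi p j = gcls j (component j p)"

text \<open>Turns equality in the associated graded module into a statement on coordinates in the
  tensor product: each component of the difference must act on the generator like something of lower
  degree.\<close>

lemma Psi_eq_iff: "Psi p = Psi q \<longleftrightarrow> (\<forall>j. Tc (component j (p - q)) \<in> Tc ` degree_less j)"
  by (simp add: fun_eq_iff Psi_def gcls_eq_iff component_diff)

lemma Psi_zero: "Psi 0 = \<zero>\<^bsub>GR\<^esub>"
  by (rule ext) (simp add: Psi_def gcls_zero associated_graded_def)

lemma Psi_add: "Psi (p + q) = Psi p \<oplus>\<^bsub>GR\<^esub> Psi q"
proof (rule ext)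
  fix j
  have "gcls j p <+>\<^bsub>ET\<^esub> gcls j q = gcls j (p + q)" for p q
  proof (intro equalityI subsetI)
    fix X assume "X \<in> gcls j p <+>\<^bsub>ET\<^esub> gcls j q"
    then obtain a b where ab: "a \<in> degree_less j" "b \<in> degree_less j" "X = Q (a + p) \<oplus>\<^bsub>ET\<^esub> Q (b + q)"
      by (auto simp: set_add_def set_mult_def gcls_def)
    hence "X = Q ((a + b) + (p + q))" by (simp add: Q_add algebra_simps)
    thus "X \<in> gcls j (p + q)" using degree_less_add[OF ab(1,2)] by (auto simp: gcls_def)
  next
    fix X assume "X \<in> gcls j (p + q)"
    then obtain a where a: "a \<in> degree_less j" "X = Q (a + (p + q))" by (auto simp: gcls_def)
    hence "X = Q (a + p) \<oplus>\<^bsub>ET\<^esub> Q (0 + q)" by (simp add: Q_add add.assoc)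
    moreover have "Q (a + p) \<in> gcls j p" "Q (0 + q) \<in> gcls j q"
      unfolding gcls_def using a degree_less_zero by blast+
    ultimately show "X \<in> gcls j p <+>\<^bsub>ET\<^esub> gcls j q"
      by (auto simp: set_add_def set_mult_def)
  qed
  thus "Psi (p + q) j = (Psi p \<oplus>\<^bsub>GR\<^esub> Psi q) j"
    by (simp add: Psi_def associated_graded_def component_add)
qed

lemma Psi_smult: "Psi (free_scalar c * p) = c \<odot>\<^bsub>GR\<^esub> Psi p"
proof (rule ext)
  fix j
  let ?q = "component j p"
  have "(c \<odot>\<^bsub>GR\<^esub> Psi p) j = (\<Union>X\<in>gcls j ?q. previous_filtration ET vv j +>\<^bsub>ET\<^esub> (c \<odot>\<^bsub>ET\<^esub> X))"
    by (simp add: associated_graded_def Psi_def)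
  also have "\<dots> = (\<Union>X\<in>gcls j ?q. gcls j (free_scalar c * ?q))"
  proof (intro SUP_cong refl)
    fix X assume "X \<in> gcls j ?q"
    then obtain a where a: "a \<in> degree_less j" "X = Q (a + ?q)" by (auto simp: gcls_def)
    have "free_scalar c * a \<in> degree_less j"
      using a(1) keys_mult[of "free_scalar c" a]
      by (auto simp: degree_less_def free_scalar_def split: if_splits)
    hence "gcls j (free_scalar c * (a + ?q)) = gcls j (free_scalar c * ?q)"
      unfolding gcls_eq_iff by (simp add: distrib_left)
    thus "previous_filtration ET vv j +>\<^bsub>ET\<^esub> (c \<odot>\<^bsub>ET\<^esub> X) = gcls j (free_scalar c * ?q)"
      unfolding a(2) Q_smult coset_eq_gcls .
  qed
  also have "\<dots> = gcls j (free_scalar c * ?q)"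
    using gcls_nonempty by simp
  finally show "Psi (free_scalar c * p) j = (c \<odot>\<^bsub>GR\<^esub> Psi p) j"
    by (simp add: Psi_def component_scalar_mult)
qed

lemma Psi_act: "Psi (free_gen h * p) = act GR h (Psi p)"
proof (rule ext)
  fix j
  obtain x s where h: "h = (x, s)" by (cases h)
  show "Psi (free_gen h * p) j = act GR h (Psi p) j"
  proof (cases "s \<le> j")
    case False
    thus ?thesis by (simp add: Psi_def component_gen_mult associated_graded_def h gcls_zero)
  next
    case True
    let ?q = "component (j - s) p"
    have "act GR h (Psi p) j = (\<Union>X\<in>gcls (j - s) ?q. previous_filtration ET vv j +>\<^bsub>ET\<^esub> act ET (x, s) X)"
      using True by (simp add: associated_graded_def Psi_def h)
    also have "\<dots> = (\<Union>X\<in>gcls (j - s) ?q. gcls j (free_gen h * ?q))"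
    proof (intro SUP_cong refl)
      fix X assume "X \<in> gcls (j - s) ?q"
      then obtain a where a: "a \<in> degree_less (j - s)" "X = Q (a + ?q)" by (auto simp: gcls_def)
      have "free_gen h * a \<in> degree_less j"
        using degree_less_mult_gen[OF a(1), of h] True by (simp add: h)
      hence "gcls j (free_gen h * (a + ?q)) = gcls j (free_gen h * ?q)"
        unfolding gcls_eq_iff by (simp add: distrib_left)
      thus "previous_filtration ET vv j +>\<^bsub>ET\<^esub> act ET (x, s) X = gcls j (free_gen h * ?q)"
        unfolding a(2) h[symmetric] Q_act coset_eq_gcls .
    qed
    also have "\<dots> = gcls j (free_gen h * ?q)"
      using gcls_nonempty by simp
    finally show ?thesis using True by (simp add: Psi_def component_gen_mult h)
  qed
qed

lemma Psi_in_graded_part: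
  assumes "\<And>j. Q (component j p) \<in> S"
  shows "Psi p \<in> graded_part ET vv S"
  unfolding graded_part_def mem_Collect_eq
proof
  show "\<forall>j. Psi p j \<in> (+>\<^bsub>ET\<^esub>) (previous_filtration ET vv j) ` (degree_filtration ET vv j \<inter> S)"
  proof
    fix j
    have "Q (component j p) \<in> degree_filtration ET vv j \<inter> S"
      using assms homogeneous_degree_less[OF homogeneous_component, of j "Suc j" p] by (auto simp: degree_filtration_eq)
    thus "Psi p j \<in> (+>\<^bsub>ET\<^esub>) (previous_filtration ET vv j) ` (degree_filtration ET vv j \<inter> S)"
      unfolding Psi_def coset_eq_gcls[symmetric] by blast
  qed
  show "finite {j. Psi p j \<noteq> previous_filtration ET vv j}"
    by (rule finite_subset[OF _ finite_components[of p]]) (auto simp: Psi_def gcls_zero)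
qed

lemma carrier_GR: "carrier GR = range Psi"
proof (intro equalityI subsetI)
  fix F assume "F \<in> carrier GR"
  hence F: "\<And>j. F j \<in> (+>\<^bsub>ET\<^esub>) (previous_filtration ET vv j) ` (degree_filtration ET vv j \<inter> carrier ET)"
    "finite {j. F j \<noteq> previous_filtration ET vv j}"
    by (auto simp: associated_graded_def graded_part_def)
  have "\<exists>q. q \<in> degree_less (Suc j) \<and> F j = gcls j q" for j
    using F(1)[of j] by (auto simp: degree_filtration_eq coset_eq_gcls)
  then obtain q where q: "\<And>j. q j \<in> degree_less (Suc j)" "\<And>j. F j = gcls j (q j)" by metis
  have Fj: "F j = gcls j (component j (q j))" for j
    unfolding q(2) gcls_eq_iff using degree_less_diff_component[OF q(1)] by auto
  let ?J = "{j. F j \<noteq> previous_filtration ET vv j}"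
  have "F = Psi (\<Sum>j\<in>?J. component j (q j))"
  proof (rule ext)
    fix i
    have "component i (\<Sum>j\<in>?J. component j (q j)) = (\<Sum>j\<in>?J. if j = i then component j (q j) else 0)"
      unfolding component_sum by (intro sum.cong refl) (simp add: component_homogeneous[OF homogeneous_component])
    also have "\<dots> = (if i \<in> ?J then component i (q i) else 0)"
      using F(2) by simp
    finally show "F i = Psi (\<Sum>j\<in>?J. component j (q j)) i"
      using Fj[of i] by (auto simp: Psi_def gcls_zero)
  qed
  thus "F \<in> range Psi" by blast
next
  fix F assume "F \<in> range Psi"
  thus "F \<in> carrier GR"
    using Psi_in_graded_part Q_carrier by (auto simp: associated_graded_def)
qed

sublocale G: module_image GR Psi UNIV "\<lambda>c q. free_scalar c * q" "\<lambda>g q. free_gen g * q"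
  by unfold_locales (simp_all add: carrier_GR Psi_zero Psi_add Psi_smult Psi_act)

lemma free_act_GR: "free_act GR p (Psi q) = Psi (p * q)"
  using G.free_act_image[of q p] by (simp add: lin_ext_regular)

lemma Psi_uea_ideal: "p - q \<in> uea_ideal \<Longrightarrow> Psi p = Psi q"
  unfolding Psi_eq_iff
  using uea_ideal_component Tc_uea_ideal degree_less_zero(1) by (metis Tc_zero imageI)

lemma apply_factor_parity:
  assumes "us \<in> parity_tuples Ms b" "i < r"
  shows "apply_factor Ms x i us \<in> parity_tuples Ms (b \<noteq> osp_odd x)"
proof -
  obtain ps where ps: "length ps = r" "odd (length (filter id ps)) = b" "us \<in> listset (map2 part Ms ps)"
    using assms(1) by (auto simp: parity_tuples_def)
  hence us: "length us = r" "\<And>l. l < r \<Longrightarrow> us ! l \<in> part (V (ms ! l)) (ps ! l)"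
    by (auto simp: in_listset_iff)
  let ?ps = "if osp_odd x then ps[i := \<not> ps ! i] else ps"
  have len: "length ?ps = r" using ps(1) by simp
  have carrier: "us ! l \<in> carrier (V (ms ! l))" if "l < r" for l
    using H.part_subset us(2)[OF that] .
  have "apply_factor Ms x i us ! l \<in> part (V (ms ! l)) (?ps ! l)" if l: "l < r" for l
    using us(2)[OF l] H.act_part[OF us(2)[OF assms(2)], of x] H.parity_involution(3)[OF carrier[OF l] us(2)[OF l]]
      ps(1) assms(2) l
    by (auto simp: nth_apply_factor[OF us(1) assms(2) l])
  hence "apply_factor Ms x i us \<in> listset (map2 part Ms ?ps)"
    using us(1) assms(2) len by (simp add: in_listset_iff length_apply_factor)
  moreover have "odd (length (filter id ?ps)) = (b \<noteq> osp_odd x)"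
    using odd_count_flip[of i ps] ps assms(2) by auto
  ultimately show ?thesis
    unfolding parity_tuples_def using len by (auto intro!: exI[of _ ?ps] simp del: map2_map_map)
qed

lemma T0_parity:
  assumes "q \<in> word_parity b"
  shows "T0 q \<in> part FT b"
proof -
  have part: "part FT b = {p. Poly_Mapping.keys p \<subseteq> parity_tuples Ms b}" for b
    by (simp add: part_def free_tensor_def)
  have "map v ms \<in> parity_tuples Ms False"
    unfolding parity_tuples_def using H.v(2)
    by (auto simp: in_listset_iff intro!: exI[of _ "replicate r False"])
  hence word: "Poly_Mapping.keys (foldr (act FT) gs s0) \<subseteq> parity_tuples Ms (odd (length (filter gen_odd gs)))" for gs
  proof (induction gs)
    case (Cons g gs)
    let ?b = "odd (length (filter gen_odd gs))"
    have "Poly_Mapping.keys (act FT g (foldr (act FT) gs s0)) \<subseteq> parity_tuples Ms (?b \<noteq> osp_odd (fst g))"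
    proof (rule act_FT_keys)
      show "apply_factor Ms (fst g) i us \<in> parity_tuples Ms (?b \<noteq> osp_odd (fst g))"
        if "us \<in> parity_tuples Ms ?b" "i < r" for us i
        using that by (rule apply_factor_parity)
      show "Poly_Mapping.keys (foldr (act FT) gs s0) \<subseteq> parity_tuples Ms ?b"
        using Cons by simp
    qed
    moreover have "odd (length (filter gen_odd (g # gs))) = (?b \<noteq> osp_odd (fst g))"
      by (cases "osp_odd (fst g)") (simp_all add: gen_odd_def[of g])
    ultimately show ?case by simp
  qed simp
  have "Poly_Mapping.keys (T0 q) \<subseteq> (\<Union>w\<in>Poly_Mapping.keys q. Poly_Mapping.keys
      (module.smult FT (Poly_Mapping.lookup q w) (foldr (act FT) (letters w) s0)))"
    unfolding T0_def lin_ext_def by (rule keys_sum)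
  also have "\<dots> \<subseteq> parity_tuples Ms b"
  proof (intro UN_least)
    fix w assume "w \<in> Poly_Mapping.keys q"
    hence "odd (length (filter gen_odd (letters w))) = b"
      using assms by (auto simp: word_parity_def word_odd_def)
    thus "Poly_Mapping.keys (module.smult FT (Poly_Mapping.lookup q w) (foldr (act FT) (letters w) s0)) \<subseteq> parity_tuples Ms b"
      using word[of "letters w"] keys_map_scale[of "Poly_Mapping.lookup q w" "foldr (act FT) (letters w) s0"]
      by (simp add: FT_simps)
  qed
  finally show ?thesis by (simp add: part)
qed

lemma Psi_parity:
  assumes "q \<in> word_parity b"
  shows "Psi q \<in> part GR b"
proof -
  have "component j q \<in> word_parity b" for j
    using assms by (auto simp: word_parity_def in_keys_iff lookup_component split: if_splits)
  hence "Q (component j q) \<in> part ET b" for j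
    using T0_parity F.quotient_part by (auto simp: Q_def evaluation_tensor_def)
  hence "Psi q \<in> graded_part ET vv (part ET b)" by (rule Psi_in_graded_part)
  thus ?thesis by (cases b) (simp_all add: part_def associated_graded_def)
qed

end

section \<open>Relations and dimension of the fusion product\<close>

lemma degree_less_mult:
  assumes "p \<in> degree_less i" "q \<in> degree_less (Suc j)"
  shows "p * q \<in> degree_less (i + j)" "q * p \<in> degree_less (i + j)"
  using assms keys_mult[of p q] keys_mult[of q p]
  by (fastforce simp: degree_less_def word_degree_plus)+

text \<open>Lower order terms added to a homogeneous element change its powers in lower degree only.
  This permits replacing x \<otimes> t^s by x \<otimes> P with P monic of degree s.\<close>

lemma degree_less_power_diff:
  assumes A: "A \<in> homogeneous s" and L: "B - A \<in> degree_less s"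
  shows "B ^ k - A ^ k \<in> degree_less (k * s) \<and> B ^ k \<in> degree_less (Suc (k * s))"
proof (induction k)
  case 0
  show ?case by (simp add: degree_less_def word_degree_def zero_uword_def flip: single_one)
next
  case (Suc k)
  have A': "A \<in> degree_less (Suc s)" using homogeneous_degree_less[OF A, of "Suc s"] by simp
  hence B: "B \<in> degree_less (Suc s)"
    using degree_less_add[of "B - A" "Suc s" A] degree_less_mono[of s "Suc s"] L by auto
  have Ak: "A ^ k \<in> degree_less (Suc (k * s))"
    using degree_less_diff[of "B ^ k" "Suc (k * s)" "B ^ k - A ^ k"] Suc degree_less_mono[of "k * s" "Suc (k * s)"] by auto
  have eq: "B ^ Suc k - A ^ Suc k = B * (B ^ k - A ^ k) + (B - A) * A ^ k"
    by (simp add: algebra_simps)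
  have "B * (B ^ k - A ^ k) \<in> degree_less (k * s + s)"
    using Suc B by (intro degree_less_mult) auto
  moreover have "(B - A) * A ^ k \<in> degree_less (s + k * s)"
    using L Ak by (intro degree_less_mult) auto
  ultimately have "B ^ Suc k - A ^ Suc k \<in> degree_less (Suc k * s)"
    unfolding eq by (intro degree_less_add) (simp_all add: add.commute)
  moreover have "B ^ Suc k \<in> degree_less (Suc (Suc k * s))"
    using degree_less_mult(1)[of B "Suc s" "B ^ k" "k * s"] B Suc by simp
  ultimately show ?case by simp
qed

lemma homogeneous_power: "A \<in> homogeneous s \<Longrightarrow> A ^ k \<in> homogeneous (k * s)"
proof (induction k)
  case 0
  show ?case by (simp add: homogeneous_def word_degree_def zero_uword_def flip: single_one)
qed (use homogeneous_mult[of A s] in \<open>simp\<close>)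

text \<open>The element x \<otimes> P(t) of the current superalgebra, which acts on factor i with
  the additional scalar P(z_i).\<close>

definition pgen :: "osp \<Rightarrow> complex poly \<Rightarrow> free_alg" where
  "pgen x P = (\<Sum>q\<le>degree P. free_scalar (coeff P q) * free_gen (x, q))"

lemma pgen_monic:
  assumes "lead_coeff P = 1"
  shows "pgen x P - free_gen (x, degree P) \<in> degree_less (degree P)"
proof -
  have "pgen x P = (\<Sum>q<degree P. free_scalar (coeff P q) * free_gen (x, q)) + free_gen (x, degree P)"
    using assms by (simp add: pgen_def free_scalar_1 flip: lessThan_Suc_atMost)
  moreover have "(\<Sum>q<degree P. free_scalar (coeff P q) * free_gen (x, q)) \<in> degree_less (degree P)"
  proof (rule degree_less_sum)
    fix q assume "q \<in> {..<degree P}"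
    thus "free_scalar (coeff P q) * free_gen (x, q) \<in> degree_less (degree P)"
      using homogeneous_degree_less[OF homogeneous_scalar_mult[OF homogeneous_gen[of "(x, q)"]]] by simp
  qed
  ultimately show ?thesis by simp
qed

context osp_tensor
begin

definition delta :: "nat list \<Rightarrow> nat list \<Rightarrow> complex" where
  "delta as bs = (if bs = as then 1 else 0)"

lemma Tc_one: "Tc 1 = delta (replicate r 0)"
proof (rule ext)
  fix bs
  show "Tc 1 bs = delta (replicate r 0) bs"
  proof (cases "bs \<in> box")
    case True
    have "Tc 1 bs = tprod (map v ms) bs"
      using True by (simp add: Tc_def dev_one tcoords_single res_def)
    also have "\<dots> = (\<Prod>i<r. if bs ! i = 0 then 1 else 0)"
    proof -
      have "H.coords (ms ! i) (v (ms ! i)) (bs ! i) = (if bs ! i = 0 then 1 else 0)" if "i < r" for i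
        using H.coords_e[of 0 "ms ! i" "bs ! i"] True that by (simp add: box_def)
      thus ?thesis unfolding tprod_def by (intro prod.cong) auto
    qed
    also have "\<dots> = delta (replicate r 0) bs"
    proof (cases "bs = replicate r 0")
      case False
      have "length bs = r" using True by (simp add: box_def)
      have "\<exists>i<r. bs ! i \<noteq> 0"
      proof (rule ccontr)
        assume "\<not> (\<exists>i<r. bs ! i \<noteq> 0)"
        hence "bs = replicate r 0" using \<open>length bs = r\<close> by (intro nth_equalityI) auto
        thus False using False by simp
      qed
      hence "(\<Prod>i<r. if bs ! i = 0 then 1 else 0 :: complex) = 0"
        by (intro prod_zero) auto
      thus ?thesis using False by (simp only: delta_def if_False)
    qed (simp add: delta_def)
    finally show ?thesis .
  next
    case False
    thus ?thesis by (auto simp: Tc_def res_def delta_def box_def)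
  qed
qed

lemma Tc_from_one: "Tc p = res (dev p (delta (replicate r 0)))"
  using Tc_mult[of p 1] by (simp add: Tc_one)

lemma zero_in_Tc_image: "0 \<in> Tc ` degree_less j"
  using degree_less_zero(1)[of j] by (rule image_eqI[rotated]) simp

lemma Psi_eq_zero_homogeneous:
  assumes "p \<in> homogeneous s" "Tc p \<in> Tc ` degree_less s"
  shows "Psi p = Psi 0"
  unfolding Psi_eq_iff using assms(2)
  by (simp add: component_homogeneous[OF assms(1)] zero_in_Tc_image)

lemma Psi_raising:
  assumes "x \<in> {Xap, Xdp}"
  shows "Psi (free_gen (x, s)) = Psi 0"
proof (rule Psi_eq_zero_homogeneous)
  show "free_gen (x, s) \<in> homogeneous s" using homogeneous_gen[of "(x, s)"] by simp
  have "fact_op x i (delta (replicate r 0)) bs = 0" if "i < r" "length bs = r" for i bs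
  proof -
    have "bs[i := source x (bs ! i)] ! i \<noteq> 0" using that assms by auto
    hence "bs[i := source x (bs ! i)] \<noteq> replicate r 0"
    proof (rule contrapos_nn)
      assume "bs[i := source x (bs ! i)] = replicate r 0"
      from arg_cong[OF this, of "\<lambda>bs. bs ! i"] show "bs[i := source x (bs ! i)] ! i = 0"
        using that(1) by simp
    qed
    thus ?thesis by (simp add: fact_op_def delta_def)
  qed
  hence "Tc (free_gen (x, s)) bs = 0" for bs
    by (simp add: Tc_from_one dev_gen dact_def res_def box_def)
  hence "Tc (free_gen (x, s)) = 0" by (auto simp: fun_eq_iff)
  thus "Tc (free_gen (x, s)) \<in> Tc ` degree_less s" by (simp only: zero_in_Tc_image)
qed

text \<open>\<open>Hal\<close> \<otimes> t^s multiplies the generator by the sum of the m_i z_i^s. A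
  scalar has degree 0, so for \<open>s > 0\<close> it is invisible in degree
  \<open>s\<close>.\<close>

lemma Psi_Hal:
  "Psi (free_gen (Hal, s) - free_scalar (if s = 0 then of_nat (sum_list ms) else 0)) = Psi 0"
proof -
  have h: "Tc (free_gen (Hal, s)) = Tc (free_scalar (\<Sum>i<r. (zs ! i) ^ s * of_nat (ms ! i)))"
  proof (rule ext)
    fix bs
    have "Tc (free_scalar c) bs = c * delta (replicate r 0) bs" for c
      using Tc_scalar[of c 1] by (simp add: Tc_one)
    moreover have "Tc (free_gen (Hal, s)) bs = (\<Sum>i<r. (zs ! i) ^ s * of_nat (ms ! i)) * delta (replicate r 0) bs"
      by (auto simp: Tc_from_one dev_gen dact_def res_def fact_op_def delta_def box_def sum_distrib_right)
    ultimately show "Tc (free_gen (Hal, s)) bs = Tc (free_scalar (\<Sum>i<r. (zs ! i) ^ s * of_nat (ms ! i))) bs"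
      by simp
  qed
  show ?thesis
  proof (cases "s = 0")
    case True
    have "(\<Sum>i<r. of_nat (ms ! i)) = (of_nat (sum_list ms) :: complex)"
      by (simp add: sum_list_sum_nth atLeast0LessThan)
    hence "Tc (free_gen (Hal, 0) - free_scalar (of_nat (sum_list ms))) = 0"
      using h True by (simp add: Tc_diff)
    moreover have "free_gen (Hal, 0) - free_scalar (of_nat (sum_list ms)) \<in> homogeneous 0"
      using homogeneous_add[OF homogeneous_gen[of "(Hal, 0)", simplified] homogeneous_uminus[OF homogeneous_scalar]] by simp
    ultimately have "Psi (free_gen (Hal, 0) - free_scalar (of_nat (sum_list ms))) = Psi 0"
      by (intro Psi_eq_zero_homogeneous) (simp_all only: zero_in_Tc_image)
    thus ?thesis using True by (simp only: simp_thms if_True)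
  next
    case False
    have "free_gen (Hal, s) \<in> homogeneous s" using homogeneous_gen[of "(Hal, s)"] by simp
    moreover have "Tc (free_gen (Hal, s)) \<in> Tc ` degree_less s"
      unfolding h by (intro imageI homogeneous_degree_less[OF homogeneous_scalar]) (use False in simp)
    ultimately have "Psi (free_gen (Hal, s)) = Psi 0"
      by (rule Psi_eq_zero_homogeneous)
    thus ?thesis using False by (simp add: free_scalar_0)
  qed
qed

lemma Tc_pgen_mult:
  assumes "bs \<in> box"
  shows "Tc (pgen x P * p) bs = (\<Sum>i<r. poly P (zs ! i) * fact_op x i (Tc p) bs)"
proof -
  have len: "length bs = r" using assms by (simp add: box_def)
  have "Tc (pgen x P * p) bs = dev (pgen x P) (Tc p) bs"
    using assms by (simp add: Tc_mult res_def)
  also have "\<dots> = (\<Sum>q\<le>degree P. coeff P q * (\<Sum>i<r. (zs ! i) ^ q * fact_op x i (Tc p) bs))"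
    using len by (simp add: pgen_def dev_sum sum_fun_apply dev_scalar dev_gen dact_def)
  also have "\<dots> = (\<Sum>i<r. \<Sum>q\<le>degree P. coeff P q * (zs ! i) ^ q * fact_op x i (Tc p) bs)"
    by (simp add: sum_distrib_left mult.assoc) (rule sum.swap)
  finally show ?thesis by (simp add: poly_altdef sum_distrib_right)
qed

lemma Tc_outside: "bs \<notin> box \<Longrightarrow> Tc p bs = 0"
  by (simp add: Tc_def res_def)

text \<open>Each factor adds 2 to one entry of the multi-index, and only at positions whose
  parameter is not a root of \<open>P\<close>.\<close>

lemma Tc_pgen_lowering_support:
  assumes "Tc (pgen Xam P ^ q) bs \<noteq> 0"
  shows "bs \<in> box \<and> (\<Sum>i<r. bs ! i) = 2 * q \<and> (\<forall>i<r. poly P (zs ! i) = 0 \<longrightarrow> bs ! i = 0)"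
  using assms
proof (induction q arbitrary: bs)
  case 0
  hence "bs = replicate r 0" by (simp add: Tc_one delta_def split: if_splits)
  thus ?case by (simp add: box_def)
next
  case (Suc q)
  have bs: "bs \<in> box" using Suc.prems Tc_outside by blast
  hence len: "length bs = r" by (simp add: box_def)
  have "(\<Sum>i<r. poly P (zs ! i) * fact_op Xam i (Tc (pgen Xam P ^ q)) bs) \<noteq> 0"
    using Suc.prems Tc_pgen_mult[OF bs, of Xam P "pgen Xam P ^ q"] by simp
  then obtain i where i: "i < r" "poly P (zs ! i) * fact_op Xam i (Tc (pgen Xam P ^ q)) bs \<noteq> 0"
    by (meson lessThan_iff sum.neutral)
  let ?b = "bs[i := bs ! i - 2]"
  have b2: "2 \<le> bs ! i" "poly P (zs ! i) \<noteq> 0" "Tc (pgen Xam P ^ q) ?b \<noteq> 0"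
    using i(2) by (auto simp: fact_op_def split: if_splits)
  note IH = Suc.IH[OF b2(3)]
  have "(\<Sum>l<r. bs ! l) = bs ! i + (\<Sum>l\<in>{..<r} - {i}. bs ! l)"
    using i(1) by (intro sum.remove) auto
  moreover have "(\<Sum>l<r. ?b ! l) = ?b ! i + (\<Sum>l\<in>{..<r} - {i}. ?b ! l)"
    using i(1) by (intro sum.remove) auto
  moreover have "(\<Sum>l\<in>{..<r} - {i}. ?b ! l) = (\<Sum>l\<in>{..<r} - {i}. bs ! l)"
    by (intro sum.cong) auto
  ultimately have "(\<Sum>l<r. bs ! l) = 2 * Suc q"
    using IH b2(1) i(1) len by simp
  moreover have "bs ! l = 0" if "l < r" "poly P (zs ! l) = 0" for l
    using IH that b2(2) i(1) len by (cases "l = i") auto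
  ultimately show ?case using bs by simp
qed

text \<open>Vanishes at the first \<open>s\<close> parameters; when there are fewer than
  \<open>s\<close>, a power of t brings the degree up to exactly \<open>s\<close>.\<close>

definition vanishing_poly :: "nat \<Rightarrow> complex poly" where
  "vanishing_poly s = monom 1 (s - min s r) * (\<Prod>i<min s r. [:- (zs ! i), 1:])"

lemma vanishing_poly: "lead_coeff (vanishing_poly s) = 1" "degree (vanishing_poly s) = s"
  "i < s \<Longrightarrow> i < r \<Longrightarrow> poly (vanishing_poly s) (zs ! i) = 0"
proof -
  have lc: "lead_coeff (\<Prod>i<l. [:- (zs ! i), 1:]) = 1" for l
    by (simp add: lead_coeff_prod)
  show "lead_coeff (vanishing_poly s) = 1"
    by (simp add: vanishing_poly_def lead_coeff_mult lc degree_monom_eq)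
  have "degree (\<Prod>i<l. [:- (zs ! i), 1:]) = l" for l
    by (subst degree_prod_eq_sum_degree) auto
  moreover have "(\<Prod>i<l. [:- (zs ! i), 1:]) \<noteq> 0" for l
    by (simp add: prod_zero_iff)
  ultimately show "degree (vanishing_poly s) = s"
    unfolding vanishing_poly_def by (subst degree_mult_eq) (simp_all add: degree_monom_eq monom_eq_0_iff)
  show "poly (vanishing_poly s) (zs ! i) = 0" if "i < s" "i < r"
    using that by (auto simp: vanishing_poly_def poly_prod prod_zero_iff)
qed

text \<open>For \<open>r \<le> s\<close> the polynomial of degree \<open>s\<close> vanishes at every
  parameter, so x \<otimes> P annihilates the generator and x \<otimes> t^s equals minus its lower
  order terms there.\<close>

lemma Psi_truncation:
  assumes "r \<le> s"
  shows "Psi (free_gen (x, s)) = Psi 0"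
proof (rule Psi_eq_zero_homogeneous)
  show "free_gen (x, s) \<in> homogeneous s" using homogeneous_gen[of "(x, s)"] by simp
  let ?P = "vanishing_poly s"
  have "Tc (pgen x ?P) bs = 0" for bs
    using Tc_pgen_mult[of bs x ?P 1] vanishing_poly(3)[of _ s] assms Tc_outside by (cases "bs \<in> box") auto
  hence "Tc (pgen x ?P) = 0" by (auto simp: fun_eq_iff)
  hence "Tc (free_gen (x, s)) = Tc (- (pgen x ?P - free_gen (x, s)))"
    by (simp add: Tc_diff)
  moreover have "- (pgen x ?P - free_gen (x, s)) \<in> degree_less s"
    using degree_less_uminus[OF pgen_monic[OF vanishing_poly(1), of x s]] by (simp only: vanishing_poly(2))
  ultimately show "Tc (free_gen (x, s)) \<in> Tc ` degree_less s" by blast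
qed

text \<open>Replacing t^s by a monic polynomial that vanishes at the first \<open>s\<close>
  parameters leaves the even lowering operator acting on the later factors only. These admit at most
  \<open>\<Sum>i\<in>{s..<r}. ms ! i\<close> applications.\<close>

lemma Psi_lowering_power:
  assumes "(\<Sum>i\<in>{s..<r}. ms ! i) \<le> c"
  shows "Psi (free_gen (Xam, s) ^ (c + 1)) = Psi 0"
proof (rule Psi_eq_zero_homogeneous)
  let ?P = "vanishing_poly s" and ?A = "free_gen (Xam, s)" and ?k = "c + 1"
  have A: "?A \<in> homogeneous s" using homogeneous_gen[of "(Xam, s)"] by simp
  show "?A ^ ?k \<in> homogeneous (?k * s)" by (rule homogeneous_power[OF A])
  have "Tc (pgen Xam ?P ^ ?k) bs = 0" for bs
  proof (rule ccontr)
    assume "Tc (pgen Xam ?P ^ ?k) bs \<noteq> 0"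
    note supp = Tc_pgen_lowering_support[OF this]
    have "(\<Sum>i<r. bs ! i) = (\<Sum>i\<in>{s..<r}. bs ! i)"
      using supp vanishing_poly(3)[of _ s] by (intro sum.mono_neutral_right) auto
    also have "\<dots> \<le> (\<Sum>i\<in>{s..<r}. 2 * ms ! i)"
      using supp by (intro sum_mono) (auto simp: box_def)
    also have "\<dots> \<le> 2 * c" using assms by (simp flip: sum_distrib_left)
    finally show False using supp by simp
  qed
  hence "Tc (pgen Xam ?P ^ ?k) = 0" by (auto simp: fun_eq_iff)
  hence "Tc (?A ^ ?k) = Tc (- (pgen Xam ?P ^ ?k - ?A ^ ?k))"
    by (simp only: minus_diff_eq Tc_diff) simp
  moreover have "pgen Xam ?P - ?A \<in> degree_less s"
    using pgen_monic[OF vanishing_poly(1), of Xam s] by (simp only: vanishing_poly(2))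
  hence "- (pgen Xam ?P ^ ?k - ?A ^ ?k) \<in> degree_less (?k * s)"
    using degree_less_power_diff[OF A] degree_less_uminus by blast
  ultimately show "Tc (?A ^ ?k) \<in> Tc ` degree_less (?k * s)" by blast
qed

text \<open>Lagrange interpolation lets the lowering operators act on a single tensor factor.\<close>

lemma delta_in_range: "as \<in> box \<Longrightarrow> \<exists>p. Tc p = delta as"
proof (induction "\<Sum>i<r. as ! i" arbitrary: as)
  case 0
  hence "as = replicate r 0" by (intro nth_equalityI) (auto simp: box_def)
  thus ?case using Tc_one by blast
next
  case (Suc n)
  have len: "length as = r" using Suc.prems by (simp add: box_def)
  have "\<exists>i<r. as ! i \<noteq> 0"
  proof (rule ccontr)
    assume "\<not> (\<exists>i<r. as ! i \<noteq> 0)"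
    thus False using Suc.hyps(2) by simp
  qed
  then obtain i where i: "i < r" "as ! i \<noteq> 0" by blast
  let ?a = "as[i := as ! i - 1]"
  have a: "?a \<in> box" using Suc.prems i by (auto simp: box_def nth_list_update)
  have "(\<Sum>l<r. as ! l) = as ! i + (\<Sum>l\<in>{..<r} - {i}. as ! l)"
    using i(1) by (intro sum.remove) auto
  moreover have "(\<Sum>l<r. ?a ! l) = ?a ! i + (\<Sum>l\<in>{..<r} - {i}. ?a ! l)"
    using i(1) by (intro sum.remove) auto
  moreover have "(\<Sum>l\<in>{..<r} - {i}. ?a ! l) = (\<Sum>l\<in>{..<r} - {i}. as ! l)"
    by (intro sum.cong) auto
  ultimately have "n = (\<Sum>l<r. ?a ! l)"
    using Suc.hyps(2) i len by simp
  from Suc.hyps(1)[OF this a] obtain p where p: "Tc p = delta ?a" by blast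
  let ?P = "\<Prod>l\<in>{..<r} - {i}. [:- (zs ! l), 1:]"
  have P: "poly ?P (zs ! l) = 0 \<longleftrightarrow> l \<noteq> i" if "l < r" for l
    using that i(1) zs by (auto simp: poly_prod prod_zero_iff nth_eq_iff_index_eq)
  define c where "c = poly ?P (zs ! i) * sgn_before i as"
  have "c \<noteq> 0"
    using P[OF i(1)] sgn_before_square[of i as] by (auto simp: c_def simp del: sgn_before_square)
  have "Tc (pgen Xdm ?P * p) bs = c * delta as bs" for bs
  proof (cases "bs \<in> box")
    case True
    hence lb: "length bs = r" by (simp add: box_def)
    have "Tc (pgen Xdm ?P * p) bs = (\<Sum>l<r. poly ?P (zs ! l) * fact_op Xdm l (Tc p) bs)"
      by (rule Tc_pgen_mult[OF True])
    also have "\<dots> = (\<Sum>l<r. if l = i then poly ?P (zs ! i) * fact_op Xdm i (Tc p) bs else 0)"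
      using P by (intro sum.cong) auto
    also have "\<dots> = poly ?P (zs ! i) * fact_op Xdm i (delta ?a) bs"
      using i(1) by (simp add: p)
    also have "\<dots> = c * delta as bs"
    proof (cases "bs = as")
      case True
      thus ?thesis using i by (simp add: fact_op_def delta_def c_def)
    next
      case False
      have "bs = as" if "1 \<le> bs ! i" "bs[i := bs ! i - 1] = ?a"
      proof (rule nth_equalityI)
        fix l assume "l < length bs"
        have "bs[i := bs ! i - 1] ! i = ?a ! i" "l \<noteq> i \<Longrightarrow> bs[i := bs ! i - 1] ! l = ?a ! l"
          using that(2) by simp_all
        thus "bs ! l = as ! l" using i that(1) lb len by (cases "l = i") auto
      qed (use lb len in simp)
      thus ?thesis using False by (auto simp: fact_op_def delta_def)
    qed
    finally show ?thesis .
  next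
    case False
    thus ?thesis using Suc.prems by (auto simp: Tc_outside delta_def)
  qed
  hence "Tc (free_scalar (1 / c) * (pgen Xdm ?P * p)) = delta as"
    using \<open>c \<noteq> 0\<close> by (simp add: Tc_scalar)
  thus ?case by blast
qed

end

section \<open>Comparing the two sides\<close>

context vector_space
begin

text \<open>Express \<open>x\<close> modulo \<open>I\<close> through a minimal subset of
  \<open>B\<close>. Each member of it can be exchanged for \<open>x\<close>, which is zero modulo
  \<open>J\<close>.\<close>

lemma spanning_set_shrink:
  assumes B: "finite B" "span (B \<union> I) = UNIV"
    and IJ: "subspace I" "I \<subseteq> J" and x: "x \<in> J" "x \<notin> I"
  shows "\<exists>b\<in>B. span ((B - {b}) \<union> J) = UNIV"
proof -
  let ?P = "{B'. B' \<subseteq> B \<and> x \<in> span (B' \<union> I)}"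
  have "finite ?P" "B \<in> ?P" using B by auto
  then obtain B' where B': "B' \<in> ?P" "\<And>A. A \<in> ?P \<Longrightarrow> A \<subseteq> B' \<Longrightarrow> B' = A"
    using finite_has_minimal2[of ?P B] by (metis (no_types, lifting))
  have "x \<notin> span ({} \<union> I)" using x(2) by (simp only: Un_empty_left span_eq_iff[THEN iffD2, OF IJ(1)] not_False_eq_True)
  hence "B' \<noteq> {}" using B'(1) by blast
  then obtain b where b: "b \<in> B'" by blast
  hence "x \<notin> span ((B' - {b}) \<union> I)" using B'(1) B'(2)[of "B' - {b}"] by auto
  moreover have "insert b ((B' - {b}) \<union> I) = B' \<union> I" using b by auto
  ultimately have "b \<in> span (insert x ((B' - {b}) \<union> I))"
    using in_span_insert[of x b "(B' - {b}) \<union> I"] B'(1) by simp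
  also have "\<dots> \<subseteq> span ((B - {b}) \<union> J)" using x(1) IJ(2) B'(1) by (intro span_mono) auto
  finally have "B \<union> I \<subseteq> span ((B - {b}) \<union> J)"
    using IJ(2) by (auto intro: span_base)
  hence "span (B \<union> I) \<subseteq> span ((B - {b}) \<union> J)" by (rule span_minimal) simp
  thus ?thesis using B(2) b B'(1) by blast
qed

text \<open>Steinitz exchange against the spanning set \<open>H\<close>. With \<open>H\<close> the
  homogeneous elements it makes a spanning set homogeneous without enlarging it.\<close>

lemma spanning_set_replace:
  assumes "finite C" "span H = UNIV" "span (C \<union> J) = UNIV"
  shows "\<exists>C'\<subseteq>H. finite C' \<and> card C' \<le> card C \<and> span (C' \<union> J) = UNIV"
  using assms(1,3)
proof (induction "card (C - H)" arbitrary: C)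
  case 0
  thus ?case by auto
next
  case (Suc n)
  then obtain b where b: "b \<in> C" "b \<notin> H" by (metis Diff_iff card.empty equals0I nat.distinct(1))
  let ?C = "C - {b}"
  have "?C - H = (C - H) - {b}" by auto
  hence n: "card (?C - H) = n" using Suc.hyps(2) b Suc.prems(1) by simp
  have card: "card ?C < card C" using b Suc.prems(1) by (meson card_Diff1_less)
  show ?case
  proof (cases "H \<subseteq> span (?C \<union> J)")
    case True
    hence "span (?C \<union> J) = UNIV"
      using span_minimal[of H "span (?C \<union> J)"] assms(2) by auto
    then obtain C' where "C' \<subseteq> H" "finite C'" "card C' \<le> card ?C" "span (C' \<union> J) = UNIV"
      using Suc.hyps(1)[OF n[symmetric]] Suc.prems(1) by auto
    thus ?thesis using less_imp_le[OF card] by (meson le_trans)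
  next
    case False
    then obtain h where h: "h \<in> H" "h \<notin> span (?C \<union> J)" by blast
    have "insert b (?C \<union> J) = C \<union> J" using b by auto
    hence "b \<in> span (insert h (?C \<union> J))"
      using in_span_insert[of h b "?C \<union> J"] h(2) Suc.prems(2) by simp
    hence "C \<union> J \<subseteq> span (insert h ?C \<union> J)" by (auto intro: span_base)
    hence "span (insert h ?C \<union> J) = UNIV"
      using span_minimal[of "C \<union> J" "span (insert h ?C \<union> J)"] Suc.prems(2) by auto
    moreover have "insert h ?C - H = ?C - H" using h(1) by auto
    ultimately obtain C' where "C' \<subseteq> H" "finite C'" "card C' \<le> card (insert h ?C)" "span (C' \<union> J) = UNIV"
      using Suc.hyps(1)[of "insert h ?C"] n Suc.prems(1) by (metis finite_Diff finite_insert)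
    moreover have "card (insert h ?C) \<le> card C"
      using card card_insert_le_m1[of "card C" ?C h] by linarith
    ultimately show ?thesis by (meson le_trans)
  qed
qed

end

global_interpretation fvs: vector_space "\<lambda>(c :: complex) (g :: nat list \<Rightarrow> complex) bs. c * g bs"
  by unfold_locales (auto simp: fun_eq_iff algebra_simps)

lemma left_ideal_uea_left_ideal: "uea_left_ideal (left_ideal R)"
proof
  show "u * a \<in> left_ideal R" if "a \<in> left_ideal R" for u a
    using that
  proof induction
    case (relation r w)
    thus ?case using left_ideal.relation[of r R "u * w"] by (simp add: mult.assoc)
  qed (simp_all add: left_ideal.zero left_ideal.add distrib_left)
qed (rule left_ideal.zero, rule left_ideal.add)

lemma left_ideal_least:
  assumes "uea_left_ideal K" "R \<subseteq> K"
  shows "left_ideal R \<subseteq> K"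
proof
  interpret uea_left_ideal K by fact
  fix a assume "a \<in> left_ideal R"
  thus "a \<in> K" by induction (use assms(2) in \<open>auto intro: zero add mult\<close>)
qed

lemma left_ideal_superset: "R \<subseteq> left_ideal R"
  using left_ideal.relation[of _ R 1] by auto

lemma span_homogeneous: "uvs.span (abs_uea ` (\<Union>j. homogeneous j)) = UNIV"
proof -
  have "abs_uea p \<in> uvs.span (abs_uea ` (\<Union>j. homogeneous j))" for p
  proof -
    have "abs_uea p = (\<Sum>j\<in>{j. component j p \<noteq> 0}. abs_uea (component j p))"
      using sum_components[OF finite_components, of p p] by (simp flip: abs_uea_sum)
    also have "\<dots> \<in> uvs.span (abs_uea ` (\<Union>j. homogeneous j))"
      using homogeneous_component by (intro uvs.span_sum uvs.span_base) auto
    finally show ?thesis .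
  qed
  thus ?thesis by (metis UNIV_eq_I abs_rep_uea)
qed

section \<open>The annihilator of the generator of the fusion product\<close>

context osp_tensor
begin

definition fusion_kernel :: "uea set" where
  "fusion_kernel = abs_uea ` {p. Psi p = Psi 0}"

lemma abs_in_fusion_kernel: "abs_uea p \<in> fusion_kernel \<longleftrightarrow> Psi p = Psi 0"
proof
  assume "abs_uea p \<in> fusion_kernel"
  then obtain q where "abs_uea p = abs_uea q" "Psi q = Psi 0" by (auto simp: fusion_kernel_def)
  thus "Psi p = Psi 0" using Psi_uea_ideal[of p q] by (simp add: abs_uea_eq_iff)
qed (simp add: fusion_kernel_def)

lemma fusion_kernel_ideal: "uea_left_ideal fusion_kernel"
proof
  show "0 \<in> fusion_kernel" using abs_in_fusion_kernel[of 0] unfolding abs_uea_0 by simp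
next
  fix a b assume "a \<in> fusion_kernel" "b \<in> fusion_kernel"
  then obtain p q where "a = abs_uea p" "b = abs_uea q" "Psi p = Psi 0" "Psi q = Psi 0"
    by (auto simp: fusion_kernel_def)
  moreover from this have "Psi (p + q) = Psi (0 + 0)" by (simp only: Psi_add)
  ultimately show "a + b \<in> fusion_kernel"
    using abs_in_fusion_kernel[of "p + q"] by (simp add: abs_uea_add)
next
  fix a u assume "a \<in> fusion_kernel"
  then obtain p where p: "a = abs_uea p" "Psi p = Psi 0" by (auto simp: fusion_kernel_def)
  have "Psi (rep_uea u * p) = Psi (rep_uea u * 0)"
    unfolding free_act_GR[symmetric] p(2) ..
  thus "u * a \<in> fusion_kernel"
    using abs_in_fusion_kernel[of "rep_uea u * p"] p by (simp add: abs_uea_mult abs_rep_uea)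
qed

text \<open>Passing to the associated graded module loses no dimension. By induction on the degree,
  a homogeneous element is a combination of \<open>C\<close> up to something that acts like an
  element of lower degree, to which the hypothesis applies.\<close>

lemma Tc_spanned:
  assumes C: "C \<subseteq> abs_uea ` (\<Union>j. homogeneous j)" "uvs.span (C \<union> fusion_kernel) = UNIV"
  shows "Tc p \<in> fvs.span ((Tc \<circ> rep_uea) ` C)"
proof -
  define S where "S = fvs.span ((Tc \<circ> rep_uea) ` C)"
  have S: "fvs.subspace S" by (simp add: S_def)
  have S0: "0 \<in> S" by (rule fvs.subspace_0[OF S])
  \<comment> \<open>For a combination of \<open>C\<close> all homogeneous components must have
    coordinates in \<open>S\<close>. This is where \<open>C\<close> has to be homogeneous: a
    component of a member of \<open>C\<close> is that member or 0.\<close>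
  define A where "A = {u. \<exists>a. abs_uea a = u \<and> (\<forall>j. Tc (component j a) \<in> S)}"
  have "uvs.subspace A"
    unfolding uvs.subspace_def
  proof (intro conjI ballI allI)
    show "0 \<in> A" unfolding A_def using S0 by (auto intro!: exI[of _ 0] simp: abs_uea_0)
  next
    fix a b assume "a \<in> A" "b \<in> A"
    then obtain a' b' where "abs_uea a' = a" "abs_uea b' = b"
      and *: "\<And>j. Tc (component j a') \<in> S" "\<And>j. Tc (component j b') \<in> S" by (auto simp: A_def)
    thus "a + b \<in> A" unfolding A_def
      using fvs.subspace_add[OF S *]
      by (intro CollectI exI[of _ "a' + b'"]) (simp only: abs_uea_add component_add Tc_add simp_thms)
  next
    fix a c assume "a \<in> A"
    then obtain a' where "abs_uea a' = a" and *: "\<And>j. Tc (component j a') \<in> S" by (auto simp: A_def)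
    thus "uscalar c * a \<in> A" unfolding A_def
      using fvs.subspace_scale[OF S *]
      by (auto intro!: exI[of _ "free_scalar c * a'"] simp: abs_uea_mult abs_uea_scalar component_scalar_mult Tc_scalar)
  qed
  moreover have "C \<subseteq> A"
  proof
    fix u assume u: "u \<in> C"
    then obtain a i where a: "u = abs_uea a" "a \<in> homogeneous i" using C(1) by auto
    have "Tc (rep_uea u) = Tc a"
      using Tc_uea_ideal[OF rep_abs_uea[of a]] a(1) by (simp add: Tc_diff)
    hence "Tc a \<in> S" unfolding S_def using u by (auto intro!: fvs.span_base image_eqI[of _ _ u])
    thus "u \<in> A" unfolding A_def using S0 a by (auto intro!: exI[of _ a] simp: component_homogeneous)
  qed
  ultimately have span: "uvs.span C \<subseteq> A" by (simp add: uvs.span_minimal)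
  interpret K: uea_left_ideal fusion_kernel by (rule fusion_kernel_ideal)
  have hom: "Tc p \<in> S" if "p \<in> homogeneous j" for p j
    using that
  proof (induction j arbitrary: p rule: less_induct)
    case (less j)
    have "abs_uea p \<in> uvs.span (C \<union> fusion_kernel)" using C(2) by simp
    then obtain a b where ab: "abs_uea p = a + b" "a \<in> uvs.span C" "b \<in> fusion_kernel"
      using K.subspace unfolding uvs.span_Un uvs.span_eq_iff[symmetric] by auto
    then obtain a' where a': "abs_uea a' = a" "\<And>j. Tc (component j a') \<in> S" using span by (auto simp: A_def)
    have "abs_uea (p - a') = b" using ab(1) a'(1) by (simp add: abs_uea_diff)
    hence "Psi (p - a') = Psi 0" using ab(3) abs_in_fusion_kernel[of "p - a'"] by simp
    hence "Tc (component j (p - a')) \<in> Tc ` degree_less j" by (simp add: Psi_eq_iff)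
    then obtain d where d: "d \<in> degree_less j" "Tc (component j (p - a')) = Tc d" by auto
    have "Tc d = (\<Sum>i\<in>{i. component i d \<noteq> 0}. Tc (component i d))"
      using sum_components[OF finite_components, of d d] by (metis Tc_sum order_refl)
    also have "\<dots> \<in> S"
    proof (rule fvs.subspace_sum[OF S])
      fix i assume "i \<in> {i. component i d \<noteq> 0}"
      then obtain w where "Poly_Mapping.lookup (component i d) w \<noteq> 0"
        by (metis lookup_zero mem_Collect_eq poly_mapping_eqI)
      hence "i < j" using d(1) by (auto simp: lookup_component degree_less_def in_keys_iff split: if_splits)
      thus "Tc (component i d) \<in> S" using less.IH homogeneous_component by blast
    qed
    finally have "Tc d + Tc (component j a') \<in> S" using a'(2) by (intro fvs.subspace_add[OF S])
    moreover have "Tc p = Tc d + Tc (component j a')"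
      unfolding d(2)[symmetric] component_diff Tc_diff component_homogeneous[OF less.prems] by simp
    ultimately show ?case by (simp only:)
  qed
  have "Tc p = (\<Sum>i\<in>{i. component i p \<noteq> 0}. Tc (component i p))"
    using sum_components[OF finite_components, of p p] by (metis Tc_sum order_refl)
  also have "\<dots> \<in> S"
    using hom homogeneous_component by (intro fvs.subspace_sum[OF S]) blast
  finally show ?thesis unfolding S_def .
qed

lemma card_box: "finite box" "card box = osp_dim ms"
proof -
  have "box = listset (map (\<lambda>m. {..2 * m}) ms)"
    by (auto simp: box_def in_listset_iff)
  moreover have "finite (listset (map (\<lambda>m. {..2 * m}) l)) \<and> card (listset (map (\<lambda>m. {..2 * m}) l)) = osp_dim l" for l :: "nat list"
  proof (induction l)
    case (Cons m l)
    have "set_Cons A B = (\<lambda>(a, b). a # b) ` (A \<times> B)" for A :: "nat set" and B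
      by (auto simp: set_Cons_def)
    moreover have "inj_on (\<lambda>(a, b). a # b) (A \<times> B)" for A :: "nat set" and B
      by (auto simp: inj_on_def)
    ultimately show ?case using Cons by (simp add: card_image osp_dim_def card_cartesian_product)
  qed (simp add: osp_dim_def)
  ultimately show "finite box" "card box = osp_dim ms" by simp_all
qed

lemma delta_independent: "fvs.independent (delta ` box)" "card (delta ` box) = osp_dim ms"
proof -
  have inj: "inj_on delta box"
  proof (rule inj_onI)
    fix as bs assume "delta as = delta bs"
    hence "delta as as = delta bs as" by simp
    thus "as = bs" by (simp add: delta_def split: if_splits)
  qed
  thus "card (delta ` box) = osp_dim ms" by (simp add: card_image card_box)
  show "fvs.independent (delta ` box)"
  proof (rule fvs.independent_if_scalars_zero)
    fix f x assume *: "(\<Sum>x\<in>delta ` box. (\<lambda>bs. f x * x bs)) = 0" "x \<in> delta ` box"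
    then obtain as where as: "x = delta as" "as \<in> box" by auto
    have "(\<Sum>bs\<in>box. f (delta bs) * delta bs as) = 0"
      using fun_cong[OF *(1), of as] by (simp add: sum_fun_apply sum.reindex[OF inj])
    also have "(\<Sum>bs\<in>box. f (delta bs) * delta bs as) = (\<Sum>bs\<in>box. if bs = as then f (delta as) else 0)"
      by (intro sum.cong) (auto simp: delta_def)
    also have "\<dots> = f (delta as)" using as(2) card_box(1) by simp
    finally show "f x = 0" using as(1) by simp
  qed (simp add: card_box)
qed

text \<open>If the left ideals differed then one of the \<open>osp_dim ms\<close> spanning vectors could be dropped,
  which contradicts the independence of the vectors \<open>delta as\<close>.\<close>

theorem fusion_kernel_eq:
  assumes R: "R \<subseteq> fusion_kernel" and dim: "orbit_dim_le (left_ideal R) 1 (osp_dim ms)"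
  shows "left_ideal R = fusion_kernel"
proof (rule ccontr)
  let ?I = "left_ideal R"
  interpret I: uea_left_ideal ?I by (rule left_ideal_uea_left_ideal)
  have sub: "?I \<subseteq> fusion_kernel" by (rule left_ideal_least[OF fusion_kernel_ideal R])
  assume "?I \<noteq> fusion_kernel"
  then obtain x where x: "x \<in> fusion_kernel" "x \<notin> ?I" using sub by auto
  obtain B where B: "finite B" "card B \<le> osp_dim ms" "\<forall>u. u * 1 \<in> uvs.span (B \<union> ?I)"
    using dim unfolding orbit_dim_le_def by blast
  hence "uvs.span (B \<union> ?I) = UNIV" by auto
  from uvs.spanning_set_shrink[OF B(1) this I.subspace sub x]
  obtain b where b: "b \<in> B" "uvs.span ((B - {b}) \<union> fusion_kernel) = UNIV" by auto
  from uvs.spanning_set_replace[OF _ span_homogeneous b(2)] B(1)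
  obtain C where C: "C \<subseteq> abs_uea ` (\<Union>j. homogeneous j)" "finite C" "card C \<le> card (B - {b})"
    "uvs.span (C \<union> fusion_kernel) = UNIV" by auto
  have "delta ` box \<subseteq> fvs.span ((Tc \<circ> rep_uea) ` C)"
  proof
    fix g assume "g \<in> delta ` box"
    then obtain p where "Tc p = g" using delta_in_range by auto
    thus "g \<in> fvs.span ((Tc \<circ> rep_uea) ` C)" using Tc_spanned[OF C(1,4), of p] by simp
  qed
  from fvs.independent_span_bound[OF _ delta_independent(1) this] C(2)
  have "osp_dim ms \<le> card ((Tc \<circ> rep_uea) ` C)" by (simp add: delta_independent(2))
  also have "\<dots> \<le> card C" by (rule card_image_le[OF C(2)])
  also have "\<dots> < osp_dim ms" using C(3) B(1,2) b(1) by (meson card_Diff1_less le_less_trans less_le_trans)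
  finally show False by simp
qed

end

section \<open>From equal left ideals to isomorphic modules\<close>

lemma regular_module_simps:
  "carrier regular_module = UNIV" "add regular_module = (+)" "\<zero>\<^bsub>regular_module\<^esub> = 0"
  "module.smult regular_module c u = uscalar c * u" "act regular_module g u = ugen g * u"
  "part regular_module b = uea_parity b"
  by (simp_all add: regular_module_def part_def)

lemma regular_module_concrete:
  assumes "uea_left_ideal K"
  shows "concrete_module regular_module K"
proof -
  interpret uea_left_ideal K by fact
  show ?thesis
    by unfold_locales (simp_all add: regular_module_simps distrib_left zero add mult uminus)
qed

lemma lin_ext_left_mult:
  "lin_ext (\<lambda>w c. uscalar c * foldr (\<lambda>g u. ugen g * u) (letters w) u) p = abs_uea p * u"
proof (induction p rule: poly_mapping_additive_induct)
  case (single w c)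
  have "foldr (\<lambda>g u. ugen g * u) gs u = prod_list (map ugen gs) * u" for gs
    by (induction gs) (simp_all add: mult.assoc)
  thus ?case
    by (cases w) (simp add: lin_ext_single abs_uea_single mult.assoc)
next
  case (add p q)
  thus ?case by (subst lin_ext_add) (simp_all add: uscalar_add distrib_right abs_uea_add)
qed

lemma hw_mod_one:
  assumes "highest_weight_relations n \<subseteq> K"
  shows "hw_mod K n 1"
proof -
  have "ugen (Hal, s) - uscalar (if s = 0 then of_nat n else 0) \<in> K" for s
    using assms unfolding highest_weight_relations_def by blast
  note this[of 0] this[of "Suc s" for s]
  moreover have "xg s \<in> K" for s
    using assms unfolding highest_weight_relations_def by blast
  ultimately show ?thesis
    unfolding hw_mod_def by (auto simp: uscalar_of_nat gr0_conv_Suc)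
qed

context osp_tensor
begin

lemma Psi_diff_eq_zero: "Psi (p - q) = Psi 0 \<longleftrightarrow> Psi p = Psi q"
  by (simp add: Psi_eq_iff)

lemma Psi_rep_uea: "Psi (rep_uea (abs_uea p)) = Psi p"
  by (rule Psi_uea_ideal[OF rep_abs_uea])

theorem presented_module_iso:
  assumes R: "left_ideal R = fusion_kernel"
  shows "presented_module R \<cong>\<^sub>U GR"
proof -
  interpret Rg: concrete_module regular_module "left_ideal R"
    by (rule regular_module_concrete[OF left_ideal_uea_left_ideal])
  let ?P = "presented_module R"
  interpret P: module_image ?P Rg.cls UNIV "\<lambda>c u. uscalar c * u" "\<lambda>g u. ugen g * u"
  proof
    show "carrier ?P = range Rg.cls" "Rg.cls 0 = \<zero>\<^bsub>?P\<^esub>" "Rg.cls (a + b) = Rg.cls a \<oplus>\<^bsub>?P\<^esub> Rg.cls b"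
      "Rg.cls (uscalar c * a) = c \<odot>\<^bsub>?P\<^esub> Rg.cls a" "Rg.cls (ugen g * a) = act ?P g (Rg.cls a)" for a b c g
      unfolding presented_module_def
      by (simp_all only: Rg.quotient_carrier Rg.quotient_zero Rg.quotient_add Rg.quotient_smult
          Rg.quotient_act regular_module_simps UNIV_I)
  qed simp_all
  have cls: "Rg.cls u = Rg.cls w \<longleftrightarrow> Psi (rep_uea u) = Psi (rep_uea w)" for u w
    using abs_in_fusion_kernel[of "rep_uea u - rep_uea w"]
    unfolding Rg.cls_cong unfolding R by (simp add: abs_uea_diff abs_rep_uea Psi_diff_eq_zero)
  define f where "f = (\<lambda>X. Psi (rep_uea (SOME u. X = Rg.cls u)))"
  have f: "f (Rg.cls u) = Psi (rep_uea u)" for u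
    unfolding f_def cls[symmetric] by (rule someI2[of _ u]) simp_all
  have f_abs: "f (Rg.cls (abs_uea p)) = Psi p" for p
    by (simp add: f Psi_rep_uea)
  have abs: "\<exists>p. X = Rg.cls (abs_uea p)" if "X \<in> carrier ?P" for X
    using that abs_rep_uea unfolding P.carrier by (metis imageE)
  show ?thesis
    unfolding uea_iso_def
  proof (intro exI[of _ f] conjI ballI allI)
    show "bij_betw f (carrier ?P) (carrier GR)"
      unfolding bij_betw_def
    proof
      show "inj_on f (carrier ?P)"
        unfolding P.carrier by (rule inj_onI, elim imageE) (simp only: f cls)
      have "Psi p \<in> f ` carrier ?P" for p
        unfolding P.carrier using f_abs[of p] by (metis UNIV_I image_eqI)
      thus "f ` carrier ?P = carrier GR"
        unfolding carrier_GR by (auto simp: f P.carrier)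
    qed
  next
    fix X Y assume "X \<in> carrier ?P" "Y \<in> carrier ?P"
    then obtain p q where "X = Rg.cls (abs_uea p)" "Y = Rg.cls (abs_uea q)" using abs by blast
    moreover from this have "X \<oplus>\<^bsub>?P\<^esub> Y = Rg.cls (abs_uea (p + q))"
      using P.add by (simp add: abs_uea_add)
    ultimately show "f (X \<oplus>\<^bsub>?P\<^esub> Y) = f X \<oplus>\<^bsub>GR\<^esub> f Y" by (simp only: f_abs Psi_add)
  next
    fix c X assume "X \<in> carrier ?P"
    then obtain p where "X = Rg.cls (abs_uea p)" using abs by blast
    moreover from this have "c \<odot>\<^bsub>?P\<^esub> X = Rg.cls (abs_uea (free_scalar c * p))"
      using P.sc by (simp add: abs_uea_mult abs_uea_scalar)
    ultimately show "f (c \<odot>\<^bsub>?P\<^esub> X) = c \<odot>\<^bsub>GR\<^esub> f X" by (simp only: f_abs Psi_smult)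
  next
    fix u X assume "X \<in> carrier ?P"
    then obtain p where "X = Rg.cls (abs_uea p)" using abs by blast
    moreover from this have "uea_act ?P u X = Rg.cls (abs_uea (rep_uea u * p))"
      unfolding uea_act_def using P.free_act_image[of "abs_uea p" "rep_uea u"]
      by (simp add: lin_ext_left_mult abs_uea_mult)
    ultimately show "f (uea_act ?P u X) = uea_act GR u (f X)"
      by (simp only: f_abs uea_act_def free_act_GR)
  next
    fix b X assume "X \<in> part ?P b"
    then obtain q where "q \<in> word_parity b" "X = Rg.cls (abs_uea q)"
      unfolding presented_module_def Rg.quotient_part regular_module_simps
      by (auto simp: uea_parity_def word_parity_def)
    thus "f X \<in> part GR b" using Psi_parity by (simp only: f_abs)
  qed
qed

lemma fusion_product_eq: "fusion_product (map (\<lambda>m. (V m, v m)) ms) zs = GR"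
  by (simp add: fusion_product_def o_def)

lemma highest_weight_relations_kernel: "highest_weight_relations (sum_list ms) \<subseteq> fusion_kernel"
proof -
  have "ugen (x, s) \<in> fusion_kernel" if "x \<in> {Xap, Xdp}" for x s
    using Psi_raising[OF that] abs_in_fusion_kernel[of "free_gen (x, s)"] by (simp add: abs_uea_gen)
  moreover have "ugen (Hal, s) - uscalar (if s = 0 then of_nat (sum_list ms) else 0) \<in> fusion_kernel" for s
    using Psi_Hal[of s] unfolding abs_in_fusion_kernel[symmetric] abs_uea_diff abs_uea_gen abs_uea_scalar .
  ultimately show ?thesis unfolding highest_weight_relations_def by blast
qed

lemma truncation_kernel: "r \<le> s \<Longrightarrow> ugen (x, s) \<in> fusion_kernel"
  using Psi_truncation[of s x] abs_in_fusion_kernel[of "free_gen (x, s)"] by (simp add: abs_uea_gen)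

lemma lowering_power_kernel:
  "(\<Sum>i\<in>{s..<r}. ms ! i) \<le> c \<Longrightarrow> ugen (Xam, s) ^ (c + 1) \<in> fusion_kernel"
  using Psi_lowering_power[of s c]
  unfolding abs_in_fusion_kernel[symmetric] abs_uea_power abs_uea_gen .

text \<open>What remains for each presentation: its relations hold in the fusion product, and they
  imply the truncations given by the partition.\<close>

lemma fusion_kernel_eq_if_frels:
  assumes R: "R \<subseteq> fusion_kernel" "highest_weight_relations (sum_list ms) \<subseteq> R"
    and f: "frels (left_ideal R) (min_sum ms) 1"
  shows "left_ideal R = fusion_kernel"
proof (rule fusion_kernel_eq[OF R(1)])
  have "hw_mod (left_ideal R) (sum_list ms) 1"
    using left_ideal_superset R(2) by (blast intro: hw_mod_one)
  thus "orbit_dim_le (left_ideal R) 1 (osp_dim ms)"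
    using bounded_profile[of ms] left_ideal_uea_left_ideal f unfolding bounded_profile_def by blast
qed

end

section \<open>The three isomorphisms\<close>

lemma min_sum_append: "min_sum (xs @ ys) r = min_sum xs r + min_sum ys r"
  by (simp add: min_sum_def)

lemma min_sum_replicate: "min_sum (replicate m x) r = m * min r x"
  by (simp add: min_sum_def sum_list_replicate)

context uea_left_ideal
begin

text \<open>A product of \<open>r\<close> factors of degree at most \<open>L\<close> cannot have
  degree above \<open>L * r\<close>, and factors of larger degree can be moved next to
  \<open>v\<close>.\<close>

lemma fpow_degree_bound:
  assumes "\<And>p. L < p \<Longrightarrow> fg p * v \<in> K" "L * r < s"
  shows "fpow r s * v \<in> K"
  using assms(2)
proof (induction r arbitrary: s)
  case 0
  thus ?case by (simp add: zero)
next
  case (Suc r)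
  have "fg p * fpow r (s - p) * v \<in> K" for p
  proof (cases "p \<le> L")
    case True
    hence "fpow r (s - p) * v \<in> K" using Suc by (intro Suc.IH) simp
    from mult[OF this, of "fg p"] show ?thesis by (simp add: mult.assoc)
  next
    case False
    from mult[OF assms(1), of p "fpow r (s - p)"] False show ?thesis
      by (simp add: fg_fpow_commute mult.assoc)
  qed
  thus ?case by (simp add: sum_distrib_right sum)
qed

text \<open>The partition is as even as possible, so its profile is \<open>N * r\<close> up to
  \<open>r = k\<close> and constantly \<open>k * N + j\<close> afterwards. The first range is the
  truncation at t^N, the second is \<open>garland\<close>.\<close>

lemma truncated_weyl_frels:
  assumes hw: "hw_mod K (k * N + j) v" and f: "fg 0 ^ (k * N + j + 1) * v \<in> K"
    and trunc: "\<And>p. N \<le> p \<Longrightarrow> fg p * v \<in> K" and j: "j < N"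
  shows "frels K (min_sum (replicate (N - j) k @ replicate j (k + 1))) v"
  unfolding frels_def
proof (intro allI impI)
  fix r s assume *: "min_sum (replicate (N - j) k @ replicate j (k + 1)) r < r + s"
  have le: "(N - j) * x + j * x = N * x" for x
    using j by (simp flip: add_mult_distrib)
  show "fpow r s * v \<in> K"
  proof (cases "r \<le> k")
    case True
    hence "N * r < r + s" using * le[of r] by (simp add: min_sum_append min_sum_replicate min_def)
    hence "(N - 1) * r < s" using j by (cases N) simp_all
    thus ?thesis using trunc by (intro fpow_degree_bound[of "N - 1"]) simp
  next
    case False
    hence "(N - j) * min r k + j * min r (k + 1) = N * k + j"
      using le[of k] by (simp add: min_absorb2)
    hence "k * N + j < r + s"
      using * by (simp add: min_sum_append min_sum_replicate mult.commute)
    thus ?thesis by (rule garland[OF hw f])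
  qed
qed

text \<open>The profile has slope \<open>k + 1\<close> up to \<open>r = j\<close>, then slope
  \<open>k\<close> up to \<open>N\<close>, then is constant. The three ranges come from the
  relations for \<open>p > k\<close>, whose exponent is 1, for \<open>p = k\<close>, whose exponent
  is \<open>j + 1\<close>, and for \<open>p = 0\<close>, through \<open>garland\<close>.\<close>

lemma demazure_frels:
  assumes hw: "hw_mod K (k * N + j) v" and f: "\<And>p. fg p ^ (k * N + j - N * p + 1) * v \<in> K"
    and j: "j < N"
  shows "frels K (min_sum (replicate k N @ [j])) v"
  unfolding frels_def
proof (intro allI impI)
  fix r s assume *: "min_sum (replicate k N @ [j]) r < r + s"
  have trunc: "fg p * v \<in> K" if "k < p" for p
  proof -
    have "k * N + j < N * (k + 1)" using j by simp
    also have "\<dots> \<le> N * p" using that by (intro mult_le_mono2) simp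
    finally show ?thesis using f[of p] by simp
  qed
  consider "r \<le> j" | "j < r" "r < N" "0 < k" | "N \<le> r \<or> j < r \<and> k = 0" by linarith
  thus "fpow r s * v \<in> K"
  proof cases
    case 1
    hence "k * r < s" using * j by (simp add: min_sum_append min_sum_replicate min_def)
    with trunc show ?thesis by (rule fpow_degree_bound)
  next
    case 2
    hence "k * r + (j + 1) \<le> r + s" using * by (simp add: min_sum_append min_sum_replicate min_def)
    from fpow_concentrated[OF 2(3) trunc this]
    obtain a u where "a \<in> K" "fpow r s * v = a + u * (fg k ^ (j + 1) * v)"
      by (auto simp: ideal_plus_def)
    moreover have "fg k ^ (j + 1) * v \<in> K" using f[of k] by (simp add: mult.commute)
    ultimately show ?thesis using add mult by simp
  next
    case 3
    hence "k * N + j < r + s" using * j by (auto simp: min_sum_append min_sum_replicate min_absorb2)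
    moreover have "fg 0 ^ (k * N + j + 1) * v \<in> K" using f[of 0] by simp
    ultimately show ?thesis by (intro garland[OF hw])
  qed
qed

text \<open>For \<open>r > 0\<close> the profile is constantly \<open>n\<close>, so
  \<open>garland\<close> gives everything; for \<open>r = 0\<close> and \<open>s > 0\<close> the
  coefficient itself is 0.\<close>

lemma weyl_frels:
  assumes hw: "hw_mod K n v" and f: "fg 0 ^ (n + 1) * v \<in> K"
  shows "frels K (min_sum (replicate n 1 @ [0])) v"
  unfolding frels_def
proof (intro allI impI)
  fix r s assume *: "min_sum (replicate n 1 @ [0]) r < r + s"
  show "fpow r s * v \<in> K"
  proof (cases r)
    case 0
    thus ?thesis using * by (simp add: zero)
  next
    case (Suc r')
    hence "n < r + s" using * by (simp add: min_sum_append min_sum_replicate)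
    thus ?thesis by (rule garland[OF hw f])
  qed
qed

end

context osp_tensor
begin

lemma sum_nth_ms: "(\<Sum>i\<in>{0..<r}. ms ! i) = sum_list ms"
  by (simp add: sum_list_sum_nth)

lemma truncated_weyl_left_ideal:
  assumes ms: "ms = replicate (N - j) k @ replicate j (k + 1)" and j: "j < N" and n: "n = k * N + j"
  shows "left_ideal (highest_weight_relations n \<union> {ugen (Xam, 0) ^ (n + 1)} \<union> {ugen (x, s) | x s. N \<le> s})
    = fusion_kernel" (is "left_ideal ?R = _")
proof (rule fusion_kernel_eq_if_frels)
  have N: "r = N" using ms j by simp
  have "(N - j) * k + j * k = N * k" using j by (simp flip: add_mult_distrib)
  hence n': "n = sum_list ms" using n by (simp add: ms sum_list_replicate)
  show "?R \<subseteq> fusion_kernel"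
    using highest_weight_relations_kernel lowering_power_kernel[of 0 n] truncation_kernel sum_nth_ms
    unfolding n' N by auto
  show hw: "highest_weight_relations (sum_list ms) \<subseteq> ?R" unfolding n' by blast
  interpret uea_left_ideal "left_ideal ?R" by (rule left_ideal_uea_left_ideal)
  have sub: "?R \<subseteq> left_ideal ?R" by (rule left_ideal_superset)
  show "frels (left_ideal ?R) (min_sum ms) 1"
    unfolding ms
  proof (rule truncated_weyl_frels[OF _ _ _ j])
    show "hw_mod (left_ideal ?R) (k * N + j) 1"
      using hw sub unfolding n'[symmetric] n by (intro hw_mod_one) blast
    show "fg 0 ^ (k * N + j + 1) * 1 \<in> left_ideal ?R" using sub unfolding n by auto
    show "fg p * 1 \<in> left_ideal ?R" if "N \<le> p" for p using sub that by auto
  qed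
qed

lemma demazure_left_ideal:
  assumes ms: "ms = replicate k N @ [j]" and j: "j < N" and n: "n = k * N + j"
  shows "left_ideal (highest_weight_relations n \<union> {ugen (Xam, s) ^ ((n - N * s) + 1) | s. True})
    = fusion_kernel" (is "left_ideal ?R = _")
proof (rule fusion_kernel_eq_if_frels)
  have n': "n = sum_list ms" by (simp add: ms n sum_list_replicate)
  have "ugen (Xam, s) ^ ((n - N * s) + 1) \<in> fusion_kernel" for s
  proof (rule lowering_power_kernel)
    \<comment> \<open>The parts \<open>N\<close> stand before the smaller part \<open>j\<close>, so
      leaving out the first \<open>s\<close> of them subtracts exactly \<open>N * s\<close>; beyond
      \<open>k\<close> parts nothing exceeds the truncated difference.\<close>
    show "(\<Sum>i\<in>{s..<r}. ms ! i) \<le> n - N * s"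
    proof (cases "s \<le> k")
      case True
      then obtain d where d: "k = s + d" by (auto simp: le_iff_add)
      hence "(\<Sum>i\<in>{s..<r}. ms ! i) = d * N + j"
        by (simp add: ms nth_append)
      thus ?thesis by (simp add: n d algebra_simps)
    qed (simp add: ms)
  qed
  thus "?R \<subseteq> fusion_kernel" using highest_weight_relations_kernel unfolding n' by auto
  show hw: "highest_weight_relations (sum_list ms) \<subseteq> ?R" unfolding n' by blast
  interpret uea_left_ideal "left_ideal ?R" by (rule left_ideal_uea_left_ideal)
  have sub: "?R \<subseteq> left_ideal ?R" by (rule left_ideal_superset)
  show "frels (left_ideal ?R) (min_sum ms) 1"
    unfolding ms
  proof (rule demazure_frels[OF _ _ j])
    show "hw_mod (left_ideal ?R) (k * N + j) 1"
      using hw sub unfolding n'[symmetric] n by (intro hw_mod_one) blast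
    show "fg p ^ (k * N + j - N * p + 1) * 1 \<in> left_ideal ?R" for p
      using sub unfolding n mult_1_right by blast
  qed
qed

lemma weyl_left_ideal:
  assumes ms: "ms = replicate n 1 @ [0]"
  shows "left_ideal (highest_weight_relations n \<union> {ugen (Xam, 0) ^ (n + 1)}) = fusion_kernel"
    (is "left_ideal ?R = _")
proof (rule fusion_kernel_eq_if_frels)
  have n': "n = sum_list ms" by (simp add: ms sum_list_replicate)
  show "?R \<subseteq> fusion_kernel"
    using highest_weight_relations_kernel lowering_power_kernel[of 0 n] sum_nth_ms unfolding n' by auto
  show hw: "highest_weight_relations (sum_list ms) \<subseteq> ?R" unfolding n' by blast
  interpret uea_left_ideal "left_ideal ?R" by (rule left_ideal_uea_left_ideal)
  have sub: "?R \<subseteq> left_ideal ?R" by (rule left_ideal_superset)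
  show "frels (left_ideal ?R) (min_sum ms) 1"
    unfolding ms
  proof (rule weyl_frels)
    show "hw_mod (left_ideal ?R) n 1"
      using hw sub unfolding n'[symmetric] by (intro hw_mod_one) blast
    show "fg 0 ^ (n + 1) * 1 \<in> left_ideal ?R" using sub by auto
  qed
qed

end

lemma uea_iso_refl: "M \<cong>\<^sub>U M"
  unfolding uea_iso_def by (rule exI[of _ "\<lambda>X. X"]) (simp add: bij_betw_def)

theorem mainTheorem2:
  fixes V :: "nat \<Rightarrow> (osp, 'v) supermodule" and v :: "nat \<Rightarrow> 'v" and n N k j :: nat
  assumes V: "\<And>m. irreducible_highest_weight (V m) m (v m)"
    and N: "1 \<le> N" and n: "n = k * N + j" and j: "j < N"
  shows "(\<forall>zs. length zs = N \<and> distinct zs \<longrightarrow>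
            truncated_weyl_module n N \<cong>\<^sub>U
              fusion_product (replicate (N - j) (V k, v k) @ replicate j (V (k + 1), v (k + 1))) zs) \<and>
         weyl_module n \<cong>\<^sub>U demazure_module 1 n \<and>
         (\<forall>zs. length zs = k + 1 \<and> distinct zs \<longrightarrow>
            demazure_module N n \<cong>\<^sub>U fusion_product (replicate k (V N, v N) @ [(V j, v j)]) zs)"
proof (intro conjI allI impI)
  fix zs :: "complex list" assume zs: "length zs = N \<and> distinct zs"
  define ms where "ms = replicate (N - j) k @ replicate j (k + 1)"
  interpret osp_tensor ms zs V v
    by unfold_locales (use V zs j in \<open>simp_all add: ms_def\<close>)
  have "truncated_weyl_module n N \<cong>\<^sub>U GR"
    unfolding truncated_weyl_module_def
    by (rule presented_module_iso[OF truncated_weyl_left_ideal[OF ms_def j n]])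
  thus "truncated_weyl_module n N \<cong>\<^sub>U
      fusion_product (replicate (N - j) (V k, v k) @ replicate j (V (k + 1), v (k + 1))) zs"
    unfolding fusion_product_eq[symmetric] by (simp add: ms_def map_replicate)
next
  define ms :: "nat list" where "ms = replicate n 1 @ [0]"
  \<comment> \<open>Any \<open>n + 1\<close> distinct numbers will do, since the parameters do not
    occur in the claim.\<close>
  define zs where "zs = map (of_nat :: nat \<Rightarrow> complex) [0..<n + 1]"
  interpret osp_tensor ms zs V v
    by unfold_locales (use V in \<open>simp_all add: ms_def zs_def distinct_map inj_on_def del: upt_Suc\<close>)
  \<comment> \<open>The part 0 gives the partition the shape of the Demazure case with
    \<open>N = 1\<close>, \<open>k = n\<close>, \<open>j = 0\<close>. Both left ideals are then the
    same kernel, and the two modules are equal.\<close>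
  have "left_ideal (highest_weight_relations n \<union> {ugen (Xam, 0) ^ (n + 1)})
      = left_ideal (highest_weight_relations n \<union> {ugen (Xam, s) ^ ((n - 1 * s) + 1) | s. True})"
    using weyl_left_ideal[OF ms_def] demazure_left_ideal[OF ms_def, of n] by simp
  hence "weyl_module n = demazure_module 1 n"
    unfolding weyl_module_def demazure_module_def presented_module_def by (simp only:)
  thus "weyl_module n \<cong>\<^sub>U demazure_module 1 n" by (simp only: uea_iso_refl)
next
  fix zs :: "complex list" assume zs: "length zs = k + 1 \<and> distinct zs"
  define ms where "ms = replicate k N @ [j]"
  interpret osp_tensor ms zs V v
    by unfold_locales (use V zs in \<open>simp_all add: ms_def\<close>)
  have "demazure_module N n \<cong>\<^sub>U GR"
    unfolding demazure_module_def
    by (rule presented_module_iso[OF demazure_left_ideal[OF ms_def j n]])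
  thus "demazure_module N n \<cong>\<^sub>U fusion_product (replicate k (V N, v N) @ [(V j, v j)]) zs"
    unfolding fusion_product_eq[symmetric] by (simp add: ms_def map_replicate)
qed

end
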